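(* Let $m>0$, let $\eta,\tau\in\mathbb{R}$ satisfy $\eta^2-\tau^2=4$, and for $\Xi\in L^2(\mathbb{R},dk)$ let $\psi_\Xi\in L^2(\mathbb{R}^2;\mathbb{C}^2)$ be $$\psi_{\Xi}(x,y)=\frac{1}{2\sqrt{\pi}}\big[\theta(x)\,\Lambda_{\eta,\tau}+\theta(-x)\,\sigma_0\big]\int_{\mathbb{R}}dk\,\begin{pmatrix}\sqrt{\left(1-\frac{\tau}{\eta}\right)\left(\sqrt{k^2+\frac{4m^2}{\eta^2}}+k\right)}\\[4pt] -i\,\sqrt{\left(1+\frac{\tau}{\eta}\right)\left(\sqrt{k^2+\frac{4m^2}{\eta^2}}-k\right)}\end{pmatrix}\Xi(k)\,e^{iky-\sqrt{k^2+\frac{4m^2}{\eta^2}}\,|x|}.$$ Then $\psi_\Xi\in\mathrm{dom}(x)$, and $$\psi_\Xi\in\mathrm{dom}(y)\quad\text{if and only if}\quad \Xi,\ \partial_k\Xi\in L^2(\mathbb{R},dk).$$ Moreover, for any admissible $\Xi$ with $\|\Xi\|_{L^2(\mathbb{R},dk)}=1$ (that is, any $\Xi\in L^2(\mathbb{R},dk)$ of unit norm and, for the identities concerning $y$, with in addition $\partial_k\Xi\in L^2(\mathbb{R},dk)$), the following identities hold: $$\langle\sigma_3\rangle_\Xi=-\frac{\tau}{\eta},\qquad \langle(\Delta\sigma_3)^2\rangle_\Xi=\frac{4}{\eta^2};$$ $$\langle x\rangle_\Xi=\frac{\tau}{2\eta}\Big\langle\Xi,\tfrac{k}{k^2+4m^2/\eta^2}\,\Xi\Big\rangle,\qquad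 \langle(\Delta x)^2\rangle_\Xi=\frac12\Big\|\tfrac{1}{\sqrt{k^2+4m^2/\eta^2}}\,\Xi\Big\|^2-\frac{\tau^2}{4\eta^2}\Big(\Big\langle\Xi,\tfrac{k}{k^2+4m^2/\eta^2}\,\Xi\Big\rangle\Big)^2;$$ $$\langle y\rangle_\Xi=\langle\Xi,i\partial_k\Xi\rangle,\qquad \langle(\Delta y)^2\rangle_\Xi=\|i\partial_k\Xi\|^2+\frac14\Big\|\tfrac{1}{\sqrt{k^2+4m^2/\eta^2}}\,\Xi\Big\|^2-\big(\langle\Xi,i\partial_k\Xi\rangle\big)^2;$$ $$\langle v_x\rangle_\Xi=\langle v_y\rangle_\Xi=0,\qquad \langle(\Delta v_x)^2\rangle_\Xi=\langle(\Delta v_y)^2\rangle_\Xi=1.$$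
   Context: $\sigma_0$ is the $2\times2$ identity matrix and $\sigma_1=\begin{pmatrix}0&1\\1&0\end{pmatrix}$, $\sigma_2=\begin{pmatrix}0&-i\\i&0\end{pmatrix}$, $\sigma_3=\begin{pmatrix}1&0\\0&-1\end{pmatrix}$ are the Pauli matrices; $\theta$ is the Heaviside step function. The matrix $\Lambda_{\eta,\tau}$ is $$\Lambda_{\eta,\tau}=\left[i\sigma_1-\tfrac12(\eta\sigma_0+\tau\sigma_3)\right]^{-1}\left[i\sigma_1+\tfrac12(\eta\sigma_0+\tau\sigma_3)\right].$$ The functions $\psi_\Xi$ satisfy $\|\psi_\Xi\|_{L^2(\mathbb{R}^2;\mathbb{C}^2)}=\|\Xi\|_{L^2(\mathbb{R},dk)}$; they are the eigenfunctions, with eigenvalue $-\tau m/\eta$, of the two-dimensional Dirac operator with critical electrostatic and Lorentz-scalar $\delta$-interaction supported on the line $\{x=0\}$. Position operators: $x$ and $y$ act by multiplication, with $\mathrm{dom}(x)=\{\psi\in L^2(\mathbb{R}^2;\mathbb{C}^2)\mid x\psi\in L^2\}$ and $\mathrm{dom}(y)=\{\psi\in L^2(\mathbb{R}^2;\mathbb{C}^2)\mid y\psi\in L^2\}$. Velocity operators: $v_x=\sigma_1$, $v_y=\sigma_2$ (bounded). For an observable $\mathcal{O}\in\{\sigma_3,x,y,v_x,v_y\}$ and normalized $\psi_\Xi$ in its domain, $$\langle\mathcal{O}\rangle_\Xi:=\langle\psi_\Xi,\mathcal{O}\psi_\Xi\rangle_{L^2(\mathbb{R}^2;\mathbb{C}^2)},\qquad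 \langle(\Delta\mathcal{O})^2\rangle_\Xi:=\|\mathcal{O}\psi_\Xi\|^2-\langle\mathcal{O}\rangle_\Xi^2.$$ On the right-hand sides of the identities, inner products and norms are those of $L^2(\mathbb{R},dk)$ (antilinear in the first entry), $k$ denotes the variable of $\Xi$, and $\partial_k$ is the distributional derivative. *)

theory Defs
  imports "HOL-Analysis.Analysis"
begin

text \<open>Elements of \<open>L\<^sup>2\<close> are represented by Borel functions; no quotient by equality almost everywhere
  is formed.\<close>

definition L2 :: "'a measure \<Rightarrow> ('a \<Rightarrow> 'b::real_normed_vector) set" where
  "L2 M = {f \<in> borel_measurable M. integrable M (\<lambda>z. (norm (f z))\<^sup>2)}"

definition L2_norm :: "'a measure \<Rightarrow> ('a \<Rightarrow> 'b::real_normed_vector) \<Rightarrow> real" where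
  "L2_norm M f = sqrt (\<integral>z. (norm (f z))\<^sup>2 \<partial>M)"

definition L2_inner :: "(real \<Rightarrow> complex) \<Rightarrow> (real \<Rightarrow> complex) \<Rightarrow> complex" where
  "L2_inner f g = (\<integral>k. cnj (f k) * g k \<partial>lborel)"

type_synonym spinor_field = "real \<times> real \<Rightarrow> complex ^ 2"

definition spinor_inner :: "spinor_field \<Rightarrow> spinor_field \<Rightarrow> complex" where
  "spinor_inner \<phi> \<psi> = (\<integral>z. (\<Sum>i\<in>UNIV. cnj (\<phi> z $ i) * \<psi> z $ i) \<partial>lborel)"

definition test_function :: "(real \<Rightarrow> complex) \<Rightarrow> bool" where
  "test_function \<phi> \<longleftrightarrow>
     (\<exists>D. D (0::nat) = \<phi> \<and> (\<forall>n t. (D n has_vector_derivative D (Suc n) t) (at t))) \<and>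
     compact (closure {t. \<phi> t \<noteq> 0})"

definition locally_integrable :: "(real \<Rightarrow> complex) \<Rightarrow> bool" where
  "locally_integrable f \<longleftrightarrow> (\<forall>a b. set_integrable lborel {a..b} f)"

definition has_distributional_derivative ::
    "(real \<Rightarrow> complex) \<Rightarrow> (real \<Rightarrow> complex) \<Rightarrow> bool" where
  "has_distributional_derivative f g \<longleftrightarrow>
     locally_integrable f \<and> locally_integrable g \<and>
     (\<forall>\<phi>. test_function \<phi> \<longrightarrow>
        (\<integral>k. f k * vector_derivative \<phi> (at k) \<partial>lborel) = - (\<integral>k. g k * \<phi> k \<partial>lborel))"

definition \<sigma>\<^sub>0 :: "complex ^ 2 ^ 2" where
  "\<sigma>\<^sub>0 = mat 1"

definition \<sigma>\<^sub>1 :: "complex ^ 2 ^ 2" where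
  "\<sigma>\<^sub>1 = vector [vector [0, 1], vector [1, 0]]"

definition \<sigma>\<^sub>2 :: "complex ^ 2 ^ 2" where
  "\<sigma>\<^sub>2 = vector [vector [0, - \<i>], vector [\<i>, 0]]"

definition \<sigma>\<^sub>3 :: "complex ^ 2 ^ 2" where
  "\<sigma>\<^sub>3 = vector [vector [1, 0], vector [0, - 1]]"

type_synonym operator = "spinor_field \<Rightarrow> spinor_field"

definition matrix_op :: "complex ^ 2 ^ 2 \<Rightarrow> operator" where
  "matrix_op A \<psi> = (\<lambda>z. A *v \<psi> z)"

definition pos_x :: operator where
  "pos_x \<psi> = (\<lambda>(x, y). x *\<^sub>R \<psi> (x, y))"

definition pos_y :: operator where
  "pos_y \<psi> = (\<lambda>(x, y). y *\<^sub>R \<psi> (x, y))"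

definition dom_x :: "spinor_field set" where
  "dom_x = {\<psi> \<in> L2 lborel. pos_x \<psi> \<in> L2 lborel}"

definition dom_y :: "spinor_field set" where
  "dom_y = {\<psi> \<in> L2 lborel. pos_y \<psi> \<in> L2 lborel}"

definition vel_x :: operator where
  "vel_x = matrix_op \<sigma>\<^sub>1"

definition vel_y :: operator where
  "vel_y = matrix_op \<sigma>\<^sub>2"

text \<open>Both quantities are complex-valued, so that \<open>\<langle>O\<rangle>\<^sup>2\<close> is the square of the inner product
  itself and not of its real part or modulus.\<close>

definition expect :: "operator \<Rightarrow> spinor_field \<Rightarrow> complex" where
  "expect A \<psi> = spinor_inner \<psi> (A \<psi>)"

definition var :: "operator \<Rightarrow> spinor_field \<Rightarrow> complex" where
  "var A \<psi> = of_real ((L2_norm lborel (A \<psi>))\<^sup>2) - (expect A \<psi>)\<^sup>2"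

definition heaviside :: "real \<Rightarrow> real" where
  "heaviside x = (if x > 0 then 1 else 0)"

definition \<Lambda> :: "real \<Rightarrow> real \<Rightarrow> complex ^ 2 ^ 2" where
  "\<Lambda> \<eta> \<tau> =
     matrix_inv (mat \<i> ** \<sigma>\<^sub>1 - (1/2) *\<^sub>R (\<eta> *\<^sub>R \<sigma>\<^sub>0 + \<tau> *\<^sub>R \<sigma>\<^sub>3)) **
     (mat \<i> ** \<sigma>\<^sub>1 + (1/2) *\<^sub>R (\<eta> *\<^sub>R \<sigma>\<^sub>0 + \<tau> *\<^sub>R \<sigma>\<^sub>3))"

definition \<omega> :: "real \<Rightarrow> real \<Rightarrow> real \<Rightarrow> real" where
  "\<omega> m \<eta> k = sqrt (k\<^sup>2 + 4 * m\<^sup>2 / \<eta>\<^sup>2)"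

definition amplitude :: "real \<Rightarrow> real \<Rightarrow> real \<Rightarrow> real \<Rightarrow> complex ^ 2" where
  "amplitude m \<eta> \<tau> k =
     vector [of_real (sqrt ((1 - \<tau>/\<eta>) * (\<omega> m \<eta> k + k))),
             - \<i> * of_real (sqrt ((1 + \<tau>/\<eta>) * (\<omega> m \<eta> k - k)))]"

text \<open>For \<open>\<Xi> \<in> L\<^sup>2\<close> the integral converges absolutely whenever \<open>x \<noteq> 0\<close>; the line \<open>x = 0\<close>, where
  the value chosen for the step function matters, is a null set.\<close>

definition \<psi> :: "real \<Rightarrow> real \<Rightarrow> real \<Rightarrow> (real \<Rightarrow> complex) \<Rightarrow> spinor_field" where
  "\<psi> m \<eta> \<tau> \<Xi> = (\<lambda>(x, y).
     (1 / (2 * sqrt pi)) *\<^sub>R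
       ((heaviside x *\<^sub>R \<Lambda> \<eta> \<tau> + heaviside (- x) *\<^sub>R \<sigma>\<^sub>0) *v
        (\<integral>k. (\<Xi> k * exp (\<i> * of_real (k * y) - of_real (\<omega> m \<eta> k * \<bar>x\<bar>)))
              *s amplitude m \<eta> \<tau> k \<partial>lborel)))"

end

theory Submission
  imports Defs "HOL-Probability.Characteristic_Functions" "HOL-Probability.Sinc_Integral"
begin

text \<open>For fixed \<open>x \<noteq> 0\<close> each component of \<open>\<psi> m \<eta> \<tau> \<Xi> (x, \<cdot>)\<close> is, up to a constant phase, the Fourier
  transform of \<open>g(x, \<cdot>) \<Xi>\<close> with an explicit real mode \<open>g\<close> decaying exponentially in \<open>\<bar>x\<bar>\<close> and \<open>\<bar>k\<bar>\<close>.
  Plancherel in \<open>y\<close> therefore turns every inner product into an integral over \<open>(x, k)\<close>, whose \<open>x\<close>-part is an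
  elementary exponential moment. Multiplication by \<open>y\<close> becomes \<open>\<i> \<partial>\<^sub>k\<close>: if \<open>\<Xi>\<close> has a weak derivative,
  testing it against the modes (with a smooth cutoff) gives the derivative of \<open>g \<Xi>\<close>. Conversely, if \<open>y \<psi>\<close> is
  square integrable, the difference quotients of \<open>g \<Xi>\<close> on one slice \<open>x = x\<^sub>0\<close> converge in the mean; dividing
  by \<open>g\<close> yields a weak derivative of \<open>\<Xi>\<close>, and Fatou's lemma on all slices shows that it is in \<open>L\<^sup>2\<close>.\<close>

section \<open>Square-integrable functions\<close>

text \<open>One family \<open>mode\<close> serves both components on both sides because criticality
  makes the interface matrix antidiagonal: crossing the line exchanges the components, and the
  entries convert \<open>1 + t\<close> into \<open>1 - t\<close> and back, where \<open>t\<close> is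
  \<open>\<tau> / \<eta>\<close>. Each component keeps its coefficient, and only the sign of
  \<open>k\<close> under the root flips. The root is harmless under differentiation: for \<sigma> =
  1 or -1 the function \<open>w k - \<sigma> * k\<close> has logarithmic derivative
  \<open>- \<sigma> / w k\<close>, so a differentiated mode is the mode times a rational expression
  in \<open>k\<close>, \<open>w k\<close> and \<open>\<bar>x\<bar>\<close>. The obstacle is a lack
  of uniformity. On a slice the modes decay exponentially in \<open>k\<close>, but at a rate that
  degenerates as \<open>x\<close> tends to 0; bounds uniform in \<open>k\<close> appear only after
  integration over \<open>x\<close>. One slice therefore gives the weak derivative only as a
  quotient by an exponentially small mode, which does not show that it is square integrable. What
  recovers this is that the integral over \<open>x\<close> of a squared mode does not depend on
  \<open>k\<close>. The same constancy makes a mode orthogonal in \<open>x\<close> to its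
  \<open>k\<close>-derivative, which removes the mixed terms in the moments of
  \<open>y\<close>.\<close>

lemma L2_measurable [measurable_dest]: "f \<in> L2 M \<Longrightarrow> f \<in> borel_measurable M"
  by (simp add: L2_def)

lemma L2_integrable: "f \<in> L2 M \<Longrightarrow> integrable M (\<lambda>z. (norm (f z))\<^sup>2)"
  by (simp add: L2_def)

lemma L2_bound:
  fixes f :: "'a \<Rightarrow> 'b::real_normed_vector" and g :: "'a \<Rightarrow> 'c::real_normed_vector"
  assumes "f \<in> L2 M" "g \<in> borel_measurable M" "AE z in M. norm (g z) \<le> C * norm (f z)"
  shows "g \<in> L2 M"
proof -
  have "integrable M (\<lambda>z. C\<^sup>2 * (norm (f z))\<^sup>2)"
    using L2_integrable[OF assms(1)] by simp
  moreover have "AE z in M. norm ((norm (g z))\<^sup>2) \<le> norm (C\<^sup>2 * (norm (f z))\<^sup>2)"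
    using assms(3)
  proof eventually_elim
    case (elim z)
    from power_mono[OF this, of 2] show ?case by (simp add: power_mult_distrib)
  qed
  ultimately show ?thesis
    using assms(2) Bochner_Integration.integrable_bound[of M "\<lambda>z. C\<^sup>2 * (norm (f z))\<^sup>2" "\<lambda>z. (norm (g z))\<^sup>2"]
    by (simp add: L2_def)
qed

lemma L2_integrable_mult:
  fixes f g :: "'a \<Rightarrow> 'b::{real_normed_div_algebra, second_countable_topology, banach}"
  assumes f: "f \<in> L2 M" and g: "g \<in> L2 M"
  shows "integrable M (\<lambda>z. f z * g z)"
proof (rule Bochner_Integration.integrable_bound)
  show "integrable M (\<lambda>z. (norm (f z))\<^sup>2 + (norm (g z))\<^sup>2)"
    using f g by (simp add: L2_def)
  show "(\<lambda>z. f z * g z) \<in> borel_measurable M"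
    using f g by measurable
  have "norm (f z * g z) \<le> (norm (f z))\<^sup>2 + (norm (g z))\<^sup>2" for z
  proof -
    have "2 * (norm (f z) * norm (g z)) \<le> (norm (f z))\<^sup>2 + (norm (g z))\<^sup>2"
      using sum_squares_bound[of "norm (f z)" "norm (g z)"] by (simp add: algebra_simps)
    then show ?thesis
      by (simp add: norm_mult) (smt (verit) mult_nonneg_nonneg norm_ge_zero)
  qed
  then show "AE z in M. norm (f z * g z) \<le> norm ((norm (f z))\<^sup>2 + (norm (g z))\<^sup>2)"
    by (auto intro!: AE_I2 intro: order_trans)
qed

lemma L2_cmult:
  fixes f :: "'a \<Rightarrow> complex"
  shows "f \<in> L2 M \<Longrightarrow> (\<lambda>z. c * f z) \<in> L2 M"
  by (rule L2_bound[where f=f and C="norm c"]) (auto simp: norm_mult)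

lemma borel_measurable_cnj [measurable (raw)]:
  "f \<in> borel_measurable M \<Longrightarrow> (\<lambda>z. cnj (f z)) \<in> borel_measurable M"
  using measurable_compose[of f M borel cnj borel]
  by (simp add: borel_measurable_continuous_onI continuous_on_cnj continuous_on_id)

lemma L2_cnj: "f \<in> L2 M \<Longrightarrow> (\<lambda>z. cnj (f z)) \<in> L2 M"
  by (rule L2_bound[where f=f and C=1]) auto

lemma norm_add_sq_le:
  fixes a b :: "'a::real_normed_vector"
  shows "(norm (a + b))\<^sup>2 \<le> 2 * (norm a)\<^sup>2 + 2 * (norm b)\<^sup>2"
proof -
  have "(norm (a + b))\<^sup>2 \<le> (norm a + norm b)\<^sup>2"
    by (intro power_mono norm_triangle_ineq) simp
  also have "\<dots> \<le> 2 * (norm a)\<^sup>2 + 2 * (norm b)\<^sup>2"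
    using sum_squares_bound[of "norm a" "norm b"] by (simp add: power2_sum)
  finally show ?thesis .
qed

lemma norm_diff_sq_le:
  fixes a b :: "'a::real_normed_vector"
  shows "(norm (a - b))\<^sup>2 \<le> 2 * (norm a)\<^sup>2 + 2 * (norm b)\<^sup>2"
  using norm_add_sq_le[of a "- b"] by simp

lemma L2_add:
  fixes f g :: "'a \<Rightarrow> complex"
  assumes f: "f \<in> L2 M" and g: "g \<in> L2 M"
  shows "(\<lambda>z. f z + g z) \<in> L2 M"
proof -
  have "integrable M (\<lambda>z. (norm (f z + g z))\<^sup>2)"
  proof (rule Bochner_Integration.integrable_bound)
    show "integrable M (\<lambda>z. 2 * (norm (f z))\<^sup>2 + 2 * (norm (g z))\<^sup>2)"
      using f g by (simp add: L2_def)
  qed (use f g norm_add_sq_le in \<open>auto\<close>)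
  then show ?thesis using f g by (auto simp: L2_def)
qed

lemma L2_diff:
  fixes f g :: "'a \<Rightarrow> complex"
  assumes "f \<in> L2 M" "g \<in> L2 M"
  shows "(\<lambda>z. f z - g z) \<in> L2 M"
  using L2_add[OF assms(1) L2_cmult[OF assms(2), of "-1"]] by simp

lemma L2_iff_nn_integral:
  "f \<in> L2 M \<longleftrightarrow> f \<in> borel_measurable M \<and> (\<integral>\<^sup>+z. ennreal ((norm (f z))\<^sup>2) \<partial>M) < \<infinity>"
  by (auto simp: L2_def integrable_iff_bounded)

lemma L2_nn_integral:
  "f \<in> L2 M \<Longrightarrow> (\<integral>\<^sup>+z. ennreal ((norm (f z))\<^sup>2) \<partial>M) = ennreal (\<integral>z. (norm (f z))\<^sup>2 \<partial>M)"
  by (intro nn_integral_eq_integral L2_integrable) auto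

lemma L2_norm_squared: "(L2_norm M f)\<^sup>2 = (\<integral>z. (norm (f z))\<^sup>2 \<partial>M)"
  by (simp add: L2_norm_def)

section \<open>Continuity of translations\<close>

text \<open>For \<open>N > 0\<close> this is the radial retraction of the complex plane onto the
  closed disc of radius \<open>N\<close>; the form with \<open>max\<close> makes its continuity
  immediate.\<close>

definition clip :: "real \<Rightarrow> complex \<Rightarrow> complex" where
  "clip N z = of_real (N / max N (norm z)) * z"

definition plateau :: "real \<Rightarrow> real \<Rightarrow> real" where
  "plateau N k = max 0 (min 1 (N + 1 - \<bar>k\<bar>))"

lemma norm_clip_le: "N > 0 \<Longrightarrow> norm (clip N z) \<le> N"
  by (auto simp: clip_def norm_mult norm_divide field_simps max_def)

lemma norm_clip_le_norm: "N > 0 \<Longrightarrow> norm (clip N z) \<le> norm z"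
  by (auto simp: clip_def norm_mult norm_divide field_simps max_def)

lemma clip_eq: "N > 0 \<Longrightarrow> norm z \<le> N \<Longrightarrow> clip N z = z"
  by (simp add: clip_def max_def)

lemma continuous_on_clip [continuous_intros]:
  "N > 0 \<Longrightarrow> continuous_on A f \<Longrightarrow> continuous_on A (\<lambda>x. clip N (f x))"
  unfolding clip_def by (intro continuous_intros) (auto simp: max_def)

lemma isCont_clip: "N > 0 \<Longrightarrow> isCont (clip N) z"
  using continuous_on_clip[of N UNIV "\<lambda>x. x"] by (simp add: continuous_on_eq_continuous_at)

lemma plateau_bounds: "0 \<le> plateau N k" "plateau N k \<le> 1"
  by (auto simp: plateau_def)

lemma plateau_eq_0: "N + 1 \<le> \<bar>k\<bar> \<Longrightarrow> plateau N k = 0"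
  by (auto simp: plateau_def)

lemma plateau_eq_1: "\<bar>k\<bar> \<le> N \<Longrightarrow> plateau N k = 1"
  by (auto simp: plateau_def)

lemma continuous_on_plateau [continuous_intros]: "continuous_on A (plateau N)"
  unfolding plateau_def by (intro continuous_intros)

text \<open>A measurable function is the limit, off a null set, of continuous functions whose size
  is uncontrolled. Truncating both values (\<open>clip\<close>) and support (\<open>plateau\<close>)
  keeps them continuous and makes dominated convergence applicable, first to \<open>f\<close>
  against its truncation, then to the truncation against those of the approximants.\<close>

lemma continuous_approx_L2:
  fixes f :: "real \<Rightarrow> complex"
  assumes f: "f \<in> L2 lborel" and e: "e > 0"
  obtains g N where "continuous_on UNIV g" "\<And>k. norm (g k) \<le> N" "\<And>k. N + 1 \<le> \<bar>k\<bar> \<Longrightarrow> g k = 0"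
    "N > 0" "g \<in> L2 lborel" "(LBINT k. (norm (f k - g k))\<^sup>2) < e"
proof -
  note [measurable] = L2_measurable[OF f]
  have "f measurable_on UNIV"
    using lebesgue_measurable_imp_measurable_on[of f UNIV] by (simp add: measurable_completion)
  then obtain Z h where Z: "negligible Z" and h: "\<And>n. continuous_on UNIV (h n)"
    and lim: "\<And>x. x \<notin> Z \<Longrightarrow> (\<lambda>n. h n x) \<longlonglongrightarrow> f x"
    unfolding measurable_on_def by (auto split: if_splits)
  have AEZ: "AE x in lborel. x \<notin> Z"
    using AE_not_in[OF Z[unfolded negligible_iff_null_sets]] by (simp only: AE_completion_iff)
  have [measurable]: "h n \<in> borel_measurable borel" for n
    using h by (simp add: borel_measurable_continuous_onI)
  have [measurable]: "clip N \<in> borel_measurable borel" "plateau N \<in> borel_measurable borel" for N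
    unfolding clip_def[abs_def] plateau_def[abs_def] by measurable
  define fN where "fN N k = of_real (plateau N k) * clip N (f k)" for N k
  define gN where "gN N n k = of_real (plateau N k) * clip N (h n k)" for N n k
  have [measurable]: "fN N \<in> borel_measurable borel" "gN N n \<in> borel_measurable borel" for N n
    unfolding fN_def[abs_def] gN_def[abs_def] by measurable
  have fN_le: "norm (fN N k) \<le> norm (f k)" if "N > 0" for N k
    using mult_mono[of "\<bar>plateau N k\<bar>" 1 "norm (clip N (f k))" "norm (f k)"]
      plateau_bounds[of N k] norm_clip_le_norm[OF that, of "f k"] by (auto simp: fN_def norm_mult)
  have "(\<lambda>j. \<integral>k. (norm (f k - fN (real (Suc j)) k))\<^sup>2 \<partial>lborel) \<longlonglongrightarrow> (\<integral>k. 0 \<partial>(lborel::real measure))"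
  proof (rule integral_dominated_convergence[where w="\<lambda>k. 4 * (norm (f k))\<^sup>2"])
    show "integrable lborel (\<lambda>k. 4 * (norm (f k))\<^sup>2)" using f by (simp add: L2_def)
    show "AE x in lborel. (\<lambda>j. (norm (f x - fN (real (Suc j)) x))\<^sup>2) \<longlonglongrightarrow> 0"
    proof (rule AE_I2, rule tendsto_eventually)
      fix x
      show "\<forall>\<^sub>F j in sequentially. (norm (f x - fN (real (Suc j)) x))\<^sup>2 = 0"
      proof (rule eventually_sequentiallyI)
        fix j assume "nat \<lceil>max \<bar>x\<bar> (norm (f x))\<rceil> \<le> j"
        then have "max \<bar>x\<bar> (norm (f x)) \<le> real j" by linarith
        then show "(norm (f x - fN (real (Suc j)) x))\<^sup>2 = 0"
          by (auto simp: fN_def plateau_eq_1 clip_eq)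
      qed
    qed
    show "AE x in lborel. norm ((norm (f x - fN (real (Suc j)) x))\<^sup>2) \<le> 4 * (norm (f x))\<^sup>2" for j
    proof (rule AE_I2)
      fix x
      have "(norm (fN (real (Suc j)) x))\<^sup>2 \<le> (norm (f x))\<^sup>2"
        using fN_le[of "real (Suc j)" x] by (intro power_mono) auto
      then show "norm ((norm (f x - fN (real (Suc j)) x))\<^sup>2) \<le> 4 * (norm (f x))\<^sup>2"
        using norm_diff_sq_le[of "f x" "fN (real (Suc j)) x"] unfolding real_norm_def abs_power2 by linarith
    qed
  qed auto
  \<comment> \<open>Each error is kept below \<open>e / 4\<close> because the squared triangle
    inequality doubles both.\<close>
  then have "\<forall>\<^sub>F j in sequentially. (LBINT k. (norm (f k - fN (real (Suc j)) k))\<^sup>2) < e / 4"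
    using e by (intro order_tendstoD(2)) auto
  then obtain j where j: "(LBINT k. (norm (f k - fN (real (Suc j)) k))\<^sup>2) < e / 4"
    by (auto simp: eventually_sequentially)
  define N where "N = real (Suc j)"
  have N: "N > 0" by (simp add: N_def)
  have gN_le: "norm (gN N n k) \<le> N * indicator {-N-1..N+1} k"
    and fN_le': "norm (fN N k) \<le> N * indicator {-N-1..N+1} k" for n k
    using mult_mono[of "\<bar>plateau N k\<bar>" 1 "norm (clip N (h n k))" N]
      mult_mono[of "\<bar>plateau N k\<bar>" 1 "norm (clip N (f k))" N] N
      plateau_bounds[of N k] norm_clip_le[OF N, of "h n k"] norm_clip_le[OF N, of "f k"] plateau_eq_0[of N k]
    by (auto simp: gN_def fN_def norm_mult indicator_def abs_le_iff)
  have indI: "integrable lborel (\<lambda>k::real. C * indicator {-N-1..N+1} k :: real)" for C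
    by (intro integrable_mult_right integrable_real_indicator) (auto simp: emeasure_lborel_Icc_eq)
  have "(\<lambda>n. \<integral>k. (norm (fN N k - gN N n k))\<^sup>2 \<partial>lborel) \<longlonglongrightarrow> (\<integral>k. 0 \<partial>(lborel::real measure))"
  proof (rule integral_dominated_convergence[where w="\<lambda>k. 4 * N\<^sup>2 * indicator {-N-1..N+1} k"])
    show "AE x in lborel. (\<lambda>n. (norm (fN N x - gN N n x))\<^sup>2) \<longlonglongrightarrow> 0"
      using AEZ
    proof eventually_elim
      case (elim x)
      have "(\<lambda>n. clip N (h n x)) \<longlonglongrightarrow> clip N (f x)"
        using isCont_tendsto_compose[OF isCont_clip[OF N] lim[OF elim]] .
      then have "(\<lambda>n. gN N n x) \<longlonglongrightarrow> fN N x" unfolding gN_def fN_def by (intro tendsto_intros)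
      then have "(\<lambda>n. (norm (fN N x - gN N n x))\<^sup>2) \<longlonglongrightarrow> (norm (fN N x - fN N x))\<^sup>2"
        by (intro tendsto_intros)
      then show ?case by simp
    qed
    show "AE x in lborel. norm ((norm (fN N x - gN N n x))\<^sup>2) \<le> 4 * N\<^sup>2 * indicator {-N-1..N+1} x" for n
    proof (rule AE_I2)
      fix x
      have "(norm (fN N x))\<^sup>2 \<le> (N * indicator {-N-1..N+1} x)\<^sup>2"
        "(norm (gN N n x))\<^sup>2 \<le> (N * indicator {-N-1..N+1} x)\<^sup>2"
        using fN_le'[of x] gN_le[of n x] by (auto intro!: power_mono)
      then show "norm ((norm (fN N x - gN N n x))\<^sup>2) \<le> 4 * N\<^sup>2 * indicator {-N-1..N+1} x"
        using norm_diff_sq_le[of "fN N x" "gN N n x"] by (auto simp: indicator_def)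
    qed
  qed (use indI[of "4 * N\<^sup>2"] in simp_all)
  then have "\<forall>\<^sub>F n in sequentially. (LBINT k. (norm (fN N k - gN N n k))\<^sup>2) < e / 4"
    using e by (intro order_tendstoD(2)) auto
  then obtain n where n: "(LBINT k. (norm (fN N k - gN N n k))\<^sup>2) < e / 4"
    by (auto simp: eventually_sequentially)
  have bddL2: "g \<in> L2 lborel" if "g \<in> borel_measurable borel" "\<And>k. norm (g k) \<le> N * indicator {-N-1..N+1} k"
    for g :: "real \<Rightarrow> complex"
  proof -
    have "(\<lambda>k. N * indicator {-N-1..N+1} k) \<in> L2 lborel"
    proof -
      have "(norm (N * indicator {-N-1..N+1} k))\<^sup>2 = N\<^sup>2 * indicator {-N-1..N+1} k" for k
        by (auto simp: indicator_def)
      then show ?thesis using indI[of "N\<^sup>2"] by (simp add: L2_def)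
    qed
    then show ?thesis
      by (rule L2_bound[where C=1]) (use that in \<open>auto intro!: AE_I2 intro: order_trans[OF _ abs_ge_self]\<close>)
  qed
  have gL: "gN N n \<in> L2 lborel" and fL: "fN N \<in> L2 lborel"
    by (auto intro!: bddL2 gN_le fN_le')
  show ?thesis
  proof (rule that[of "gN N n" N])
    show "continuous_on UNIV (gN N n)"
      unfolding gN_def by (intro continuous_intros h N)
    show "norm (gN N n k) \<le> N" for k
      using gN_le[of n k] N by (cases "k \<in> {-N-1..N+1}") auto
    show "gN N n k = 0" if "N + 1 \<le> \<bar>k\<bar>" for k
      using that by (simp add: gN_def plateau_eq_0)
    have "(LBINT k. (norm (f k - gN N n k))\<^sup>2)
      \<le> (LBINT k. 2 * (norm (f k - fN N k))\<^sup>2 + 2 * (norm (fN N k - gN N n k))\<^sup>2)"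
    proof (rule integral_mono)
      show "integrable lborel (\<lambda>k. (norm (f k - gN N n k))\<^sup>2)"
        by (intro L2_integrable L2_diff f gL)
      show "integrable lborel (\<lambda>k. 2 * (norm (f k - fN N k))\<^sup>2 + 2 * (norm (fN N k - gN N n k))\<^sup>2)"
        by (intro Bochner_Integration.integrable_add integrable_mult_right L2_integrable L2_diff f fL gL)
      show "(norm (f k - gN N n k))\<^sup>2 \<le> 2 * (norm (f k - fN N k))\<^sup>2 + 2 * (norm (fN N k - gN N n k))\<^sup>2" for k
        using norm_add_sq_le[of "f k - fN N k" "fN N k - gN N n k"] by simp
    qed
    also have "\<dots> = 2 * (LBINT k. (norm (f k - fN N k))\<^sup>2) + 2 * (LBINT k. (norm (fN N k - gN N n k))\<^sup>2)"
      by (subst Bochner_Integration.integral_add)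
        (auto intro!: integrable_mult_right L2_integrable L2_diff f fL gL)
    also have "\<dots> < e" using j n by (simp add: N_def)
    finally show "(LBINT k. (norm (f k - gN N n k))\<^sup>2) < e" .
  qed (use N gL in auto)
qed

lemma integral_translate:
  fixes f :: "real \<Rightarrow> 'a::{banach, second_countable_topology}"
  shows "(LBINT k. f (k + s)) = (LBINT k. f k)"
  using lborel_integral_real_affine[of 1 f s] by (simp add: add.commute)

lemma integrable_translate:
  fixes f :: "real \<Rightarrow> 'a::{banach, second_countable_topology}"
  shows "integrable lborel f \<Longrightarrow> integrable lborel (\<lambda>k. f (k + s))"
  using lborel_integrable_real_affine[of f 1 s] by (simp add: add.commute)

lemma L2_translate: "f \<in> L2 lborel \<Longrightarrow> (\<lambda>k::real. f (k + s)) \<in> L2 lborel"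
  using integrable_translate[of "\<lambda>k. (norm (f k))\<^sup>2" s] by (auto simp: L2_def)

text \<open>Translations are isometries, so the claim passes from continuous compactly supported
  functions, where dominated convergence applies, to all of \<open>L2\<close>.\<close>

lemma translate_tendsto_L2:
  fixes f :: "real \<Rightarrow> complex"
  assumes f: "f \<in> L2 lborel" and s: "s \<longlonglongrightarrow> 0"
  shows "(\<lambda>n. \<integral>k. (norm (f (k + s n) - f k))\<^sup>2 \<partial>lborel) \<longlonglongrightarrow> 0"
proof (rule tendstoI)
  fix e :: real assume "e > 0"
  \<comment> \<open>The final estimate weights the three errors by 2, 4 and 4, which adds up to ten
    sixteenths of \<open>e\<close>.\<close>
  then have "e / 16 > 0" by simp
  from continuous_approx_L2[OF f this] obtain g N where g: "continuous_on UNIV g"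
    "\<And>k. norm (g k) \<le> N" "\<And>k. N + 1 \<le> \<bar>k\<bar> \<Longrightarrow> g k = 0" "N > 0" "g \<in> L2 lborel"
    "(LBINT k. (norm (f k - g k))\<^sup>2) < e / 16" by blast
  have [measurable]: "g \<in> borel_measurable borel"
    using g(1) by (rule borel_measurable_continuous_onI)
  \<comment> \<open>Shifts shorter than 1 keep all translates of \<open>g\<close> supported in
    \<open>{-N-2..N+2}\<close>, which provides the dominating function.\<close>
  obtain n0 where n0: "\<And>n. n \<ge> n0 \<Longrightarrow> \<bar>s n\<bar> < 1"
    using LIMSEQ_D[OF s, of 1] by auto
  have "(\<lambda>n. \<integral>k. (norm (g (k + s (n + n0)) - g k))\<^sup>2 \<partial>lborel) \<longlonglongrightarrow> (\<integral>k. 0 \<partial>(lborel::real measure))"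
  proof (rule integral_dominated_convergence[where w="\<lambda>k. 4 * N\<^sup>2 * indicator {-N-2..N+2} k"])
    show "integrable lborel (\<lambda>k::real. 4 * N\<^sup>2 * indicator {-N-2..N+2} k :: real)"
      by (intro integrable_mult_right integrable_real_indicator) (auto simp: emeasure_lborel_Icc_eq)
    show "AE x in lborel. (\<lambda>n. (norm (g (x + s (n + n0)) - g x))\<^sup>2) \<longlonglongrightarrow> 0"
    proof (rule AE_I2)
      fix x
      have "(\<lambda>n. x + s (n + n0)) \<longlonglongrightarrow> x + 0"
        by (intro tendsto_intros LIMSEQ_ignore_initial_segment s)
      moreover have "isCont g (x + 0)" using g(1) by (simp add: continuous_on_eq_continuous_at)
      ultimately have "(\<lambda>n. g (x + s (n + n0))) \<longlonglongrightarrow> g (x + 0)"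
        by (metis isCont_tendsto_compose)
      then have "(\<lambda>n. (norm (g (x + s (n + n0)) - g x))\<^sup>2) \<longlonglongrightarrow> (norm (g (x + 0) - g x))\<^sup>2"
        by (intro tendsto_intros)
      then show "(\<lambda>n. (norm (g (x + s (n + n0)) - g x))\<^sup>2) \<longlonglongrightarrow> 0" by simp
    qed
    show "AE x in lborel. norm ((norm (g (x + s (n + n0)) - g x))\<^sup>2) \<le> 4 * N\<^sup>2 * indicator {-N-2..N+2} x" for n
    proof (rule AE_I2)
      fix x
      have le: "(norm (g (x + s (n + n0)) - g x))\<^sup>2 \<le> 4 * N\<^sup>2"
        using norm_diff_sq_le[of "g (x + s (n + n0))" "g x"] power_mono[OF g(2)[of x], of 2]
          power_mono[OF g(2)[of "x + s (n + n0)"], of 2] by simp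
      show "norm ((norm (g (x + s (n + n0)) - g x))\<^sup>2) \<le> 4 * N\<^sup>2 * indicator {-N-2..N+2} x"
      proof (cases "x \<in> {-N-2..N+2}")
        case False
        then have "N + 1 \<le> \<bar>x\<bar>" "N + 1 \<le> \<bar>x + s (n + n0)\<bar>" using n0[of "n + n0"] g(4) by auto
        then show ?thesis using g(3) by simp
      qed (use le in auto)
    qed
  qed auto
  then have "(\<lambda>n. \<integral>k. (norm (g (k + s n) - g k))\<^sup>2 \<partial>lborel) \<longlonglongrightarrow> 0"
    by (auto intro: LIMSEQ_offset[where k=n0])
  then have "\<forall>\<^sub>F n in sequentially. (LBINT k. (norm (g (k + s n) - g k))\<^sup>2) < e / 16"
    using \<open>e > 0\<close> by (intro order_tendstoD(2)) auto
  then show "\<forall>\<^sub>F n in sequentially. dist (LBINT k. (norm (f (k + s n) - f k))\<^sup>2) 0 < e"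
  proof eventually_elim
    case (elim n)
    let ?t = "s n"
    have int: "integrable lborel (\<lambda>k. (norm (f (k + ?t) - g (k + ?t)))\<^sup>2)"
      "integrable lborel (\<lambda>k. (norm (g (k + ?t) - g k))\<^sup>2)"
      "integrable lborel (\<lambda>k. (norm (f k - g k))\<^sup>2)"
      "integrable lborel (\<lambda>k. (norm (f (k + ?t) - f k))\<^sup>2)"
      by (intro L2_integrable L2_diff L2_translate f g)+
    have "(LBINT k. (norm (f (k + ?t) - f k))\<^sup>2)
      \<le> (LBINT k. 2 * (norm (f (k + ?t) - g (k + ?t)))\<^sup>2
          + (4 * (norm (g (k + ?t) - g k))\<^sup>2 + 4 * (norm (f k - g k))\<^sup>2))"
    proof (rule integral_mono)
      fix k
      show "(norm (f (k + ?t) - f k))\<^sup>2 \<le> 2 * (norm (f (k + ?t) - g (k + ?t)))\<^sup>2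
          + (4 * (norm (g (k + ?t) - g k))\<^sup>2 + 4 * (norm (f k - g k))\<^sup>2)"
        using norm_add_sq_le[of "f (k + ?t) - g (k + ?t)" "g (k + ?t) - f k"]
          norm_add_sq_le[of "g (k + ?t) - g k" "g k - f k"] by (simp add: norm_minus_commute)
    qed (use int in auto)
    also have "\<dots> = 2 * (LBINT k. (norm (f (k + ?t) - g (k + ?t)))\<^sup>2)
          + (4 * (LBINT k. (norm (g (k + ?t) - g k))\<^sup>2) + 4 * (LBINT k. (norm (f k - g k))\<^sup>2))"
      using int by simp
    also have "(LBINT k. (norm (f (k + ?t) - g (k + ?t)))\<^sup>2) = (LBINT k. (norm (f k - g k))\<^sup>2)"
      by (rule integral_translate)
    finally have "(LBINT k. (norm (f (k + ?t) - f k))\<^sup>2) < 2*(e/16) + (4 * (e/16) + 4*(e/16)) "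
      using elim g(6) by linarith
    moreover have "0 \<le> (LBINT k. (norm (f (k + ?t) - f k))\<^sup>2)" by (rule integral_nonneg_AE) simp
    ultimately show ?case using \<open>e>0\<close> g(6) elim
      by (simp add: dist_real_def)
  qed
qed

section \<open>The Plancherel identity\<close>

text \<open>Sign and normalisation are those of the integral in \<open>\<psi>\<close>; the price is
  a factor \<open>2 * pi\<close> in Plancherel's identity.\<close>

definition fourier :: "(real \<Rightarrow> complex) \<Rightarrow> real \<Rightarrow> complex" where
  "fourier f y = (LBINT k. f k * cis (k * y))"

lemma borel_measurable_cis [measurable (raw)]:
  "f \<in> borel_measurable M \<Longrightarrow> (\<lambda>z. cis (f z)) \<in> borel_measurable M"
  using measurable_compose[of f M borel cis borel]
  by (simp add: borel_measurable_continuous_onI continuous_on_cis continuous_on_id)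

lemma integrable_mult_bounded:
  fixes f g :: "'a \<Rightarrow> complex"
  assumes "integrable M f" "g \<in> borel_measurable M" "\<And>z. norm (g z) \<le> C"
  shows "integrable M (\<lambda>z. f z * g z)"
proof (rule Bochner_Integration.integrable_bound)
  show "integrable M (\<lambda>z. C * norm (f z))" using assms(1) by simp
  have "norm (f z * g z) \<le> \<bar>C\<bar> * norm (f z)" for z
    using mult_right_mono[OF order_trans[OF assms(3)[of z] abs_ge_self], of "norm (f z)"]
    by (simp add: norm_mult mult.commute)
  then show "AE z in M. norm (f z * g z) \<le> norm (C * norm (f z))"
    by (simp add: abs_mult)
qed (use assms in measurable)

lemma fourier_integrable [simp, intro]:
  "integrable lborel f \<Longrightarrow> integrable lborel (\<lambda>k. f k * cis (k * y))"
  by (rule integrable_mult_bounded[where C=1]) auto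

lemma fourier_measurable [measurable (raw)]:
  assumes [measurable]: "f \<in> borel_measurable borel"
  shows "fourier f \<in> borel_measurable borel"
  unfolding fourier_def[abs_def] by measurable

lemma norm_fourier_le: "norm (fourier f y) \<le> (LBINT k. norm (f k))"
  unfolding fourier_def using integral_norm_bound[of lborel "\<lambda>k. f k * cis (k * y)"]
  by (simp add: norm_mult)

lemma fourier_cmult: "fourier (\<lambda>k. c * f k) y = c * fourier f y"
  by (simp add: fourier_def mult.assoc)

lemma fourier_add:
  "integrable lborel f \<Longrightarrow> integrable lborel g \<Longrightarrow> fourier (\<lambda>k. f k + g k) y = fourier f y + fourier g y"
  unfolding fourier_def by (subst Bochner_Integration.integral_add[symmetric]) (auto simp: algebra_simps)

lemma fourier_diff:
  "integrable lborel f \<Longrightarrow> integrable lborel g \<Longrightarrow> fourier (\<lambda>k. f k - g k) y = fourier f y - fourier g y"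
  unfolding fourier_def by (subst Bochner_Integration.integral_diff[symmetric]) (auto simp: algebra_simps)

lemma fourier_translate: "fourier (\<lambda>k. f (k + h)) y = cis (- h * y) * fourier f y"
proof -
  have "fourier (\<lambda>k. f (k + h)) y = (LBINT k. cis (- h * y) * (f (k + h) * cis ((k + h) * y)))"
    unfolding fourier_def by (intro Bochner_Integration.integral_cong)
      (auto simp: algebra_simps cis_mult)
  also have "\<dots> = cis (- h * y) * fourier f y"
    using integral_translate[of "\<lambda>k. f k * cis (k * y)" h] by (simp add: fourier_def)
  finally show ?thesis .
qed

text \<open>The kernel \<open>r\<close> stands for the phases. It is not integrable itself, but
  bounded, so integrability on the product comes from that of \<open>p a * q b\<close>.\<close>

lemma Fubini_kernel:
  fixes p q :: "real \<Rightarrow> complex" and r :: "real \<Rightarrow> real \<Rightarrow> complex"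
  assumes p: "integrable lborel p" and q: "integrable lborel q"
    and r: "(\<lambda>(a, b). r a b) \<in> borel_measurable (lborel \<Otimes>\<^sub>M lborel)" "\<And>a b. norm (r a b) \<le> 1"
  shows "(LBINT a. p a * (LBINT b. q b * r a b)) = (LBINT b. q b * (LBINT a. p a * r a b))"
proof -
  have [measurable]: "p \<in> borel_measurable lborel" "q \<in> borel_measurable lborel"
    "(\<lambda>(a, b). r a b) \<in> borel_measurable (lborel \<Otimes>\<^sub>M lborel)" using p q r by auto
  have "integrable (lborel \<Otimes>\<^sub>M lborel) (\<lambda>(a, b). p a * q b)"
  proof (rule lborel_pair.Fubini_integrable)
    show "(\<lambda>(a, b). p a * q b) \<in> borel_measurable (lborel \<Otimes>\<^sub>M lborel)" by measurable
    show "integrable lborel (\<lambda>x. \<integral>y. norm (case (x, y) of (a, b) \<Rightarrow> p a * q b) \<partial>lborel)"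
      using p by (simp add: norm_mult)
    show "AE x in lborel. integrable lborel (\<lambda>y. case (x, y) of (a, b) \<Rightarrow> p a * q b)"
      using q by simp
  qed
  then have "integrable (lborel \<Otimes>\<^sub>M lborel) (\<lambda>z. (case z of (a, b) \<Rightarrow> p a * q b) * (case z of (a, b) \<Rightarrow> r a b))"
    by (rule integrable_mult_bounded[where C=1]) (use r in \<open>auto split: prod.split\<close>)
  then have *: "integrable (lborel \<Otimes>\<^sub>M lborel) (\<lambda>(a, b). p a * q b * r a b)"
    by (simp add: case_prod_unfold)
  have "(LBINT a. p a * (LBINT b. q b * r a b)) = (LBINT a. (LBINT b. p a * q b * r a b))"
    by (simp add: mult.assoc)
  also have "\<dots> = (LBINT b. (LBINT a. p a * q b * r a b))"
    using lborel_pair.Fubini_integral[OF *] by simp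
  also have "\<dots> = (LBINT b. q b * (LBINT a. p a * r a b))"
    by (simp add: mult.assoc mult.left_commute[of _ "q _"])
  finally show ?thesis .
qed

lemma gaussian_integrable: "integrable lborel (\<lambda>s::real. exp (- (s\<^sup>2) / 2))"
proof -
  have "integrable lborel (\<lambda>s::real. sqrt (2 * pi) * std_normal_density s)"
    by (intro integrable_mult_right integrable_normal_density) simp
  then show ?thesis by (simp add: std_normal_density_def)
qed

lemma gaussian_integral: "(LBINT s. exp (- (s\<^sup>2) / 2)) = sqrt (2 * pi)"
proof -
  have "(LBINT s. std_normal_density s) = 1" by (intro integral_normal_density) simp
  then have "(1 / sqrt (2 * pi)) * (LBINT s. exp (- (s\<^sup>2) / 2)) = 1"
    unfolding std_normal_density_def integral_mult_right_zero .
  moreover have "sqrt (2 * pi) \<noteq> 0" by simp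
  ultimately show ?thesis by (simp only: times_divide_eq_left mult_1 divide_eq_1_iff)
qed

lemma gaussian_fourier:
  "(LBINT y. complex_of_real (exp (- (y\<^sup>2) / 2)) * cis (t * y)) = of_real (sqrt (2 * pi) * exp (- (t\<^sup>2) / 2))"
proof -
  have "of_real (exp (- (t\<^sup>2) / 2)) = (\<integral>y. iexp (t * y) \<partial>std_normal_distribution)"
    using char_std_normal_distribution by (simp add: char_def fun_eq_iff)
  also have "\<dots> = (LBINT y. std_normal_density y *\<^sub>R iexp (t * y))"
    by (intro integral_density) auto
  also have "\<dots> = (LBINT y. of_real (1 / sqrt (2 * pi)) * (of_real (exp (- (y\<^sup>2) / 2)) * cis (t * y)))"
    by (intro Bochner_Integration.integral_cong)
      (auto simp: std_normal_density_def scaleR_conv_of_real cis_conv_exp)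
  also have "\<dots> = of_real (1 / sqrt (2 * pi)) * (LBINT y. of_real (exp (- (y\<^sup>2) / 2)) * cis (t * y))"
    by (rule integral_mult_right_zero)
  finally have "of_real (sqrt (2 * pi)) * complex_of_real (exp (- (t\<^sup>2) / 2))
    = of_real (sqrt (2 * pi)) * (of_real (1 / sqrt (2 * pi)) * (LBINT y. of_real (exp (- (y\<^sup>2) / 2)) * cis (t * y)))"
    by simp
  also have "\<dots> = (LBINT y. of_real (exp (- (y\<^sup>2) / 2)) * cis (t * y))"
    by (simp flip: of_real_mult mult.assoc)
  finally show ?thesis by (simp only: of_real_mult)
qed

lemma gaussian_fourier_scaled:
  assumes "\<sigma> > 0"
  shows "(LBINT y. complex_of_real (exp (- ((\<sigma> * y)\<^sup>2) / 2)) * cis (t * y))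
    = of_real (sqrt (2 * pi) / \<sigma> * exp (- ((t / \<sigma>)\<^sup>2) / 2))"
proof -
  have "of_real (sqrt (2 * pi) * exp (- ((t / \<sigma>)\<^sup>2) / 2))
      = \<bar>\<sigma>\<bar> *\<^sub>R (LBINT y. complex_of_real (exp (- ((0 + \<sigma> * y)\<^sup>2) / 2)) * cis (t / \<sigma> * (0 + \<sigma> * y)))"
    unfolding gaussian_fourier[symmetric] using assms by (intro lborel_integral_real_affine) simp
  also have "\<dots> = of_real \<sigma> * (LBINT y. complex_of_real (exp (- ((\<sigma> * y)\<^sup>2) / 2)) * cis (t * y))"
    using assms by (simp add: scaleR_conv_of_real)
  finally show ?thesis using assms by (simp add: field_simps)
qed

lemma gaussian_scaled_integrable:
  assumes "\<sigma> > 0"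
  shows "integrable lborel (\<lambda>y. complex_of_real (exp (- ((\<sigma> * y)\<^sup>2) / 2)))"
  using integrable_of_real[OF lborel_integrable_real_affine[OF gaussian_integrable, of \<sigma> 0], where 'a=complex] assms by simp

text \<open>Damping the \<open>y\<close>-integral by a Gaussian smears the autocorrelation of \<open>f\<close> around \<open>0\<close>; removing the
  damping is then a matter of continuity of the autocorrelation at \<open>0\<close>.\<close>

lemma fourier_gaussian_regularized:
  fixes f :: "real \<Rightarrow> complex"
  assumes f: "integrable lborel f" and f2: "f \<in> L2 lborel" and s: "\<sigma> > 0"
  shows "(LBINT y. (norm (fourier f y))\<^sup>2 * exp (- ((\<sigma> * y)\<^sup>2) / 2))
    = sqrt (2 * pi) * (LBINT s. exp (- (s\<^sup>2) / 2) * Re (LBINT l. cnj (f l) * f (l + \<sigma> * s)))"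
proof -
  have [measurable]: "f \<in> borel_measurable borel" using f by auto
  define w where "w y = complex_of_real (exp (- ((\<sigma> * y)\<^sup>2) / 2))" for y
  define c where "c = complex_of_real (sqrt (2 * pi))"
  have [measurable]: "w \<in> borel_measurable borel" unfolding w_def[abs_def] by measurable
  have w: "integrable lborel w" unfolding w_def[abs_def] using gaussian_scaled_integrable[OF s] .
  have wF: "integrable lborel (\<lambda>y. w y * fourier f y)"
    by (rule integrable_mult_bounded[OF w _ norm_fourier_le]) simp
  have cnjF: "cnj (fourier f y) = (LBINT l. cnj (f l) * cis (- l * y))" for y
  proof -
    have "cnj (fourier f y) = (LBINT l. cnj (f l * cis (l * y)))"
      unfolding fourier_def by (rule Bochner_Integration.integral_cnj[symmetric])
    then show ?thesis by (simp add: cis_cnj del: Bochner_Integration.integral_cnj)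
  qed
  \<comment> \<open>Inverting the damped transform returns \<open>f\<close> smeared by a Gaussian of
    width \<open>\<sigma>\<close>, written after the substitution
    \<open>k = l + \<sigma> * s\<close>.\<close>
  have inner: "(LBINT y. (w y * fourier f y) * cis (- l * y))
    = c * (LBINT s. f (l + \<sigma> * s) * of_real (exp (- (s\<^sup>2) / 2)))" for l
  proof -
    have "(LBINT y. (w y * fourier f y) * cis (- l * y))
        = (LBINT y. (w y * cis (- l * y)) * (LBINT k. f k * cis (k * y)))"
      by (simp add: fourier_def mult_ac)
    also have "\<dots> = (LBINT k. f k * (LBINT y. (w y * cis (- l * y)) * cis (k * y)))"
      by (rule Fubini_kernel) (use w f in \<open>auto intro!: integrable_mult_bounded[where C=1]\<close>)
    also have "\<dots> = (LBINT k. f k * of_real (sqrt (2 * pi) / \<sigma> * exp (- (((k - l) / \<sigma>)\<^sup>2) / 2)))"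
    proof (rule Bochner_Integration.integral_cong[OF refl])
      fix k
      have "(LBINT y. (w y * cis (- l * y)) * cis (k * y)) = (LBINT y. w y * cis ((k - l) * y))"
        by (simp add: mult.assoc cis_mult left_diff_distrib)
      then show "f k * (LBINT y. (w y * cis (- l * y)) * cis (k * y))
        = f k * of_real (sqrt (2 * pi) / \<sigma> * exp (- (((k - l) / \<sigma>)\<^sup>2) / 2))"
        unfolding w_def by (simp only: gaussian_fourier_scaled[OF s])
    qed
    also have "\<dots> = \<bar>\<sigma>\<bar> *\<^sub>R (LBINT s. f (l + \<sigma> * s) * of_real (sqrt (2 * pi) / \<sigma> * exp (- (((l + \<sigma> * s - l) / \<sigma>)\<^sup>2) / 2)))"
      using s by (intro lborel_integral_real_affine) simp
    also have "\<dots> = \<bar>\<sigma>\<bar> *\<^sub>R (LBINT s. (c / of_real \<sigma>) * (f (l + \<sigma> * s) * of_real (exp (- (s\<^sup>2) / 2))))"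
      using s by (simp add: c_def mult_ac)
    also have "\<dots> = c * (LBINT s. f (l + \<sigma> * s) * of_real (exp (- (s\<^sup>2) / 2)))"
      using s by (simp add: scaleR_conv_of_real)
    finally show ?thesis .
  qed
  define N where "N = (LBINT l. (norm (f l))\<^sup>2)"
  define G where "G = (\<lambda>(s, l). complex_of_real (exp (- (s\<^sup>2) / 2)) * (cnj (f l) * f (l + \<sigma> * s)))"
  have intf: "integrable lborel (\<lambda>l. cnj (f l) * f (l + t))" for t
    by (intro L2_integrable_mult L2_cnj L2_translate f2)
  \<comment> \<open>By the arithmetic-geometric inequality and translation invariance, the integral
    over \<open>l\<close> is at most \<open>N\<close> times the Gaussian, whatever the
    shift.\<close>
  have G: "integrable (lborel \<Otimes>\<^sub>M lborel) G"
  proof (rule lborel_pair.Fubini_integrable)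
    show "G \<in> borel_measurable (lborel \<Otimes>\<^sub>M lborel)" unfolding G_def by measurable
    show "AE x in lborel. integrable lborel (\<lambda>y. G (x, y))"
      unfolding G_def using intf by simp
    show "integrable lborel (\<lambda>x. \<integral>y. norm (G (x, y)) \<partial>lborel)"
    proof (rule Bochner_Integration.integrable_bound)
      show "integrable lborel (\<lambda>s. N * exp (- (s\<^sup>2) / 2))"
        by (intro integrable_mult_right gaussian_integrable)
      show "(\<lambda>x. \<integral>y. norm (G (x, y)) \<partial>lborel) \<in> borel_measurable lborel"
        unfolding G_def by measurable
      show "AE x in lborel. norm (LBINT y. norm (G (x, y))) \<le> norm (N * exp (- (x\<^sup>2) / 2))"
      proof (rule AE_I2)
        fix x
        let ?t = "\<sigma> * x"
        have "(LBINT l. norm (cnj (f l) * f (l + ?t)))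
          \<le> (LBINT l. ((norm (f l))\<^sup>2 + (norm (f (l + ?t)))\<^sup>2) / 2)"
        proof (rule integral_mono)
          show "integrable lborel (\<lambda>l. ((norm (f l))\<^sup>2 + (norm (f (l + ?t)))\<^sup>2) / 2)"
            using f2 L2_translate[OF f2] by (simp add: L2_def)
          show "norm (cnj (f l) * f (l + ?t)) \<le> ((norm (f l))\<^sup>2 + (norm (f (l + ?t)))\<^sup>2) / 2" for l
            using sum_squares_bound[of "norm (f l)" "norm (f (l + ?t))"] by (simp add: norm_mult)
        qed (use intf in simp)
        also have "\<dots> = N"
          using f2 L2_translate[OF f2, of ?t] integral_translate[of "\<lambda>l. (norm (f l))\<^sup>2" ?t]
          by (simp add: L2_def N_def)
        finally have "(LBINT l. norm (cnj (f l) * f (l + ?t))) \<le> N" .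
        moreover have "0 \<le> (LBINT l. norm (cnj (f l) * f (l + ?t)))" by (rule integral_nonneg_AE) simp
        ultimately show "norm (LBINT y. norm (G (x, y))) \<le> norm (N * exp (- (x\<^sup>2) / 2))"
          unfolding G_def
          by (auto simp: norm_mult mult.commute[of N] intro!: order_trans[OF _ abs_ge_self] mult_left_mono)
      qed
    qed
  qed
  have "(LBINT y. (w y * fourier f y) * cnj (fourier f y))
      = (LBINT y. (w y * fourier f y) * (LBINT l. cnj (f l) * cis (- l * y)))"
    by (simp only: cnjF)
  also have "\<dots> = (LBINT l. cnj (f l) * (LBINT y. (w y * fourier f y) * cis (- l * y)))"
    by (rule Fubini_kernel[OF wF]) (use f in auto)
  also have "\<dots> = (LBINT l. c * (LBINT s. G (s, l)))"
    unfolding inner G_def by (simp add: mult_ac)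
  also have "\<dots> = c * (LBINT l. (LBINT s. G (s, l)))"
    by simp
  also have "(LBINT l. (LBINT s. G (s, l))) = (LBINT s. (LBINT l. G (s, l)))"
    using lborel_pair.Fubini_integral[of "\<lambda>s l. G (s, l)"] G by simp
  finally have eq: "(LBINT y. (w y * fourier f y) * cnj (fourier f y))
     = c * (LBINT s. (LBINT l. G (s, l)))" .
  have "complex_of_real (LBINT y. (norm (fourier f y))\<^sup>2 * exp (- ((\<sigma> * y)\<^sup>2) / 2))
     = (LBINT y. (w y * fourier f y) * cnj (fourier f y))"
    unfolding integral_complex_of_real[symmetric]
    by (intro Bochner_Integration.integral_cong) (auto simp: w_def mult_ac complex_norm_square[unfolded of_real_power])
  from arg_cong[OF this, of Re]
  have "(LBINT y. (norm (fourier f y))\<^sup>2 * exp (- ((\<sigma> * y)\<^sup>2) / 2))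
     = sqrt (2 * pi) * Re (LBINT s. (LBINT l. G (s, l)))"
    unfolding eq by (simp add: c_def)
  also have "Re (LBINT s. (LBINT l. G (s, l))) = (LBINT s. Re (LBINT l. G (s, l)))"
    using lborel_pair.integrable_fst'[OF G] by (rule integral_Re[symmetric])
  also have "\<dots> = (LBINT s. exp (- (s\<^sup>2) / 2) * Re (LBINT l. cnj (f l) * f (l + \<sigma> * s)))"
    unfolding G_def by (simp del: of_real_exp exp_of_real)
  finally show ?thesis .
qed

text \<open>Expanding the squared norm of the difference reduces continuity of the autocorrelation
  at 0 to continuity of translations in the mean.\<close>

lemma autocorrelation:
  fixes f :: "real \<Rightarrow> complex"
  assumes f: "f \<in> L2 lborel"
  shows "Re (LBINT l. cnj (f l) * f (l + t))
    = (LBINT l. (norm (f l))\<^sup>2) - (LBINT l. (norm (f (l + t) - f l))\<^sup>2) / 2"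
proof -
  have int: "integrable lborel (\<lambda>l. cnj (f l) * f (l + t))"
    by (intro L2_integrable_mult L2_cnj L2_translate f)
  have ints: "integrable lborel (\<lambda>l. (norm (f (l + t)))\<^sup>2)" "integrable lborel (\<lambda>l. (norm (f l))\<^sup>2)"
    by (intro L2_integrable L2_translate f)+
  have eq: "(norm (f (l + t) - f l))\<^sup>2 = (norm (f (l + t)))\<^sup>2 + (norm (f l))\<^sup>2 - 2 * Re (cnj (f l) * f (l + t))" for l
    unfolding cmod_power2 by (simp add: power2_eq_square algebra_simps)
  have "(LBINT l. (norm (f (l + t) - f l))\<^sup>2)
     = (LBINT l. (norm (f (l + t)))\<^sup>2) + (LBINT l. (norm (f l))\<^sup>2) - 2 * (LBINT l. Re (cnj (f l) * f (l + t)))"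
    unfolding eq using ints integrable_Re[OF int] by (simp del: times_complex.sel)
  moreover have "(LBINT l. (norm (f (l + t)))\<^sup>2) = (LBINT l. (norm (f l))\<^sup>2)"
    by (rule integral_translate)
  moreover have "(LBINT l. Re (cnj (f l) * f (l + t))) = Re (LBINT l. cnj (f l) * f (l + t))"
    using int by (rule integral_Re)
  ultimately show ?thesis by argo
qed

text \<open>Both sides are limits of the Gaussian-damped identity as the width
  \<open>\<sigma> n\<close> decreases to 0: by monotone convergence on the left, by dominated
  convergence on the right. The left side is an extended integral because square integrability of
  the transform is itself a consequence.\<close>

theorem plancherel:
  fixes f :: "real \<Rightarrow> complex"
  assumes f: "integrable lborel f" and f2: "f \<in> L2 lborel"
  shows "(\<integral>\<^sup>+y. ennreal ((norm (fourier f y))\<^sup>2) \<partial>lborel) = 2 * pi * (LBINT l. (norm (f l))\<^sup>2)"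
proof (rule LIMSEQ_unique)
  have [measurable]: "f \<in> borel_measurable borel" using f by auto
  define \<sigma> where "\<sigma> n = 1 / real (Suc n)" for n
  define I where "I n y = (norm (fourier f y))\<^sup>2 * exp (- ((\<sigma> n * y)\<^sup>2) / 2)" for n y
  define N where "N = (LBINT l. (norm (f l))\<^sup>2)"
  define A where "A t = Re (LBINT l. cnj (f l) * f (l + t))" for t
  have \<sigma>: "\<sigma> n > 0" for n by (simp add: \<sigma>_def)
  have \<sigma>0: "\<sigma> \<longlonglongrightarrow> 0"
    unfolding \<sigma>_def[abs_def] using LIMSEQ_inverse_real_of_nat by (simp add: inverse_eq_divide)
  have [measurable]: "I n \<in> borel_measurable borel" "A \<in> borel_measurable borel" for n
    unfolding I_def[abs_def] A_def[abs_def] by measurable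
  have I_int: "integrable lborel (I n)" for n
  proof (rule Bochner_Integration.integrable_bound)
    show "integrable lborel (\<lambda>y. (LBINT k. norm (f k))\<^sup>2 * norm (complex_of_real (exp (- ((\<sigma> n * y)\<^sup>2) / 2))))"
      by (intro integrable_mult_right integrable_norm gaussian_scaled_integrable \<sigma>)
    have "I n y \<le> (LBINT k. norm (f k))\<^sup>2 * norm (complex_of_real (exp (- ((\<sigma> n * y)\<^sup>2) / 2)))" for y
      unfolding I_def norm_of_real by (intro mult_mono power_mono norm_fourier_le) auto
    moreover have "0 \<le> I n y" for y by (simp add: I_def)
    ultimately show "AE y in lborel. norm (I n y) \<le> norm ((LBINT k. norm (f k))\<^sup>2 * norm (complex_of_real (exp (- ((\<sigma> n * y)\<^sup>2) / 2))))"
      by (simp add: abs_of_nonneg)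
  qed simp
  show "(\<lambda>n. \<integral>\<^sup>+y. ennreal (I n y) \<partial>lborel) \<longlonglongrightarrow> (\<integral>\<^sup>+y. ennreal ((norm (fourier f y))\<^sup>2) \<partial>lborel)"
  proof (rule nn_integral_LIMSEQ)
    show "incseq (\<lambda>n y. ennreal (I n y))"
    proof (intro incseq_SucI le_funI ennreal_leI)
      fix n y
      have "(\<sigma> (Suc n) * y)\<^sup>2 \<le> (\<sigma> n * y)\<^sup>2"
        unfolding power_mult_distrib by (intro mult_right_mono power_mono) (auto simp: \<sigma>_def field_simps)
      then show "I n y \<le> I (Suc n) y" unfolding I_def by (intro mult_left_mono) auto
    qed
    show "(\<lambda>n. ennreal (I n y)) \<longlonglongrightarrow> ennreal ((norm (fourier f y))\<^sup>2)" for y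
    proof -
      have "(\<lambda>n. I n y) \<longlonglongrightarrow> (norm (fourier f y))\<^sup>2 * exp (- ((0 * y)\<^sup>2) / 2)"
        unfolding I_def by (intro tendsto_intros \<sigma>0) simp
      then show ?thesis by (intro tendsto_ennrealI) simp
    qed
  qed simp
  have "(\<lambda>n. \<integral>s. exp (- (s\<^sup>2) / 2) * A (\<sigma> n * s) \<partial>lborel) \<longlonglongrightarrow> (LBINT s. exp (- (s\<^sup>2) / 2) * N)"
  proof (rule integral_dominated_convergence[where w="\<lambda>s. N * exp (- (s\<^sup>2) / 2)"])
    show "integrable lborel (\<lambda>s. N * exp (- (s\<^sup>2) / 2))"
      by (intro integrable_mult_right gaussian_integrable)
    show "AE s in lborel. (\<lambda>n. exp (- (s\<^sup>2) / 2) * A (\<sigma> n * s)) \<longlonglongrightarrow> exp (- (s\<^sup>2) / 2) * N"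
    proof (rule AE_I2)
      fix s :: real
      have "(\<lambda>n. \<sigma> n * s) \<longlonglongrightarrow> 0 * s" by (intro tendsto_intros \<sigma>0)
      then have "(\<lambda>n. \<integral>k. (norm (f (k + \<sigma> n * s) - f k))\<^sup>2 \<partial>lborel) \<longlonglongrightarrow> 0"
        by (intro translate_tendsto_L2 f2) simp
      then have "(\<lambda>n. A (\<sigma> n * s)) \<longlonglongrightarrow> N - 0 / 2"
        unfolding A_def autocorrelation[OF f2] N_def by (intro tendsto_intros) auto
      then show "(\<lambda>n. exp (- (s\<^sup>2) / 2) * A (\<sigma> n * s)) \<longlonglongrightarrow> exp (- (s\<^sup>2) / 2) * N"
        by (intro tendsto_intros) simp
    qed
    have A_le: "\<bar>A t\<bar> \<le> N" for t
    proof -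
      have "(LBINT k. (norm (f (k + t) - f k))\<^sup>2) \<le> (LBINT k. 2 * (norm (f (k + t)))\<^sup>2 + 2 * (norm (f k))\<^sup>2)"
        by (intro integral_mono norm_diff_sq_le L2_integrable L2_diff L2_translate f2
            Bochner_Integration.integrable_add integrable_mult_right)
      also have "\<dots> = 4 * N"
        using L2_integrable[OF L2_translate[OF f2, of t]] L2_integrable[OF f2]
          integral_translate[of "\<lambda>k. (norm (f k))\<^sup>2" t] by (simp add: N_def)
      finally have "(LBINT k. (norm (f (k + t) - f k))\<^sup>2) \<le> 4 * N" .
      moreover have "0 \<le> (LBINT k. (norm (f (k + t) - f k))\<^sup>2)" by (rule integral_nonneg_AE) simp
      ultimately show ?thesis unfolding A_def autocorrelation[OF f2] N_def[symmetric] by linarith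
    qed
    show "AE s in lborel. norm (exp (- (s\<^sup>2) / 2) * A (\<sigma> n * s)) \<le> N * exp (- (s\<^sup>2) / 2)" for n
      using A_le by (intro AE_I2) (simp add: abs_mult mult.commute mult_right_mono)
  qed simp_all
  then have "(\<lambda>n. sqrt (2 * pi) * (LBINT s. exp (- (s\<^sup>2) / 2) * A (\<sigma> n * s)))
      \<longlonglongrightarrow> sqrt (2 * pi) * (LBINT s. exp (- (s\<^sup>2) / 2) * N)"
    by (intro tendsto_intros)
  also have "sqrt (2 * pi) * (LBINT s. exp (- (s\<^sup>2) / 2) * N) = 2 * pi * N"
    using gaussian_integral by simp
  finally have "(\<lambda>n. \<integral>y. I n y \<partial>lborel) \<longlonglongrightarrow> 2 * pi * N"
    unfolding I_def A_def fourier_gaussian_regularized[OF f f2 \<sigma>] .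
  then have "(\<lambda>n. ennreal (LBINT y. I n y)) \<longlonglongrightarrow> ennreal (2 * pi * N)"
    by (rule tendsto_ennrealI)
  moreover have "(\<integral>\<^sup>+y. ennreal (I n y) \<partial>lborel) = ennreal (LBINT y. I n y)" for n
    by (intro nn_integral_eq_integral I_int) (simp add: I_def)
  ultimately show "(\<lambda>n. \<integral>\<^sup>+y. ennreal (I n y) \<partial>lborel) \<longlonglongrightarrow> ennreal (2 * pi * (LBINT l. (norm (f l))\<^sup>2))"
    by (simp add: N_def)
qed

lemma fourier_L2:
  assumes f: "integrable lborel f" and f2: "f \<in> L2 lborel"
  shows "fourier f \<in> L2 lborel"
    and "(LBINT y. (norm (fourier f y))\<^sup>2) = 2 * pi * (LBINT l. (norm (f l))\<^sup>2)"
proof -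
  have [measurable]: "f \<in> borel_measurable borel" using f by auto
  show *: "fourier f \<in> L2 lborel"
    unfolding L2_iff_nn_integral plancherel[OF f f2] by simp
  have "0 \<le> (LBINT l. (norm (f l))\<^sup>2)" by (rule integral_nonneg_AE) simp
  then show "(LBINT y. (norm (fourier f y))\<^sup>2) = 2 * pi * (LBINT l. (norm (f l))\<^sup>2)"
    using plancherel[OF f f2] unfolding L2_nn_integral[OF *]
    by (subst (asm) ennreal_inj) (auto intro!: integral_nonneg_AE)
qed

section \<open>Polarization and the partial Fourier transform\<close>

text \<open>An inner product is a combination of the squared norms of \<open>F + c * G\<close> for
  \<open>c = 1, -1, \<i>, - \<i>\<close>, so a map that scales squared norms of such sums by
  \<open>C\<close> scales inner products by \<open>C\<close>.\<close>

lemma polarization: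
  fixes F G :: "'a \<Rightarrow> complex" and f g :: "'b \<Rightarrow> complex"
  assumes F: "F \<in> L2 M" and G: "G \<in> L2 M" and f: "f \<in> L2 N" and g: "g \<in> L2 N"
    and eq: "\<And>c. (\<integral>z. (norm (F z + c * G z))\<^sup>2 \<partial>M) = C * (\<integral>z. (norm (f z + c * g z))\<^sup>2 \<partial>N)"
  shows "(\<integral>z. cnj (F z) * G z \<partial>M) = of_real C * (\<integral>z. cnj (f z) * g z \<partial>N)"
proof -
  have pol: "(\<integral>z. cnj (F z) * G z \<partial>M) =
      (of_real (\<integral>z. (norm (F z + 1 * G z))\<^sup>2 \<partial>M) - of_real (\<integral>z. (norm (F z + (-1) * G z))\<^sup>2 \<partial>M)
      - \<i> * of_real (\<integral>z. (norm (F z + \<i> * G z))\<^sup>2 \<partial>M) + \<i> * of_real (\<integral>z. (norm (F z + (-\<i>) * G z))\<^sup>2 \<partial>M)) / 4"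
    if F: "F \<in> L2 M" and G: "G \<in> L2 M" for F G :: "'c \<Rightarrow> complex" and M
  proof -
    have int: "integrable M (\<lambda>z. complex_of_real ((norm (F z + c * G z))\<^sup>2))" for c
      by (intro integrable_of_real L2_integrable L2_add L2_cmult F G)
    have pt: "cnj a * b = (of_real ((norm (a + 1 * b))\<^sup>2) - of_real ((norm (a + (-1) * b))\<^sup>2)
      - \<i> * of_real ((norm (a + \<i> * b))\<^sup>2) + \<i> * of_real ((norm (a + (-\<i>) * b))\<^sup>2)) / 4" for a b
      by (rule complex_eqI; simp add: cmod_power2; simp add: power2_eq_square algebra_simps)
    show ?thesis
      unfolding pt integral_complex_of_real[symmetric] using int[of 1] int[of "-1"] int[of \<i>] int[of "-\<i>"]
      by (simp del: of_real_power)
  qed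
  show ?thesis
    unfolding pol[OF F G] pol[OF f g] eq by (simp add: field_simps)
qed

text \<open>The slice conditions are imposed for every \<open>x\<close>, so that the transform is
  given by convergent integrals everywhere and is additive pointwise, not just almost
  everywhere.\<close>

definition slicewise_L2 :: "(real \<times> real \<Rightarrow> complex) \<Rightarrow> bool" where
  "slicewise_L2 P \<longleftrightarrow> P \<in> L2 lborel \<and>
     (\<forall>x. integrable lborel (\<lambda>k. P (x, k)) \<and> (\<lambda>k. P (x, k)) \<in> L2 lborel)"

definition partial_fourier :: "(real \<times> real \<Rightarrow> complex) \<Rightarrow> real \<times> real \<Rightarrow> complex" where
  "partial_fourier P = (\<lambda>(x, y). fourier (\<lambda>k. P (x, k)) y)"

lemma slicewise_L2_cmult: "slicewise_L2 P \<Longrightarrow> slicewise_L2 (\<lambda>z. c * P z)"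
  by (auto simp: slicewise_L2_def intro: L2_cmult)

lemma slicewise_L2_add: "slicewise_L2 P \<Longrightarrow> slicewise_L2 Q \<Longrightarrow> slicewise_L2 (\<lambda>z. P z + Q z)"
  by (auto simp: slicewise_L2_def intro: L2_add)

lemma partial_fourier_cmult: "partial_fourier (\<lambda>z. c * P z) z = c * partial_fourier P z"
  by (simp add: partial_fourier_def fourier_cmult split: prod.split)

lemma partial_fourier_add:
  "slicewise_L2 P \<Longrightarrow> slicewise_L2 Q \<Longrightarrow>
    partial_fourier (\<lambda>z. P z + Q z) z = partial_fourier P z + partial_fourier Q z"
  by (simp add: partial_fourier_def fourier_add slicewise_L2_def split: prod.split)

lemma partial_fourier_measurable [measurable (raw)]:
  assumes [measurable]: "P \<in> borel_measurable borel"
  shows "partial_fourier P \<in> borel_measurable borel"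
proof -
  have "(\<lambda>z. \<integral>k. P (fst z, k) * cis (k * snd z) \<partial>lborel) \<in> borel_measurable (borel :: (real \<times> real) measure)"
    unfolding borel_prod[symmetric] by measurable
  then show ?thesis by (simp add: partial_fourier_def fourier_def case_prod_unfold)
qed

lemma nn_integral_lborel_iterated:
  fixes f :: "real \<times> real \<Rightarrow> ennreal"
  assumes "f \<in> borel_measurable borel"
  shows "(\<integral>\<^sup>+x. (\<integral>\<^sup>+y. f (x, y) \<partial>lborel) \<partial>lborel) = (\<integral>\<^sup>+z. f z \<partial>lborel)"
    and "(\<integral>\<^sup>+y. (\<integral>\<^sup>+x. f (x, y) \<partial>lborel) \<partial>lborel) = (\<integral>\<^sup>+z. f z \<partial>lborel)"
proof -
  have f: "f \<in> borel_measurable (lborel \<Otimes>\<^sub>M lborel)"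
    using assms by (simp add: lborel_prod)
  show "(\<integral>\<^sup>+x. (\<integral>\<^sup>+y. f (x, y) \<partial>lborel) \<partial>lborel) = (\<integral>\<^sup>+z. f z \<partial>lborel)"
    using lborel.nn_integral_fst[OF f] by (simp add: lborel_prod)
  show "(\<integral>\<^sup>+y. (\<integral>\<^sup>+x. f (x, y) \<partial>lborel) \<partial>lborel) = (\<integral>\<^sup>+z. f z \<partial>lborel)"
    using lborel_pair.nn_integral_snd[of f] f by (simp add: lborel_prod)
qed

text \<open>Plancherel on each line of constant \<open>x\<close>, integrated over \<open>x\<close>
  by Tonelli's theorem.\<close>

lemma nn_integral_partial_fourier:
  assumes P: "slicewise_L2 P"
  shows "(\<integral>\<^sup>+z. ennreal ((norm (partial_fourier P z))\<^sup>2) \<partial>lborel)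
    = 2 * pi * (\<integral>\<^sup>+z. ennreal ((norm (P z))\<^sup>2) \<partial>lborel)"
proof -
  have [measurable]: "P \<in> borel_measurable borel" using P by (auto simp: slicewise_L2_def L2_def)
  have slice: "(\<integral>\<^sup>+y. ennreal ((norm (partial_fourier P (x, y)))\<^sup>2) \<partial>lborel)
      = 2 * pi * (\<integral>\<^sup>+k. ennreal ((norm (P (x, k)))\<^sup>2) \<partial>lborel)" for x
    using P plancherel[of "\<lambda>k. P (x, k)"]
    by (simp add: partial_fourier_def slicewise_L2_def L2_nn_integral ennreal_mult' integral_nonneg_AE)
  have "(\<integral>\<^sup>+z. ennreal ((norm (partial_fourier P z))\<^sup>2) \<partial>lborel)
      = (\<integral>\<^sup>+x. (\<integral>\<^sup>+y. ennreal ((norm (partial_fourier P (x, y)))\<^sup>2) \<partial>lborel) \<partial>lborel)"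
    by (subst nn_integral_lborel_iterated) measurable
  also have "\<dots> = (\<integral>\<^sup>+x. 2 * pi * (\<integral>\<^sup>+k. ennreal ((norm (P (x, k)))\<^sup>2) \<partial>lborel) \<partial>lborel)"
    unfolding slice ..
  also have "\<dots> = 2 * pi * (\<integral>\<^sup>+x. (\<integral>\<^sup>+k. ennreal ((norm (P (x, k)))\<^sup>2) \<partial>lborel) \<partial>lborel)"
  proof (rule nn_integral_cmult)
    show "(\<lambda>x. \<integral>\<^sup>+k. ennreal ((norm (P (x, k)))\<^sup>2) \<partial>lborel) \<in> borel_measurable lborel"
      by (rule lborel.borel_measurable_nn_integral) (simp add: case_prod_unfold lborel_prod)
  qed
  also have "(\<integral>\<^sup>+x. (\<integral>\<^sup>+k. ennreal ((norm (P (x, k)))\<^sup>2) \<partial>lborel) \<partial>lborel) = (\<integral>\<^sup>+z. ennreal ((norm (P z))\<^sup>2) \<partial>lborel)"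
    by (subst nn_integral_lborel_iterated) measurable
  finally show ?thesis .
qed

lemma partial_fourier_L2:
  assumes P: "slicewise_L2 P"
  shows "partial_fourier P \<in> L2 lborel"
    and "(LBINT z. (norm (partial_fourier P z))\<^sup>2) = 2 * pi * (LBINT z. (norm (P z))\<^sup>2)"
proof -
  have PL: "P \<in> L2 lborel" and [measurable]: "P \<in> borel_measurable borel"
    using P by (auto simp: slicewise_L2_def L2_def)
  have nn: "0 \<le> (LBINT z. (norm (P z))\<^sup>2)" by (rule integral_nonneg_AE) simp
  have *: "(\<integral>\<^sup>+z. ennreal ((norm (partial_fourier P z))\<^sup>2) \<partial>lborel) = ennreal (2 * pi * (LBINT z. (norm (P z))\<^sup>2))"
    unfolding nn_integral_partial_fourier[OF P] L2_nn_integral[OF PL] using nn by (simp add: ennreal_mult)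
  show **: "partial_fourier P \<in> L2 lborel"
    unfolding L2_iff_nn_integral * by simp
  show "(LBINT z. (norm (partial_fourier P z))\<^sup>2) = 2 * pi * (LBINT z. (norm (P z))\<^sup>2)"
    using * nn unfolding L2_nn_integral[OF **] by (subst (asm) ennreal_inj) (auto intro!: integral_nonneg_AE)
qed

lemma partial_fourier_inner:
  assumes P: "slicewise_L2 P" and Q: "slicewise_L2 Q"
  shows "(LBINT z. cnj (partial_fourier P z) * partial_fourier Q z)
    = of_real (2 * pi) * (LBINT z. cnj (P z) * Q z)"
proof (rule polarization)
  show "(LBINT z. (norm (partial_fourier P z + c * partial_fourier Q z))\<^sup>2)
    = 2 * pi * (LBINT z. (norm (P z + c * Q z))\<^sup>2)" for c
    using partial_fourier_L2(2)[OF slicewise_L2_add[OF P slicewise_L2_cmult[OF Q, of c]]]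
    by (simp add: partial_fourier_add[OF P slicewise_L2_cmult[OF Q]] partial_fourier_cmult)
qed (use P Q partial_fourier_L2 in \<open>auto simp: slicewise_L2_def\<close>)

section \<open>Convergence in the mean\<close>

text \<open>Extended integrals allow its use before the limit is known to be square integrable, and
  also with \<open>C\<close> infinite.\<close>

lemma nn_integral_Fatou_bound:
  fixes u :: "nat \<Rightarrow> 'a \<Rightarrow> complex"
  assumes [measurable]: "\<And>n. u n \<in> borel_measurable M"
    and lim: "AE z in M. (\<lambda>n. u n z) \<longlonglongrightarrow> v z"
    and C: "\<forall>\<^sub>F n in sequentially. (\<integral>\<^sup>+z. ennreal ((norm (u n z))\<^sup>2) \<partial>M) \<le> C"
  shows "(\<integral>\<^sup>+z. ennreal ((norm (v z))\<^sup>2) \<partial>M) \<le> C"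
proof -
  have "(\<integral>\<^sup>+z. ennreal ((norm (v z))\<^sup>2) \<partial>M) = (\<integral>\<^sup>+z. liminf (\<lambda>n. ennreal ((norm (u n z))\<^sup>2)) \<partial>M)"
  proof (rule nn_integral_cong_AE)
    show "AE z in M. ennreal ((norm (v z))\<^sup>2) = liminf (\<lambda>n. ennreal ((norm (u n z))\<^sup>2))"
      using lim
    proof eventually_elim
      case (elim z)
      then have "(\<lambda>n. ennreal ((norm (u n z))\<^sup>2)) \<longlonglongrightarrow> ennreal ((norm (v z))\<^sup>2)"
        by (intro tendsto_intros)
      from lim_imp_Liminf[OF _ this] show ?case by simp
    qed
  qed
  also have "\<dots> \<le> liminf (\<lambda>n. \<integral>\<^sup>+z. ennreal ((norm (u n z))\<^sup>2) \<partial>M)"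
    by (rule nn_integral_liminf) simp
  also have "\<dots> \<le> C"
    using C by (intro Liminf_le) auto
  finally show ?thesis .
qed

text \<open>The Riesz-Fischer theorem. The almost everywhere convergent subsequence belongs to the
  conclusion because the limit is later manipulated pointwise.\<close>

lemma L2_Cauchy_convergent:
  fixes u :: "nat \<Rightarrow> 'a \<Rightarrow> complex"
  assumes u: "\<And>n. u n \<in> L2 M"
    and Cauchy: "\<And>e. e > 0 \<Longrightarrow> \<exists>N. \<forall>m\<ge>N. \<forall>n\<ge>N. (\<integral>z. (norm (u m z - u n z))\<^sup>2 \<partial>M) < e"
  obtains r g where "strict_mono r" "g \<in> L2 M" "AE z in M. (\<lambda>j. u (r j) z) \<longlonglongrightarrow> g z"
    "(\<lambda>n. \<integral>z. (norm (u n z - g z))\<^sup>2 \<partial>M) \<longlonglongrightarrow> 0"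
proof -
  note [measurable] = L2_measurable[OF u]
  \<comment> \<open>With the weight \<open>2 ^ j\<close> in \<open>d\<close> below, the rate
    \<open>(1/8) ^ j\<close> still leaves the summable bound \<open>(1/4) ^ j\<close>.\<close>
  have "\<forall>j. \<exists>N. \<forall>m\<ge>N. \<forall>n\<ge>N. (\<integral>z. (norm (u m z - u n z))\<^sup>2 \<partial>M) < (1/8) ^ j"
    using Cauchy by simp
  then obtain N where N: "\<And>j m n. m \<ge> N j \<Longrightarrow> n \<ge> N j \<Longrightarrow> (\<integral>z. (norm (u m z - u n z))\<^sup>2 \<partial>M) < (1/8) ^ j"
    by metis
  \<comment> \<open>The summand \<open>j\<close> makes \<open>r\<close> strictly increasing; the
    partial sum makes \<open>r j\<close> at least \<open>N j\<close>.\<close>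
  define r where "r j = j + (\<Sum>i\<le>j. N i)" for j
  have r: "strict_mono r"
    by (rule strict_mono_Suc_iff[THEN iffD2]) (simp add: r_def)
  have rN: "r j \<ge> N j" for j
    using member_le_sum[of j "{..j}" N] by (simp add: r_def)
  define d where "d j z = 2 ^ j * (norm (u (r (Suc j)) z - u (r j) z))\<^sup>2" for j z
  have [measurable]: "d j \<in> borel_measurable M" for j unfolding d_def[abs_def] by measurable
  have d0: "0 \<le> d j z" for j z by (simp add: d_def)
  have "(\<integral>\<^sup>+z. (\<Sum>j. ennreal (d j z)) \<partial>M) = (\<Sum>j. \<integral>\<^sup>+z. ennreal (d j z) \<partial>M)"
    by (rule nn_integral_suminf) simp
  also have "\<dots> \<le> (\<Sum>j. ennreal ((1/4) ^ j))"
  proof (rule suminf_le)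
    fix j
    have "(\<integral>\<^sup>+z. ennreal (d j z) \<partial>M) = ennreal (\<integral>z. d j z \<partial>M)"
      unfolding d_def by (intro nn_integral_eq_integral integrable_mult_right L2_integrable L2_diff u) auto
    also have "(\<integral>z. d j z \<partial>M) \<le> 2 ^ j * (1/8) ^ j"
      unfolding d_def integral_mult_right_zero
      using N[of j "r (Suc j)" "r j"] rN[of j] strict_mono_leD[OF r, of j "Suc j"]
      by (intro mult_left_mono less_imp_le) auto
    also have "2 ^ j * (1/8) ^ j = (1/4 :: real) ^ j"
      by (simp flip: power_mult_distrib)
    finally show "(\<integral>\<^sup>+z. ennreal (d j z) \<partial>M) \<le> ennreal ((1/4) ^ j)" by (simp add: ennreal_leI)
  qed auto
  also have "\<dots> < \<infinity>"
  proof -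
    have "(\<Sum>j. ennreal ((1/4) ^ j)) \<noteq> top"
      by (intro ennreal_suminf_neq_top summable_geometric) auto
    then show ?thesis by (simp only: less_top infinity_ennreal_def)
  qed
  finally have "AE z in M. (\<Sum>j. ennreal (d j z)) \<noteq> \<infinity>"
    by (intro nn_integral_noteq_infinite) auto
  then have conv: "AE z in M. convergent (\<lambda>j. u (r j) z)"
  proof eventually_elim
    case (elim z)
    then have "summable (\<lambda>j. d j z)" using d0 by (intro summable_suminf_not_top) auto
    then have "summable (\<lambda>j. (d j z + (1/2) ^ j) / 2)"
      by (intro summable_divide summable_add summable_geometric) auto
    then have "summable (\<lambda>j. u (r (Suc j)) z - u (r j) z)"
    proof (rule summable_comparison_test_ev[rotated])
      show "\<forall>\<^sub>F j in sequentially. norm (u (r (Suc j)) z - u (r j) z) \<le> (d j z + (1/2) ^ j) / 2"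
      proof (rule always_eventually, rule allI)
        fix j
        define a where "a = norm (u (r (Suc j)) z - u (r j) z)"
        \<comment> \<open>The inequality \<open>2 * a \<le> 2 ^ j * a\<^sup>2 + (1/2) ^ j\<close>
          turns weighted square summability of the increments into absolute summability.\<close>
        have "2 * (sqrt (2 ^ j) * a) * sqrt ((1/2) ^ j) \<le> (sqrt (2 ^ j) * a)\<^sup>2 + (sqrt ((1/2) ^ j))\<^sup>2"
          by (rule sum_squares_bound)
        also have "\<dots> = d j z + (1/2) ^ j"
          by (simp add: d_def a_def power_mult_distrib)
        also have "2 * (sqrt (2 ^ j) * a) * sqrt ((1/2) ^ j) = 2 * a * (sqrt (2 ^ j * (1/2) ^ j))"
          by (simp add: real_sqrt_mult)
        also have "2 ^ j * (1/2::real) ^ j = 1"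
          by (simp flip: power_mult_distrib)
        finally show "a \<le> (d j z + (1/2) ^ j) / 2" by simp
      qed
    qed
    then have "(\<lambda>n. u (r 0) z + (\<Sum>j<n. u (r (Suc j)) z - u (r j) z)) \<longlonglongrightarrow> u (r 0) z + (\<Sum>j. u (r (Suc j)) z - u (r j) z)"
      by (intro tendsto_intros summable_LIMSEQ)
    moreover have "u (r 0) z + (\<Sum>j<n. u (r (Suc j)) z - u (r j) z) = u (r n) z" for n
      using sum_lessThan_telescope[of "\<lambda>j. u (r j) z" n] by simp
    ultimately show ?case by (auto simp: convergent_def)
  qed
  define g where "g z = lim (\<lambda>j. u (r j) z)" for z
  have [measurable]: "g \<in> borel_measurable M" unfolding g_def[abs_def] by measurable
  have lim: "AE z in M. (\<lambda>j. u (r j) z) \<longlonglongrightarrow> g z"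
    using conv by eventually_elim (simp add: g_def convergent_LIMSEQ_iff)
  \<comment> \<open>The Cauchy estimate at fixed \<open>n\<close> against \<open>u (r j)\<close>;
    Fatou's lemma lets \<open>j\<close> tend to infinity.\<close>
  have bound: "(\<integral>\<^sup>+z. ennreal ((norm (u n z - g z))\<^sup>2) \<partial>M) \<le> ennreal e"
    if n: "n \<ge> N0" and N0: "\<And>m n. m \<ge> N0 \<Longrightarrow> n \<ge> N0 \<Longrightarrow> (\<integral>z. (norm (u m z - u n z))\<^sup>2 \<partial>M) < e" for n e N0
  proof (rule nn_integral_Fatou_bound)
    show "AE z in M. (\<lambda>j. u n z - u (r j) z) \<longlonglongrightarrow> u n z - g z"
      using lim by eventually_elim (intro tendsto_intros)
    show "\<forall>\<^sub>F j in sequentially. (\<integral>\<^sup>+z. ennreal ((norm (u n z - u (r j) z))\<^sup>2) \<partial>M) \<le> ennreal e"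
    proof (rule eventually_sequentiallyI[of N0])
      fix j assume "N0 \<le> j"
      then have "r j \<ge> N0" using seq_suble[OF r, of j] by simp
      then show "(\<integral>\<^sup>+z. ennreal ((norm (u n z - u (r j) z))\<^sup>2) \<partial>M) \<le> ennreal e"
        using N0[OF n] by (simp add: L2_nn_integral[OF L2_diff[OF u u]] ennreal_leI less_imp_le)
    qed
  qed measurable
  have diff: "(\<lambda>z. u n z - g z) \<in> L2 M"
    if n: "n \<ge> N0" and N0: "\<And>m n. m \<ge> N0 \<Longrightarrow> n \<ge> N0 \<Longrightarrow> (\<integral>z. (norm (u m z - u n z))\<^sup>2 \<partial>M) < e" for n e N0
    using bound[OF that] by (auto simp: L2_iff_nn_integral intro: le_less_trans[OF _ ennreal_less_top])
  obtain N1 where N1: "\<And>m n. m \<ge> N1 \<Longrightarrow> n \<ge> N1 \<Longrightarrow> (\<integral>z. (norm (u m z - u n z))\<^sup>2 \<partial>M) < 1"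
    using Cauchy[of 1] by auto
  have g: "g \<in> L2 M"
    using L2_diff[OF u[of N1] diff[of N1 N1 1]] N1 by simp
  have "(\<lambda>n. \<integral>z. (norm (u n z - g z))\<^sup>2 \<partial>M) \<longlonglongrightarrow> 0"
  proof (rule LIMSEQ_I)
    fix e :: real assume e: "e > 0"
    obtain N0 where N0: "\<And>m n. m \<ge> N0 \<Longrightarrow> n \<ge> N0 \<Longrightarrow> (\<integral>z. (norm (u m z - u n z))\<^sup>2 \<partial>M) < e / 2"
      using Cauchy[of "e / 2"] e by auto
    have "norm ((\<integral>z. (norm (u n z - g z))\<^sup>2 \<partial>M) - 0) < e" if "n \<ge> N0" for n
    proof -
      have "ennreal (\<integral>z. (norm (u n z - g z))\<^sup>2 \<partial>M) \<le> ennreal (e / 2)"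
        using bound[OF that N0] by (simp add: L2_nn_integral[OF L2_diff[OF u g]])
      then have "(\<integral>z. (norm (u n z - g z))\<^sup>2 \<partial>M) \<le> e / 2" using e by (simp add: ennreal_le_iff)
      moreover have "0 \<le> (\<integral>z. (norm (u n z - g z))\<^sup>2 \<partial>M)" by (rule integral_nonneg_AE) simp
      ultimately show ?thesis using e by simp
    qed
    then show "\<exists>no. \<forall>n\<ge>no. norm ((\<integral>z. (norm (u n z - g z))\<^sup>2 \<partial>M) - 0) < e" by blast
  qed
  then show ?thesis using that r g lim by blast
qed

text \<open>The weighted inequality \<open>2 * a * b \<le> a\<^sup>2 / \<epsilon> + \<epsilon> *
  b\<^sup>2\<close> replaces the Cauchy-Schwarz inequality.\<close>

lemma L2_tendsto_pairing:
  fixes u :: "nat \<Rightarrow> 'a \<Rightarrow> complex"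
  assumes u: "\<And>n. u n \<in> L2 M" and g: "g \<in> L2 M" and \<phi>: "\<phi> \<in> L2 M"
    and lim: "(\<lambda>n. \<integral>z. (norm (u n z - g z))\<^sup>2 \<partial>M) \<longlonglongrightarrow> 0"
  shows "(\<lambda>n. \<integral>z. u n z * \<phi> z \<partial>M) \<longlonglongrightarrow> (\<integral>z. g z * \<phi> z \<partial>M)"
proof (rule LIMSEQ_I)
  fix e :: real assume e: "e > 0"
  define B where "B = (\<integral>z. (norm (\<phi> z))\<^sup>2 \<partial>M)"
  \<comment> \<open>Chosen so that \<open>\<epsilon> * B < e\<close>; the summand 1 covers
    \<open>B = 0\<close>. The threshold \<open>e * \<epsilon>\<close> below makes the other term
    less than \<open>e\<close>, and the estimate is the mean of the two.\<close>
  define \<epsilon> where "\<epsilon> = e / (1 + B)"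
  have B: "0 \<le> B" unfolding B_def by (rule integral_nonneg_AE) simp
  then have \<epsilon>: "\<epsilon> > 0" using e by (simp add: \<epsilon>_def)
  have \<epsilon>B: "\<epsilon> * B < e" using B e by (simp add: \<epsilon>_def field_simps)
  obtain n0 where n0: "\<And>n. n \<ge> n0 \<Longrightarrow> (\<integral>z. (norm (u n z - g z))\<^sup>2 \<partial>M) < e * \<epsilon>"
    using LIMSEQ_D[OF lim, of "e * \<epsilon>"] e \<epsilon> by fastforce
  have "norm ((\<integral>z. u n z * \<phi> z \<partial>M) - (\<integral>z. g z * \<phi> z \<partial>M)) < e" if n: "n \<ge> n0" for n
  proof -
    have int: "integrable M (\<lambda>z. (norm (u n z - g z))\<^sup>2)" "integrable M (\<lambda>z. (norm (\<phi> z))\<^sup>2)"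
      "integrable M (\<lambda>z. (u n z - g z) * \<phi> z)"
      by (intro L2_integrable L2_integrable_mult L2_diff u g \<phi>)+
    have "(\<integral>z. u n z * \<phi> z \<partial>M) - (\<integral>z. g z * \<phi> z \<partial>M) = (\<integral>z. (u n z - g z) * \<phi> z \<partial>M)"
      using L2_integrable_mult[OF u \<phi>] L2_integrable_mult[OF g \<phi>] by (simp add: left_diff_distrib)
    also have "norm \<dots> \<le> (\<integral>z. norm ((u n z - g z) * \<phi> z) \<partial>M)" by (rule integral_norm_bound)
    also have "\<dots> \<le> (\<integral>z. ((norm (u n z - g z))\<^sup>2 / \<epsilon> + \<epsilon> * (norm (\<phi> z))\<^sup>2) / 2 \<partial>M)"
    proof (rule integral_mono)
      fix z
      have "2 * (norm (u n z - g z) / sqrt \<epsilon>) * (sqrt \<epsilon> * norm (\<phi> z))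
        \<le> (norm (u n z - g z) / sqrt \<epsilon>)\<^sup>2 + (sqrt \<epsilon> * norm (\<phi> z))\<^sup>2"
        by (rule sum_squares_bound)
      also have "\<dots> = (norm (u n z - g z))\<^sup>2 / \<epsilon> + \<epsilon> * (norm (\<phi> z))\<^sup>2"
        using \<epsilon> by (simp add: power_divide power_mult_distrib)
      finally show "norm ((u n z - g z) * \<phi> z) \<le> ((norm (u n z - g z))\<^sup>2 / \<epsilon> + \<epsilon> * (norm (\<phi> z))\<^sup>2) / 2"
        using \<epsilon> by (simp add: norm_mult)
    qed (use int in simp_all)
    also have "\<dots> = ((\<integral>z. (norm (u n z - g z))\<^sup>2 \<partial>M) / \<epsilon> + \<epsilon> * B) / 2"
      using int by (simp add: B_def)
    also have "\<dots> < e"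
    proof -
      have "(\<integral>z. (norm (u n z - g z))\<^sup>2 \<partial>M) / \<epsilon> < e"
        using n0[OF n] \<epsilon> by (simp add: pos_divide_less_eq)
      then show ?thesis using \<epsilon>B by simp
    qed
    finally show ?thesis .
  qed
  then show "\<exists>no. \<forall>n\<ge>no. norm ((\<integral>z. u n z * \<phi> z \<partial>M) - (\<integral>z. g z * \<phi> z \<partial>M)) < e" by blast
qed

section \<open>Difference quotients\<close>

lemma has_vector_derivative_LIMSEQ:
  fixes f :: "real \<Rightarrow> 'a::real_normed_vector"
  assumes f: "(f has_vector_derivative D) (at x)" and h: "h \<longlonglongrightarrow> 0" "\<And>n. h n \<noteq> 0"
  shows "(\<lambda>n. (f (x + h n) - f x) /\<^sub>R h n) \<longlonglongrightarrow> D"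
proof -
  have "((\<lambda>h. norm (f (x + h) - f x - h *\<^sub>R D) / norm h) \<longlongrightarrow> 0) (at 0)"
    using f by (simp add: has_vector_derivative_def has_derivative_at)
  moreover have "filterlim h (at 0) sequentially"
    using h by (simp add: filterlim_at)
  ultimately have "(\<lambda>n. norm (f (x + h n) - f x - h n *\<^sub>R D) / norm (h n)) \<longlonglongrightarrow> 0"
    by (rule filterlim_compose)
  moreover have "norm (f (x + h n) - f x - h n *\<^sub>R D) / norm (h n) = norm ((f (x + h n) - f x) /\<^sub>R h n - D)" for n
  proof -
    have "(f (x + h n) - f x) /\<^sub>R h n - D = (f (x + h n) - f x - h n *\<^sub>R D) /\<^sub>R h n"
      using h(2)[of n] by (simp add: scaleR_diff_right)
    then show ?thesis by (simp add: divide_inverse mult.commute)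
  qed
  ultimately show ?thesis
    by (simp add: tendsto_norm_zero_iff LIM_zero_iff)
qed

text \<open>The length of the chord is twice the modulus of \<open>sin (t / 2)\<close>.\<close>

lemma norm_cis_minus_1_le: "norm (cis t - 1) \<le> \<bar>t\<bar>"
proof -
  have "(norm (cis t - 1))\<^sup>2 = (2 * sin (t / 2))\<^sup>2"
    using cos_double_sin[of "t / 2"] sin_cos_squared_add[of t]
    unfolding cmod_power2 by (simp add: power2_eq_square algebra_simps)
  also have "\<dots> = \<bar>2 * sin (t / 2)\<bar>\<^sup>2" by (rule power2_abs[symmetric])
  also have "\<dots> \<le> \<bar>t\<bar>\<^sup>2"
    by (rule power_mono) (use abs_sin_x_le_abs_x[of "t / 2"] in \<open>simp_all add: abs_mult\<close>)
  finally show ?thesis by (rule power2_le_imp_le) simp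
qed

lemma cis_has_vector_derivative: "((\<lambda>h. cis (h * y)) has_vector_derivative (\<i> * of_real y * cis (x * y))) (at x)"
proof -
  have "((\<lambda>h. exp (of_real h * (\<i> * of_real y))) has_vector_derivative (\<i> * of_real y) * exp (of_real x * (\<i> * of_real y))) (at x)"
    using exp_scaleR_has_vector_derivative_left[of "\<i> * of_real y" x] by (simp only: scaleR_conv_of_real)
  then show ?thesis by (simp add: cis_conv_exp mult_ac)
qed

text \<open>A fixed sequence of steps is used so that the limit theorems for sequences of integrals
  apply directly.\<close>

definition diffquot :: "nat \<Rightarrow> (real \<Rightarrow> complex) \<Rightarrow> real \<Rightarrow> complex" where
  "diffquot n f k = of_nat (Suc n) * (f (k + 1 / real (Suc n)) - f k)"

text \<open>The Fourier multiplier of \<open>diffquot n\<close>: bounded by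
  \<open>\<bar>y\<bar>\<close> uniformly in \<open>n\<close>, with limit
  \<open>- \<i> * of_real y\<close>.\<close>

definition diffquot_symbol :: "nat \<Rightarrow> real \<Rightarrow> complex" where
  "diffquot_symbol n y = of_nat (Suc n) * (cis (- (1 / real (Suc n)) * y) - 1)"

lemma norm_diffquot_symbol_le: "norm (diffquot_symbol n y) \<le> \<bar>y\<bar>"
proof -
  have "norm (diffquot_symbol n y) \<le> real (Suc n) * \<bar>- (1 / real (Suc n)) * y\<bar>"
    unfolding diffquot_symbol_def norm_mult norm_of_nat
    by (intro mult_left_mono norm_cis_minus_1_le) simp
  also have "\<dots> = \<bar>y\<bar>" by (simp add: abs_mult)
  finally show ?thesis .
qed

lemma diffquot_tendsto:
  assumes "(f has_vector_derivative D) (at k)"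
  shows "(\<lambda>n. diffquot n f k) \<longlonglongrightarrow> D"
proof -
  have "(\<lambda>n. (f (k + 1 / real (Suc n)) - f k) /\<^sub>R (1 / real (Suc n))) \<longlonglongrightarrow> D"
    using assms LIMSEQ_inverse_real_of_nat
    by (intro has_vector_derivative_LIMSEQ) (auto simp: inverse_eq_divide)
  then show ?thesis by (simp add: diffquot_def scaleR_conv_of_real del: of_nat_Suc)
qed

lemma diffquot_symbol_tendsto: "(\<lambda>n. diffquot_symbol n y) \<longlonglongrightarrow> - \<i> * of_real y"
proof -
  have "(\<lambda>n. diffquot n (\<lambda>h. cis (h * - y)) 0) \<longlonglongrightarrow> \<i> * of_real (- y) * cis (0 * - y)"
    by (intro diffquot_tendsto cis_has_vector_derivative)
  then show ?thesis by (simp add: diffquot_def diffquot_symbol_def)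
qed

lemma diffquot_L2: "f \<in> L2 lborel \<Longrightarrow> diffquot n f \<in> L2 lborel"
  unfolding diffquot_def[abs_def] by (intro L2_cmult L2_diff L2_translate)

lemma diffquot_integrable: "integrable lborel f \<Longrightarrow> integrable lborel (diffquot n f)"
  unfolding diffquot_def[abs_def]
  by (intro integrable_mult_right Bochner_Integration.integrable_diff integrable_translate)

lemma fourier_diffquot:
  assumes f: "integrable lborel f"
  shows "fourier (diffquot n f) y = diffquot_symbol n y * fourier f y"
  unfolding diffquot_def[abs_def] fourier_cmult fourier_diff[OF integrable_translate[OF f] f]
    fourier_translate diffquot_symbol_def by (simp add: algebra_simps)

text \<open>Plancherel and the uniform bound on the symbol. The bound is independent of
  \<open>n\<close> and remains valid when the right side is infinite, so it can be used on every
  slice.\<close>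

lemma diffquot_nn_integral_le:
  assumes f: "integrable lborel f" "f \<in> L2 lborel"
  shows "2 * pi * (\<integral>\<^sup>+k. ennreal ((norm (diffquot n f k))\<^sup>2) \<partial>lborel)
     \<le> (\<integral>\<^sup>+y. ennreal ((norm (y *\<^sub>R fourier f y))\<^sup>2) \<partial>lborel)"
proof -
  have "2 * pi * (\<integral>\<^sup>+k. ennreal ((norm (diffquot n f k))\<^sup>2) \<partial>lborel)
     = (\<integral>\<^sup>+y. ennreal ((norm (fourier (diffquot n f) y))\<^sup>2) \<partial>lborel)"
    unfolding plancherel[OF diffquot_integrable[OF f(1)] diffquot_L2[OF f(2)]]
      L2_nn_integral[OF diffquot_L2[OF f(2)]] by (subst ennreal_mult) (auto intro!: integral_nonneg_AE)
  also have "\<dots> \<le> (\<integral>\<^sup>+y. ennreal ((norm (y *\<^sub>R fourier f y))\<^sup>2) \<partial>lborel)"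
    unfolding fourier_diffquot[OF f(1)] norm_mult norm_scaleR
    by (intro nn_integral_mono ennreal_leI power_mono mult_right_mono norm_diffquot_symbol_le) auto
  finally show ?thesis .
qed

text \<open>On the Fourier side the quotients are the symbols times the transform of
  \<open>f\<close>. They converge in the mean, dominated by \<open>y\<close> times that transform,
  and Plancherel carries the Cauchy property back to \<open>k\<close>.\<close>

lemma diffquot_L2_convergent:
  assumes f: "integrable lborel f" "f \<in> L2 lborel" and yF: "(\<lambda>y. y *\<^sub>R fourier f y) \<in> L2 lborel"
  obtains r g where "strict_mono r" "g \<in> L2 lborel" "AE k in lborel. (\<lambda>j. diffquot (r j) f k) \<longlonglongrightarrow> g k"
    "(\<lambda>n. \<integral>k. (norm (diffquot n f k - g k))\<^sup>2 \<partial>lborel) \<longlonglongrightarrow> 0"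
proof (rule L2_Cauchy_convergent[of "\<lambda>n. diffquot n f" lborel])
  have [measurable]: "f \<in> borel_measurable borel" using f by auto
  have [measurable]: "diffquot_symbol n \<in> borel_measurable borel" for n
    unfolding diffquot_symbol_def[abs_def] by measurable
  define E where "E n = (LBINT y. (norm (diffquot_symbol n y * fourier f y - (- \<i> * of_real y) * fourier f y))\<^sup>2)" for n
  have iy: "(\<lambda>y. (- \<i> * of_real y) * fourier f y) \<in> L2 lborel"
    by (rule L2_bound[OF yF, where C=1]) (auto simp: norm_mult)
  have sy: "(\<lambda>y. diffquot_symbol n y * fourier f y) \<in> L2 lborel" for n
    by (rule L2_bound[OF yF, where C=1]) (auto simp: norm_mult intro!: mult_right_mono norm_diffquot_symbol_le)
  have "E \<longlonglongrightarrow> (\<integral>y. 0 \<partial>(lborel::real measure))"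
    unfolding E_def[abs_def]
  proof (rule integral_dominated_convergence[where w="\<lambda>y. 4 * (norm (y *\<^sub>R fourier f y))\<^sup>2"])
    show "integrable lborel (\<lambda>y. 4 * (norm (y *\<^sub>R fourier f y))\<^sup>2)"
      using yF by (intro integrable_mult_right L2_integrable)
    show "AE y in lborel. (\<lambda>n. (norm (diffquot_symbol n y * fourier f y - (- \<i> * of_real y) * fourier f y))\<^sup>2) \<longlonglongrightarrow> 0"
    proof (rule AE_I2)
      fix y
      have "(\<lambda>n. (norm (diffquot_symbol n y * fourier f y - (- \<i> * of_real y) * fourier f y))\<^sup>2)
        \<longlonglongrightarrow> (norm ((- \<i> * of_real y) * fourier f y - (- \<i> * of_real y) * fourier f y))\<^sup>2"
        by (intro tendsto_intros diffquot_symbol_tendsto)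
      then show "(\<lambda>n. (norm (diffquot_symbol n y * fourier f y - (- \<i> * of_real y) * fourier f y))\<^sup>2) \<longlonglongrightarrow> 0"
        by simp
    qed
    show "AE y in lborel. norm ((norm (diffquot_symbol n y * fourier f y - (- \<i> * of_real y) * fourier f y))\<^sup>2)
        \<le> 4 * (norm (y *\<^sub>R fourier f y))\<^sup>2" for n
    proof (rule AE_I2)
      fix y
      have "(norm (diffquot_symbol n y * fourier f y))\<^sup>2 \<le> (norm (y *\<^sub>R fourier f y))\<^sup>2"
        unfolding norm_mult norm_scaleR by (intro power_mono mult_right_mono norm_diffquot_symbol_le) auto
      moreover have "(norm ((- \<i> * of_real y) * fourier f y))\<^sup>2 = (norm (y *\<^sub>R fourier f y))\<^sup>2"
        by (simp add: norm_mult)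
      ultimately show "norm ((norm (diffquot_symbol n y * fourier f y - (- \<i> * of_real y) * fourier f y))\<^sup>2)
        \<le> 4 * (norm (y *\<^sub>R fourier f y))\<^sup>2"
        using norm_diff_sq_le[of "diffquot_symbol n y * fourier f y" "(- \<i> * of_real y) * fourier f y"]
        unfolding real_norm_def abs_power2 by linarith
    qed
  qed simp_all
  then have E: "E \<longlonglongrightarrow> 0" by simp
  show "diffquot n f \<in> L2 lborel" for n by (rule diffquot_L2[OF f(2)])
  fix e :: real assume e: "e > 0"
  then obtain N where N: "\<And>n. n \<ge> N \<Longrightarrow> E n < e"
    using order_tendstoD(2)[OF E e] by (auto simp: eventually_sequentially)
  show "\<exists>N. \<forall>m\<ge>N. \<forall>n\<ge>N. (LBINT k. (norm (diffquot m f k - diffquot n f k))\<^sup>2) < e"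
  proof (intro exI allI impI)
    fix m n assume mn: "m \<ge> N" "n \<ge> N"
    have int: "integrable lborel (\<lambda>k. diffquot m f k - diffquot n f k)"
      and L2: "(\<lambda>k. diffquot m f k - diffquot n f k) \<in> L2 lborel"
      using diffquot_integrable[OF f(1)] diffquot_L2[OF f(2)] by (auto intro: L2_diff)
    have "2 * pi * (LBINT k. (norm (diffquot m f k - diffquot n f k))\<^sup>2)
      = (LBINT y. (norm (diffquot_symbol m y * fourier f y - diffquot_symbol n y * fourier f y))\<^sup>2)"
      unfolding fourier_L2(2)[OF int L2, symmetric]
        fourier_diff[OF diffquot_integrable[OF f(1)] diffquot_integrable[OF f(1)]] fourier_diffquot[OF f(1)] ..
    also have "\<dots> \<le> (LBINT y. 2 * (norm (diffquot_symbol m y * fourier f y - (- \<i> * of_real y) * fourier f y))\<^sup>2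
        + 2 * (norm (diffquot_symbol n y * fourier f y - (- \<i> * of_real y) * fourier f y))\<^sup>2)"
    proof (rule integral_mono)
      show "integrable lborel (\<lambda>y. 2 * (norm (diffquot_symbol m y * fourier f y - (- \<i> * of_real y) * fourier f y))\<^sup>2
        + 2 * (norm (diffquot_symbol n y * fourier f y - (- \<i> * of_real y) * fourier f y))\<^sup>2)"
        by (intro Bochner_Integration.integrable_add integrable_mult_right L2_integrable L2_diff sy iy)
      show "integrable lborel (\<lambda>y. (norm (diffquot_symbol m y * fourier f y - diffquot_symbol n y * fourier f y))\<^sup>2)"
        by (intro L2_integrable L2_diff sy)
      show "(norm (diffquot_symbol m y * fourier f y - diffquot_symbol n y * fourier f y))\<^sup>2
        \<le> 2 * (norm (diffquot_symbol m y * fourier f y - (- \<i> * of_real y) * fourier f y))\<^sup>2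
        + 2 * (norm (diffquot_symbol n y * fourier f y - (- \<i> * of_real y) * fourier f y))\<^sup>2" for y
        using norm_diff_sq_le[of "diffquot_symbol m y * fourier f y - (- \<i> * of_real y) * fourier f y"
            "diffquot_symbol n y * fourier f y - (- \<i> * of_real y) * fourier f y"] by simp
    qed
    also have "\<dots> = 2 * E m + 2 * E n"
      unfolding E_def by (subst Bochner_Integration.integral_add)
        (intro integrable_mult_right L2_integrable L2_diff sy iy | simp only: integral_mult_right_zero)+
    also have "\<dots> < 4 * e" using N mn by (smt (verit))
    finally have "2 * pi * (LBINT k. (norm (diffquot m f k - diffquot n f k))\<^sup>2) < 4 * e" .
    moreover have "0 \<le> (LBINT k. (norm (diffquot m f k - diffquot n f k))\<^sup>2)" (is "0 \<le> ?I")
      by (rule integral_nonneg_AE) simp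
    \<comment> \<open>The factor \<open>2 * pi\<close> from Plancherel exceeds the 4 produced by the
      squared triangle inequality, so the same threshold \<open>N\<close> works for
      \<open>e\<close>.\<close>
    then have "4 * ?I \<le> 2 * pi * ?I" using pi_ge_two by (intro mult_right_mono) auto
    ultimately show "?I < e" by simp
  qed
qed

text \<open>A discrete integration by parts. Here \<open>\<phi>\<close> is asked for only one
  bounded derivative, because it will be a test function divided by a mode.\<close>

lemma diffquot_weak_limit:
  assumes f: "integrable lborel f" "f \<in> L2 lborel" and g: "g \<in> L2 lborel"
    and lim: "(\<lambda>n. \<integral>k. (norm (diffquot n f k - g k))\<^sup>2 \<partial>lborel) \<longlonglongrightarrow> 0"
    and \<phi>: "\<phi> \<in> L2 lborel" "\<And>k. (\<phi> has_vector_derivative \<phi>' k) (at k)" "\<And>k. norm (\<phi>' k) \<le> B"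
  shows "(LBINT k. g k * \<phi> k) = - (LBINT k. f k * \<phi>' k)"
proof (rule LIMSEQ_unique)
  have [measurable]: "f \<in> borel_measurable borel" "\<phi> \<in> borel_measurable borel" using f \<phi>(1) by (auto simp: L2_def)
  show "(\<lambda>n. \<integral>k. diffquot n f k * \<phi> k \<partial>lborel) \<longlonglongrightarrow> (LBINT k. g k * \<phi> k)"
    by (rule L2_tendsto_pairing[OF diffquot_L2[OF f(2)] g \<phi>(1) lim])
  \<comment> \<open>Translation invariance moves the forward quotient of \<open>f\<close> onto
    \<open>\<phi>\<close> with step of the opposite sign, hence the limit
    \<open>- \<phi>' k\<close>.\<close>
  define b where "b n k = of_nat (Suc n) * (\<phi> (k + - (1 / real (Suc n))) - \<phi> k)" for n k
  have b_lim: "(\<lambda>n. b n k) \<longlonglongrightarrow> - \<phi>' k" for k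
  proof -
    have "(\<lambda>n. - (1 / real (Suc n))) \<longlonglongrightarrow> - 0"
      using LIMSEQ_inverse_real_of_nat by (intro tendsto_minus) (simp add: inverse_eq_divide)
    then have "(\<lambda>n. (\<phi> (k + - (1 / real (Suc n))) - \<phi> k) /\<^sub>R (- (1 / real (Suc n)))) \<longlonglongrightarrow> \<phi>' k"
      by (intro has_vector_derivative_LIMSEQ \<phi>(2)) auto
    then have "(\<lambda>n. - ((\<phi> (k + - (1 / real (Suc n))) - \<phi> k) /\<^sub>R (- (1 / real (Suc n))))) \<longlonglongrightarrow> - \<phi>' k"
      by (rule tendsto_minus)
    then show ?thesis by (simp add: b_def scaleR_conv_of_real del: of_nat_Suc)
  qed
  have [measurable]: "b n \<in> borel_measurable borel" for n unfolding b_def[abs_def] by measurable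
  have \<phi>'m: "\<phi>' \<in> borel_measurable borel"
  proof (rule borel_measurable_LIMSEQ_metric)
    show "(\<lambda>n. - b n k) \<longlonglongrightarrow> \<phi>' k" for k using tendsto_minus[OF b_lim[of k]] by simp
  qed simp
  have b_le: "norm (b n k) \<le> B" for n k
  proof -
    have "norm (\<phi> (k + - (1 / real (Suc n))) - \<phi> k) \<le> B * norm ((k + - (1 / real (Suc n))) - k)"
    proof (rule differentiable_bound[of UNIV \<phi> "\<lambda>x h. h *\<^sub>R \<phi>' x"])
      show "(\<phi> has_derivative (\<lambda>h. h *\<^sub>R \<phi>' x)) (at x within UNIV)" for x
        using \<phi>(2)[of x] by (simp add: has_vector_derivative_def)
      show "onorm (\<lambda>h. h *\<^sub>R \<phi>' x) \<le> B" for x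
        using \<phi>(3)[of x] by (simp add: onorm_scaleR_left onorm_id)
    qed auto
    also have "\<dots> = B / real (Suc n)" by simp
    finally have "real (Suc n) * norm (\<phi> (k + - (1 / real (Suc n))) - \<phi> k) \<le> real (Suc n) * (B / real (Suc n))"
      by (intro mult_left_mono) auto
    then show ?thesis unfolding b_def norm_mult norm_of_nat by simp
  qed
  have "(\<lambda>n. \<integral>k. f k * b n k \<partial>lborel) \<longlonglongrightarrow> (LBINT k. f k * (- \<phi>' k))"
  proof (rule integral_dominated_convergence[where w="\<lambda>k. B * norm (f k)"])
    show "AE k in lborel. norm (f k * b n k) \<le> B * norm (f k)" for n
      using mult_left_mono[OF b_le, of "norm (f _)"] by (intro AE_I2) (simp add: norm_mult mult.commute)
    show "AE k in lborel. (\<lambda>n. f k * b n k) \<longlonglongrightarrow> f k * (- \<phi>' k)"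
      by (intro AE_I2 tendsto_intros b_lim)
  qed (use f \<phi>'m in auto)
  moreover have "(LBINT k. f k * b n k) = (LBINT k. diffquot n f k * \<phi> k)" for n
  proof -
    let ?h = "1 / real (Suc n)"
    have int: "integrable lborel (\<lambda>k. f (k + ?h) * \<phi> k)" "integrable lborel (\<lambda>k. f k * \<phi> k)"
      "integrable lborel (\<lambda>k. f k * \<phi> (k + - ?h))"
      by (intro L2_integrable_mult L2_translate f \<phi>)+
    have "(LBINT k. f (k + ?h) * \<phi> k) = (LBINT k. f k * \<phi> (k + - ?h))"
      using integral_translate[of "\<lambda>k. f k * \<phi> (k + - ?h)" ?h] by simp
    then have "of_nat (Suc n) * ((LBINT k. f (k + ?h) * \<phi> k) - (LBINT k. f k * \<phi> k))
      = of_nat (Suc n) * ((LBINT k. f k * \<phi> (k + - ?h)) - (LBINT k. f k * \<phi> k))" by simp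
    also have "of_nat (Suc n) * ((LBINT k. f (k + ?h) * \<phi> k) - (LBINT k. f k * \<phi> k)) = (LBINT k. diffquot n f k * \<phi> k)"
      unfolding Bochner_Integration.integral_diff[OF int(1,2), symmetric] integral_mult_right_zero[symmetric] diffquot_def
      by (simp add: left_diff_distrib right_diff_distrib mult.assoc del: of_nat_Suc)
    also have "of_nat (Suc n) * ((LBINT k. f k * \<phi> (k + - ?h)) - (LBINT k. f k * \<phi> k)) = (LBINT k. f k * b n k)"
      unfolding Bochner_Integration.integral_diff[OF int(3,2), symmetric] integral_mult_right_zero[symmetric] b_def
      by (simp add: right_diff_distrib mult.left_commute del: of_nat_Suc)
    finally show ?thesis ..
  qed
  ultimately show "(\<lambda>n. \<integral>k. diffquot n f k * \<phi> k \<partial>lborel) \<longlonglongrightarrow> - (LBINT k. f k * \<phi>' k)"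
    by simp
qed

section \<open>Exponential moments on the line\<close>

lemma halfline_moment:
  assumes "a > 0"
  shows "has_bochner_integral lborel (\<lambda>x::real. x ^ n * exp (- (a * x)) * indicator {0<..} x) (fact n / a ^ Suc n)"
proof -
  have "has_bochner_integral lborel (\<lambda>x. (0 + a * x) ^ n * exp (- (0 + a * x)) * indicator {0<..} (0 + a * x)) (fact n /\<^sub>R \<bar>a\<bar>)"
    using has_bochner_integral_I0i_power_exp_m[of n] assms
      lborel_has_bochner_integral_real_affine_iff[of a "\<lambda>x. x ^ n * exp (- x) * indicator {0 <..} x" "fact n" 0] by simp
  then have "has_bochner_integral lborel (\<lambda>x. (1 / a ^ n) * ((0 + a * x) ^ n * exp (- (0 + a * x)) * indicator {0<..} (0 + a * x))) ((1 / a ^ n) * (fact n /\<^sub>R \<bar>a\<bar>))"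
    by (intro has_bochner_integral_mult_right)
  moreover have "(1 / a ^ n) * ((0 + a * x) ^ n * exp (- (0 + a * x)) * indicator {0<..} (0 + a * x))
      = x ^ n * exp (- (a * x)) * indicator {0<..} x" for x
    using assms by (auto simp: power_mult_distrib indicator_def zero_less_mult_iff)
  moreover have "(1 / a ^ n) * (fact n /\<^sub>R \<bar>a\<bar>) = fact n / a ^ Suc n"
    using assms by (simp add: field_simps)
  ultimately show ?thesis by simp
qed

lemma halfline_moment_neg:
  assumes "a > 0"
  shows "has_bochner_integral lborel (\<lambda>x::real. (- x) ^ n * exp (- (a * (- x))) * indicator {0<..} (- x)) (fact n / a ^ Suc n)"
  using lborel_has_bochner_integral_real_affine_iff[of "-1" "\<lambda>x. x ^ n * exp (- (a * x)) * indicator {0<..} x" "fact n / a ^ Suc n" 0]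
    halfline_moment[OF assms, of n] by simp

text \<open>A product of two modes, of their \<open>k\<close>-derivatives or of their multiples by
  \<open>x\<close> is an exponential times one quadratic polynomial on each half-line. The
  denominators come from \<open>n! / (2 * w) ^ (n + 1)\<close> for \<open>n = 0, 1, 2\<close>; for
  \<open>n = 2\<close> the factorial turns 8 into 4.\<close>

lemma quadratic_exp_integral:
  fixes w :: real
  assumes "w > 0"
  shows "has_bochner_integral lborel
    (\<lambda>x. (if 0 < x then p0 + p1 * \<bar>x\<bar> + p2 * x\<^sup>2 else if x < 0 then q0 + q1 * \<bar>x\<bar> + q2 * x\<^sup>2 else 0) * exp (- (2 * w * \<bar>x\<bar>)))
    ((p0 + q0) / (2 * w) + (p1 + q1) / (4 * w\<^sup>2) + (p2 + q2) / (4 * w ^ 3))"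
proof -
  define h where "h n x = x ^ n * exp (- (2 * w * x)) * indicator {0<..} x" for n and x :: real
  have h: "has_bochner_integral lborel (h n) (fact n / (2 * w) ^ Suc n)" for n
    unfolding h_def[abs_def] using assms by (intro halfline_moment) simp
  have h': "has_bochner_integral lborel (\<lambda>x. h n (- x)) (fact n / (2 * w) ^ Suc n)" for n
    unfolding h_def[abs_def] using assms by (intro halfline_moment_neg) simp
  have "has_bochner_integral lborel (\<lambda>x. (p0 * h 0 x + p1 * h 1 x + p2 * h 2 x) + (q0 * h 0 (- x) + q1 * h 1 (- x) + q2 * h 2 (- x)))
    ((p0 * (fact 0 / (2 * w) ^ Suc 0) + p1 * (fact 1 / (2 * w) ^ Suc 1) + p2 * (fact 2 / (2 * w) ^ Suc 2))
     + (q0 * (fact 0 / (2 * w) ^ Suc 0) + q1 * (fact 1 / (2 * w) ^ Suc 1) + q2 * (fact 2 / (2 * w) ^ Suc 2)))"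
    by (intro has_bochner_integral_add has_bochner_integral_mult_right h h')
  moreover have "(p0 * h 0 x + p1 * h 1 x + p2 * h 2 x) + (q0 * h 0 (- x) + q1 * h 1 (- x) + q2 * h 2 (- x))
    = (if 0 < x then p0 + p1 * \<bar>x\<bar> + p2 * x\<^sup>2 else if x < 0 then q0 + q1 * \<bar>x\<bar> + q2 * x\<^sup>2 else 0) * exp (- (2 * w * \<bar>x\<bar>))" for x
    by (auto simp: h_def indicator_def algebra_simps)
  moreover have "(p0 * (fact 0 / (2 * w) ^ Suc 0) + p1 * (fact 1 / (2 * w) ^ Suc 1) + p2 * (fact 2 / (2 * w) ^ Suc 2))
     + (q0 * (fact 0 / (2 * w) ^ Suc 0) + q1 * (fact 1 / (2 * w) ^ Suc 1) + q2 * (fact 2 / (2 * w) ^ Suc 2))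
     = (p0 + q0) / (2 * w) + (p1 + q1) / (4 * w\<^sup>2) + (p2 + q2) / (4 * w ^ 3)"
    by (simp add: power2_eq_square power3_eq_cube add_divide_distrib eval_nat_numeral)
  ultimately show ?thesis by simp
qed

lemma integrable_exp_abs: "a > 0 \<Longrightarrow> integrable lborel (\<lambda>x::real. exp (- (a * \<bar>x\<bar>)))"
proof -
  assume a: "a > 0"
  have "has_bochner_integral lborel
    (\<lambda>x. (if 0 < x then 1 + 0 * \<bar>x\<bar> + 0 * x\<^sup>2 else if x < 0 then 1 + 0 * \<bar>x\<bar> + 0 * x\<^sup>2 else 0) * exp (- (2 * (a / 2) * \<bar>x\<bar>)))
    ((1 + 1) / (2 * (a / 2)) + (0 + 0) / (4 * (a / 2)\<^sup>2) + (0 + 0) / (4 * (a / 2) ^ 3))"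
    using a by (intro quadratic_exp_integral) simp
  then have "integrable lborel (\<lambda>x. (if 0 < x then 1 + 0 * \<bar>x\<bar> + 0 * x\<^sup>2 else if x < 0 then 1 + 0 * \<bar>x\<bar> + 0 * x\<^sup>2 else 0) * exp (- (2 * (a / 2) * \<bar>x\<bar>)))"
    by (rule integrable.intros)
  then show ?thesis
    by (rule integrable_cong_AE_imp) (use AE_lborel_singleton[of 0] in \<open>auto elim!: eventually_mono\<close>)
qed

section \<open>Smooth cutoff functions\<close>

text \<open>Iterating a choice of derivatives inside a class closed under differentiation produces
  the whole sequence demanded by \<open>test_function\<close>.\<close>

lemma smooth_sequence:
  fixes S :: "(real \<Rightarrow> 'a::real_normed_vector) set"
  assumes S: "\<And>f. f \<in> S \<Longrightarrow> \<exists>f'\<in>S. \<forall>t. (f has_vector_derivative f' t) (at t)" and f: "f \<in> S"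
  shows "\<exists>D. D (0::nat) = f \<and> (\<forall>n t. (D n has_vector_derivative D (Suc n) t) (at t))"
proof -
  obtain d where d: "\<And>f. f \<in> S \<Longrightarrow> d f \<in> S" "\<And>f t. f \<in> S \<Longrightarrow> (f has_vector_derivative d f t) (at t)"
    using S by metis
  have "(d ^^ n) f \<in> S" for n by (induction n) (auto intro: d f)
  then show ?thesis by (intro exI[of _ "\<lambda>n. (d ^^ n) f"]) (auto intro: d)
qed

text \<open>The classical smooth function \<open>exp (- 1 / u)\<close>, extended by 0, divided by a
  power of \<open>u\<close>. With these powers included, linear combinations of the family are
  closed under differentiation.\<close>

definition flat :: "nat \<Rightarrow> real \<Rightarrow> real" where
  "flat n u = (if u > 0 then exp (- (1 / u)) / u ^ n else 0)"

lemma flat_nonneg: "0 \<le> flat n u"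
  by (simp add: flat_def)

lemma power_le_fact_exp: "v \<ge> 0 \<Longrightarrow> v ^ n \<le> fact n * exp (v::real)"
proof -
  assume "v \<ge> 0"
  have "(\<Sum>i\<in>{n}. v ^ i /\<^sub>R fact i) \<le> (\<Sum>i. v ^ i /\<^sub>R fact i)"
    using exp_converges[of v] \<open>v \<ge> 0\<close> by (intro sum_le_suminf) (auto simp: sums_summable)
  also have "\<dots> = exp v" by (rule sums_unique[OF exp_converges, symmetric])
  finally show ?thesis by (simp add: field_simps)
qed

text \<open>With \<open>v = 1 / u\<close> this is \<open>v ^ n * exp (- v) \<le> fact n\<close>, a
  single term of the exponential series.\<close>

lemma flat_le_fact: "flat n u \<le> fact n"
proof (cases "u > 0")
  case True
  have "(1 / u) ^ n \<le> fact n * exp (1 / u)" using True by (intro power_le_fact_exp) simp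
  then have "(1 / u) ^ n * exp (- (1 / u)) \<le> fact n * exp (1 / u) * exp (- (1 / u))"
    by (intro mult_right_mono) auto
  also have "\<dots> = fact n" by (simp flip: exp_add)
  finally show ?thesis using True by (simp add: flat_def power_one_over field_simps)
qed (simp add: flat_def)

lemma flat_Suc: "flat n u = u * flat (Suc n) u"
  by (simp add: flat_def)

lemma flat_le: "flat n u \<le> fact (Suc n) * \<bar>u\<bar>"
proof (cases "u > 0")
  case True
  then show ?thesis
    using mult_left_mono[OF flat_le_fact[of "Suc n" u], of u] unfolding flat_Suc[of n] by (simp add: mult.commute)
qed (simp add: flat_def mult_nonneg_nonpos del: fact_Suc)

text \<open>Only \<open>u = 0\<close> is delicate: there the difference quotient of
  \<open>flat n\<close> is \<open>flat (n + 1)\<close>, which is at most a constant times the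
  modulus of the increment.\<close>

lemma flat_has_derivative: "(flat n has_real_derivative (flat (n + 2) u - n * flat (n + 1) u)) (at u)"
proof -
  consider "u > 0" | "u < 0" | "u = 0" by linarith
  then show ?thesis
  proof cases
    case 1
    have "((\<lambda>u. exp (- (1 / u)) / u ^ n) has_real_derivative (flat (n + 2) u - n * flat (n + 1) u)) (at u)"
      using 1 by (auto intro!: derivative_eq_intros simp: flat_def field_simps power2_eq_square)
        (cases n; simp add: field_simps)
    then show ?thesis
      by (rule has_field_derivative_transform_within_open[of _ _ _ "{0<..}"]) (use 1 in \<open>auto simp: flat_def\<close>)
  next
    case 2
    have "((\<lambda>u. 0) has_real_derivative 0) (at u)" by simp
    then have "(flat n has_real_derivative 0) (at u)"
      by (rule has_field_derivative_transform_within_open[of _ _ _ "{..<0}"]) (use 2 in \<open>auto simp: flat_def\<close>)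
    then show ?thesis using 2 by (simp add: flat_def)
  next
    case 3
    have "((\<lambda>h. flat (Suc n) h) \<longlongrightarrow> 0) (at 0)"
    proof (rule tendsto_sandwich)
      show "\<forall>\<^sub>F h in at 0. 0 \<le> flat (Suc n) h" by (simp add: flat_nonneg)
      show "\<forall>\<^sub>F h in at 0. flat (Suc n) h \<le> fact (Suc (Suc n)) * \<bar>h\<bar>"
        using flat_le by (intro always_eventually) blast
      show "((\<lambda>h::real. fact (Suc (Suc n)) * \<bar>h\<bar>) \<longlongrightarrow> 0) (at 0)"
        by (auto intro!: tendsto_eq_intros simp del: fact_Suc)
    qed simp
    then have "((\<lambda>h. (flat n (0 + h) - flat n 0) / h) \<longlongrightarrow> 0) (at 0)"
      by (rule Lim_transform_eventually) (auto simp: eventually_at_filter flat_Suc[of n])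
    then show ?thesis using 3 by (simp add: DERIV_def flat_def)
  qed
qed

text \<open>A smooth bump on the interval of half-length \<open>n + 1\<close>. It is not normalised:
  its pointwise limit is \<open>exp (- 2)\<close>, a common factor that cancels where the cutoff is
  removed.\<close>

definition cutoff :: "nat \<Rightarrow> real \<Rightarrow> real" where
  "cutoff n k = flat 0 (1 + k / Suc n) * flat 0 (1 - k / Suc n)"

definition cutoff' :: "nat \<Rightarrow> real \<Rightarrow> real" where
  "cutoff' n k = (flat 2 (1 + k / Suc n) * flat 0 (1 - k / Suc n) - flat 0 (1 + k / Suc n) * flat 2 (1 - k / Suc n)) / Suc n"

lemma cutoff_bounds: "0 \<le> cutoff n k" "cutoff n k \<le> 1"
proof -
  show "0 \<le> cutoff n k" by (simp add: cutoff_def flat_nonneg)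
  show "cutoff n k \<le> 1"
    using mult_mono[OF flat_le_fact[of 0] flat_le_fact[of 0]] unfolding cutoff_def by (simp add: flat_nonneg)
qed

lemma cutoff_eq_0: "real (Suc n) \<le> \<bar>k\<bar> \<Longrightarrow> cutoff n k = 0"
  unfolding cutoff_def flat_def by (auto simp: field_simps abs_if split: if_splits)

lemma cutoff'_bound: "\<bar>cutoff' n k\<bar> \<le> 2 / Suc n"
proof -
  \<comment> \<open>Both products lie between 0 and 2, so their difference has modulus at most
    2.\<close>
  have b: "0 \<le> flat 2 a * flat 0 b \<and> flat 2 a * flat 0 b \<le> 2" for a b
    using mult_mono[OF flat_le_fact[of 2 a] flat_le_fact[of 0 b]] by (simp add: flat_nonneg fact_2)
  have "\<bar>flat 2 (1 + k / Suc n) * flat 0 (1 - k / Suc n) - flat 0 (1 + k / Suc n) * flat 2 (1 - k / Suc n)\<bar> \<le> 2"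
    using b[of "1 + k / Suc n" "1 - k / Suc n"] b[of "1 - k / Suc n" "1 + k / Suc n"] by (simp add: mult.commute abs_le_iff)
  then show ?thesis unfolding cutoff'_def by (simp add: divide_right_mono)
qed

lemma cutoff_has_derivative: "(cutoff n has_real_derivative cutoff' n k) (at k)"
proof -
  have *: "((\<lambda>k. flat 0 (a + b * k)) has_real_derivative flat 2 (a + b * k) * b) (at k)" for a b k
  proof -
    have "((\<lambda>k. a + b * k) has_real_derivative b) (at k)" by (auto intro!: derivative_eq_intros)
    from DERIV_chain2[OF flat_has_derivative[of 0] this] show ?thesis by (simp add: numeral_2_eq_2)
  qed
  have "((\<lambda>k. flat 0 (1 + (1 / Suc n) * k) * flat 0 (1 + (- 1 / Suc n) * k)) has_real_derivative
     flat 2 (1 + (1 / Suc n) * k) * (1 / Suc n) * flat 0 (1 + (- 1 / Suc n) * k)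
     + flat 2 (1 + (- 1 / Suc n) * k) * (- 1 / Suc n) * flat 0 (1 + (1 / Suc n) * k)) (at k)"
    by (rule DERIV_mult[OF * *])
  then show ?thesis
    unfolding cutoff_def[abs_def] cutoff'_def by (simp add: diff_divide_distrib mult.commute del: of_nat_Suc)
qed

lemma cutoff_tendsto: "(\<lambda>n. cutoff n k) \<longlonglongrightarrow> exp (- 2)"
proof -
  have lim: "(\<lambda>n. k / real (Suc n)) \<longlonglongrightarrow> 0"
    using tendsto_mult[OF tendsto_const[of k] LIMSEQ_inverse_real_of_nat] by (simp add: divide_inverse)
  have cont: "isCont (flat 0) 1" using flat_has_derivative[of 0 1] by (rule DERIV_isCont)
  have "(\<lambda>n. flat 0 (1 + k / real (Suc n)) * flat 0 (1 - k / real (Suc n))) \<longlonglongrightarrow> flat 0 1 * flat 0 1"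
    using tendsto_add[OF tendsto_const[of 1] lim] tendsto_diff[OF tendsto_const[of 1] lim]
    by (intro tendsto_mult isCont_tendsto_compose[OF cont]) auto
  then show ?thesis by (simp add: cutoff_def flat_def flip: exp_add)
qed

lemma cutoff'_tendsto: "(\<lambda>n. cutoff' n k) \<longlonglongrightarrow> 0"
proof (rule Lim_null_comparison)
  show "\<forall>\<^sub>F n in sequentially. norm (cutoff' n k) \<le> 2 / Suc n" using cutoff'_bound by simp
  show "(\<lambda>n. 2 / real (Suc n)) \<longlonglongrightarrow> 0"
    using tendsto_mult[OF tendsto_const[of 2] LIMSEQ_inverse_real_of_nat] by (simp add: divide_inverse)
qed

section \<open>The modes of the interface\<close>

locale dirac_line =
  fixes m \<eta> \<tau> :: real
  assumes m_pos: "m > 0" and critical: "\<eta>\<^sup>2 - \<tau>\<^sup>2 = 4"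
begin

section \<open>The dispersion relation\<close>

abbreviation w :: "real \<Rightarrow> real" where "w \<equiv> \<omega> m \<eta>"

lemma \<eta>_nz: "\<eta> \<noteq> 0"
proof
  assume "\<eta> = 0" then show False using critical zero_le_power2[of \<tau>] by simp
qed

lemma mass_pos: "0 < 4 * m\<^sup>2 / \<eta>\<^sup>2"
  using m_pos \<eta>_nz by simp

lemma w_sq: "(w k)\<^sup>2 = k\<^sup>2 + 4 * m\<^sup>2 / \<eta>\<^sup>2"
  unfolding \<omega>_def using mass_pos by (intro real_sqrt_pow2) (simp add: add_nonneg_nonneg)

lemma w_gt: "\<bar>k\<bar> < w k"
proof -
  have "sqrt (k\<^sup>2) < w k" unfolding \<omega>_def using mass_pos by (intro real_sqrt_less_mono) simp
  then show ?thesis by simp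
qed

lemma w_pos: "0 < w k"
  using w_gt[of k] by linarith

lemma w_neq_0 [simp]: "w k \<noteq> 0"
  using w_pos[of k] by simp

definition w0 :: real where "w0 = sqrt (4 * m\<^sup>2 / \<eta>\<^sup>2)"

lemma w0_pos: "0 < w0"
  unfolding w0_def using mass_pos by simp

lemma w0_le: "w0 \<le> w k"
  unfolding w0_def \<omega>_def by (rule real_sqrt_le_mono) simp

lemma w_has_derivative [derivative_intros]:
  assumes "(f has_real_derivative f') (at k within S)"
  shows "((\<lambda>k. w (f k)) has_real_derivative (f k / w (f k) * f')) (at k within S)"
proof -
  have sqrt_deriv: "((\<lambda>k. sqrt (k\<^sup>2 + q)) has_real_derivative k / sqrt (k\<^sup>2 + q)) (at k)" if "q > 0" for k q :: real
  proof -
    have pos: "0 < k\<^sup>2 + q" using that by (simp add: add_nonneg_pos)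
    have "((\<lambda>k. k\<^sup>2 + q) has_real_derivative 2 * k) (at k)" by (auto intro!: derivative_eq_intros)
    from DERIV_chain2[where f=sqrt and s=UNIV, OF DERIV_real_sqrt[OF pos] this]
    show ?thesis by (simp add: field_simps)
  qed
  have "(w has_real_derivative k / w k) (at k)" for k
    unfolding \<omega>_def[abs_def] by (rule sqrt_deriv[OF mass_pos])
  from DERIV_chain2[OF this assms] show ?thesis .
qed

lemma w_measurable [measurable]: "w \<in> borel_measurable borel"
  unfolding \<omega>_def[abs_def] by measurable

text \<open>The value 0 at \<open>x = 0\<close> agrees with \<open>heaviside 0 = 0\<close>, by which
  \<open>\<psi>\<close> vanishes on the line; it also makes the slice \<open>x = 0\<close>
  integrable.\<close>

definition side :: "real \<Rightarrow> real \<Rightarrow> real" where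
  "side \<epsilon> x = (if x < 0 then 1 else if x > 0 then \<epsilon> else 0)"

text \<open>The common profile of both spinor components: \<open>c\<close> is their coefficient
  \<open>1 - t\<close> or \<open>1 + t\<close>, \<open>s\<close> is 1 for the first and -1 for the
  second, and \<open>\<epsilon>\<close> is the sign acquired in crossing the line from negative to
  positive \<open>x\<close>. The prefactor of \<open>\<psi>\<close> is included.\<close>

definition mode :: "real \<Rightarrow> real \<Rightarrow> real \<Rightarrow> real \<Rightarrow> real \<Rightarrow> real" where
  "mode c s \<epsilon> x k = side \<epsilon> x / (2 * sqrt pi) * sqrt (c * (w k - s * sgn x * k)) * exp (- (w k * \<bar>x\<bar>))"

text \<open>The \<open>k\<close>-derivative of the logarithm of a mode. The root contributes the
  first term, since \<open>w k - \<sigma> * k\<close> has derivative \<open>- \<sigma> / w k\<close>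
  times itself when \<sigma> = 1 or -1; the exponential contributes the second. Keeping the mode as
  a factor of \<open>dmode\<close> reduces all integrals of \<open>dmode\<close> to moments of
  squared modes.\<close>

definition log_deriv :: "real \<Rightarrow> real \<Rightarrow> real \<Rightarrow> real" where
  "log_deriv s x k = - (s * sgn x) / (2 * w k) - k * \<bar>x\<bar> / w k"

definition dmode :: "real \<Rightarrow> real \<Rightarrow> real \<Rightarrow> real \<Rightarrow> real \<Rightarrow> real" where
  "dmode c s \<epsilon> x k = mode c s \<epsilon> x k * log_deriv s x k"

lemma abs_s_sgn_le: fixes s x k :: real shows "\<bar>s\<bar> = 1 \<Longrightarrow> \<bar>s * sgn x * k\<bar> \<le> \<bar>k\<bar>"
  by (cases "x = 0") (simp_all add: abs_mult abs_sgn_eq)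

lemma mode_arg_pos: "\<bar>s\<bar> = 1 \<Longrightarrow> 0 < w k - s * sgn x * k"
  using abs_s_sgn_le[of s x k] w_gt[of k] by linarith

lemma mode_arg_le: "\<bar>s\<bar> = 1 \<Longrightarrow> w k - s * sgn x * k \<le> 2 * w k"
  using abs_s_sgn_le[of s x k] w_gt[of k] by linarith

lemma mode_has_derivative:
  assumes c: "c > 0" and s: "\<bar>s\<bar> = 1"
  shows "(mode c s \<epsilon> x has_real_derivative dmode c s \<epsilon> x k) (at k)"
proof (cases "x = 0")
  case True
  then show ?thesis by (simp add: mode_def[abs_def] dmode_def side_def)
next
  case False
  define \<sigma> where "\<sigma> = s * sgn x"
  have \<sigma>: "\<sigma> * \<sigma> = 1" using s False by (auto simp: \<sigma>_def sgn_real_def abs_if split: if_splits)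
  define A where "A = w k - \<sigma> * k"
  have A: "0 < A" using mode_arg_pos[OF s, of k x] by (simp add: A_def \<sigma>_def)
  have cA: "0 < c * A" using A c by simp
  define r where "r = sqrt (c * A)"
  have r: "r * r = c * A" "r > 0" using cA by (auto simp: r_def)
  have eq: "inverse r / 2 * (c * (k / w k - \<sigma>)) = r * (- \<sigma> / (2 * w k))"
  proof -
    have "c * (k / w k - \<sigma>) = - \<sigma> * (c * A) / w k"
    proof -
      have "- \<sigma> * A = k - \<sigma> * w k" using \<sigma> by (simp add: A_def right_diff_distrib flip: mult.assoc)
      then have "- \<sigma> * A / w k = k / w k - \<sigma>" by (simp add: diff_divide_distrib)
      then have "c * (k / w k - \<sigma>) = c * (- \<sigma> * A / w k)" by (simp only:)
      then show ?thesis by (simp add: mult_ac)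
    qed
    also have "\<dots> = - \<sigma> * (r * r) / w k" by (simp add: r)
    finally show ?thesis using r(2) by (simp add: divide_simps)
  qed
  define K where "K = side \<epsilon> x / (2 * sqrt pi)"
  have "((\<lambda>k. K * sqrt (c * (w k - \<sigma> * k)) * exp (- (w k * \<bar>x\<bar>))) has_real_derivative
     K * (inverse r / 2 * (c * (k / w k - \<sigma>))) * exp (- (w k * \<bar>x\<bar>))
     + exp (- (w k * \<bar>x\<bar>)) * (- (k / w k * \<bar>x\<bar>)) * (K * r)) (at k)"
    using cA by (auto intro!: derivative_eq_intros simp: r_def A_def)
  moreover have "mode c s \<epsilon> x = (\<lambda>k. K * sqrt (c * (w k - \<sigma> * k)) * exp (- (w k * \<bar>x\<bar>)))"
    by (simp add: mode_def \<sigma>_def K_def fun_eq_iff)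
  moreover have "dmode c s \<epsilon> x k = K * r * exp (- (w k * \<bar>x\<bar>)) * (- \<sigma> / (2 * w k) - k * \<bar>x\<bar> / w k)"
    by (simp add: dmode_def mode_def log_deriv_def \<sigma>_def r_def A_def K_def)
  moreover have "K * (r * (- \<sigma> / (2 * w k))) * exp (- (w k * \<bar>x\<bar>))
     + exp (- (w k * \<bar>x\<bar>)) * (- (k / w k * \<bar>x\<bar>)) * (K * r)
     = K * r * exp (- (w k * \<bar>x\<bar>)) * (- \<sigma> / (2 * w k) - k * \<bar>x\<bar> / w k)"
    by (simp add: algebra_simps)
  ultimately show ?thesis unfolding eq by (simp only:)
qed

text \<open>A common majorant, up to constants, of the modes, their \<open>k\<close>-derivatives and
  their multiples by \<open>x\<close>. For fixed \<open>x\<close> it decays in \<open>k\<close>,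
  though not uniformly near \<open>x = 0\<close>; the integral of its square over \<open>x\<close>
  is bounded uniformly in \<open>k\<close>.\<close>

definition env :: "real \<Rightarrow> real \<Rightarrow> real" where
  "env x k = (if x = 0 then 0 else (1 + \<bar>x\<bar>) * sqrt (w k) * exp (- (w k * \<bar>x\<bar>)))"

lemma env_nonneg: "0 \<le> env x k"
  using w_pos[of k] by (simp add: env_def)

lemma env_measurable [measurable]: "(\<lambda>k. env x k) \<in> borel_measurable borel"
  unfolding env_def[abs_def] by measurable

text \<open>Half of the exponential decay pays for the factor \<open>w k\<close>, through
  \<open>w k * \<bar>x\<bar> \<le> exp (w k * \<bar>x\<bar>)\<close>.\<close>

lemma w_exp_le: assumes "x \<noteq> 0" shows "w k * exp (- (2 * w k * \<bar>x\<bar>)) \<le> 1 / \<bar>x\<bar> * exp (- (\<bar>x\<bar> * \<bar>k\<bar>))"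
proof -
  have "w k * \<bar>x\<bar> \<le> exp (w k * \<bar>x\<bar>)"
    using exp_ge_add_one_self[of "w k * \<bar>x\<bar>"] by linarith
  then have "w k \<le> exp (w k * \<bar>x\<bar>) / \<bar>x\<bar>" using assms by (simp add: field_simps)
  then have "w k * exp (- (2 * w k * \<bar>x\<bar>)) \<le> exp (w k * \<bar>x\<bar>) / \<bar>x\<bar> * exp (- (2 * w k * \<bar>x\<bar>))"
    by (rule mult_right_mono) simp
  also have "\<dots> = 1 / \<bar>x\<bar> * exp (- (\<bar>x\<bar> * w k))"
    by (simp add: mult.commute flip: exp_add)
  also have "\<dots> \<le> 1 / \<bar>x\<bar> * exp (- (\<bar>x\<bar> * \<bar>k\<bar>))"
    using w_gt[of k] by (intro mult_left_mono) (auto intro!: mult_left_mono)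
  finally show ?thesis .
qed

lemma env_sq: "x \<noteq> 0 \<Longrightarrow> (env x k)\<^sup>2 = (1 + \<bar>x\<bar>)\<^sup>2 * (w k * exp (- (2 * w k * \<bar>x\<bar>)))"
  using w_pos[of k] by (simp add: env_def power_mult_distrib mult.assoc flip: exp_double)

lemma env_sq_le: "x \<noteq> 0 \<Longrightarrow> (env x k)\<^sup>2 \<le> (1 + \<bar>x\<bar>)\<^sup>2 / \<bar>x\<bar> * exp (- (\<bar>x\<bar> * \<bar>k\<bar>))"
  using mult_left_mono[OF w_exp_le[of x k], of "(1 + \<bar>x\<bar>)\<^sup>2"] by (simp add: env_sq)

lemma env_bounded: "\<exists>B. \<forall>k. env x k \<le> B"
proof (cases "x = 0")
  case True then show ?thesis by (auto simp: env_def intro: exI[of _ 0])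
next
  case False
  have "(env x k)\<^sup>2 \<le> (1 + \<bar>x\<bar>)\<^sup>2 / \<bar>x\<bar> * 1" for k
    using env_sq_le[OF False, of k] by (rule order_trans) (intro mult_left_mono; simp)
  then have "env x k \<le> sqrt ((1 + \<bar>x\<bar>)\<^sup>2 / \<bar>x\<bar> * 1)" for k
    using real_le_rsqrt by blast
  then show ?thesis by blast
qed

lemma env_integrable: "integrable lborel (\<lambda>k. (env x k)\<^sup>2)"
proof (cases "x = 0")
  case False
  show ?thesis
  proof (rule Bochner_Integration.integrable_bound)
    show "integrable lborel (\<lambda>k. (1 + \<bar>x\<bar>)\<^sup>2 / \<bar>x\<bar> * exp (- (\<bar>x\<bar> * \<bar>k\<bar>)))"
      using False by (intro integrable_mult_right integrable_exp_abs) simp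
    show "AE k in lborel. norm ((env x k)\<^sup>2) \<le> norm ((1 + \<bar>x\<bar>)\<^sup>2 / \<bar>x\<bar> * exp (- (\<bar>x\<bar> * \<bar>k\<bar>)))"
      using env_sq_le[OF False] by (intro AE_I2) (auto intro: order_trans[OF _ abs_ge_self])
  qed measurable
qed (simp add: env_def)

text \<open>The factor \<open>w k\<close> in the squared envelope cancels the leading
  \<open>1 / w k\<close> of the exponential integral, so the value stays bounded for large
  \<open>k\<close>.\<close>

lemma env_moment:
  "has_bochner_integral lborel (\<lambda>x. (env x k)\<^sup>2) (1 + 1 / w k + 1 / (2 * (w k)\<^sup>2))"
proof -
  have "has_bochner_integral lborel (\<lambda>x. w k * ((if 0 < x then 1 + 2 * \<bar>x\<bar> + 1 * x\<^sup>2 else if x < 0 then 1 + 2 * \<bar>x\<bar> + 1 * x\<^sup>2 else 0) * exp (- (2 * w k * \<bar>x\<bar>))))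
    (w k * ((1 + 1) / (2 * w k) + (2 + 2) / (4 * (w k)\<^sup>2) + (1 + 1) / (4 * w k ^ 3)))"
    by (intro has_bochner_integral_mult_right quadratic_exp_integral w_pos)
  moreover have "w k * ((if 0 < x then 1 + 2 * \<bar>x\<bar> + 1 * x\<^sup>2 else if x < 0 then 1 + 2 * \<bar>x\<bar> + 1 * x\<^sup>2 else 0) * exp (- (2 * w k * \<bar>x\<bar>))) = (env x k)\<^sup>2" for x
  proof (cases "x = 0")
    case False
    then show ?thesis unfolding env_sq[OF False] by (simp add: power2_sum)
  qed (simp add: env_def)
  moreover have "w k * ((1 + 1) / (2 * w k) + (2 + 2) / (4 * (w k)\<^sup>2) + (1 + 1) / (4 * w k ^ 3)) = 1 + 1 / w k + 1 / (2 * (w k)\<^sup>2)"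
    by (simp add: field_simps power2_eq_square power3_eq_cube)
  ultimately show ?thesis by simp
qed

definition env_const :: real where "env_const = 1 + 1 / w0 + 1 / (2 * w0\<^sup>2)"

lemma env_moment_le: "(\<integral>\<^sup>+x. ennreal ((env x k)\<^sup>2) \<partial>lborel) \<le> ennreal env_const"
proof -
  have "(\<integral>\<^sup>+x. ennreal ((env x k)\<^sup>2) \<partial>lborel) = ennreal (1 + 1 / w k + 1 / (2 * (w k)\<^sup>2))"
    using env_moment[of k] by (simp add: nn_integral_eq_integral has_bochner_integral_iff)
  also have "1 + 1 / w k + 1 / (2 * (w k)\<^sup>2) \<le> env_const"
    unfolding env_const_def using w0_pos w0_le[of k] w_pos[of k]
    by (intro add_mono frac_le mult_left_mono power_mono) auto
  finally show ?thesis by (simp add: ennreal_leI)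
qed

lemma env_const_nonneg: "0 \<le> env_const"
  using w0_pos by (simp add: env_const_def)

text \<open>The class of kernels that turn a square integrable function of \<open>k\<close> into a
  field to which the partial Fourier transform and its Plancherel identity apply.\<close>

definition weight :: "(real \<Rightarrow> real \<Rightarrow> real) \<Rightarrow> bool" where
  "weight g \<longleftrightarrow> (\<lambda>z. g (fst z) (snd z)) \<in> borel_measurable borel \<and> (\<exists>C\<ge>0. \<forall>x k. \<bar>g x k\<bar> \<le> C * env x k)"

lemma weight_slice_measurable: assumes "weight g" shows "(\<lambda>k. g x k) \<in> borel_measurable borel" "(\<lambda>x. g x k) \<in> borel_measurable borel"
proof -
  have [measurable]: "(\<lambda>z. g (fst z) (snd z)) \<in> borel_measurable (borel \<Otimes>\<^sub>M borel)"
    using assms unfolding weight_def borel_prod by blast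
  have "(\<lambda>k. (\<lambda>z. g (fst z) (snd z)) (x, k)) \<in> borel_measurable borel" by measurable
  then show "(\<lambda>k. g x k) \<in> borel_measurable borel" by simp
  have "(\<lambda>x. (\<lambda>z. g (fst z) (snd z)) (x, k)) \<in> borel_measurable borel" by measurable
  then show "(\<lambda>x. g x k) \<in> borel_measurable borel" by simp
qed

lemma weight_slice_L2: assumes g: "weight g" shows "(\<lambda>k. complex_of_real (g x k)) \<in> L2 lborel"
proof -
  obtain C where C: "\<And>x k. \<bar>g x k\<bar> \<le> C * env x k" using g by (auto simp: weight_def)
  have "(\<lambda>k. env x k) \<in> L2 lborel" using env_integrable[of x] by (simp add: L2_def)
  then show ?thesis
    by (rule L2_bound[where C=C]) (use C weight_slice_measurable[OF g] in \<open>auto simp: env_nonneg\<close>)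
qed

lemma weight_bounded: assumes g: "weight g" shows "\<exists>B. \<forall>k. \<bar>g x k\<bar> \<le> B"
proof -
  obtain C where C: "C \<ge> 0" "\<And>x k. \<bar>g x k\<bar> \<le> C * env x k" using g by (auto simp: weight_def)
  obtain B where B: "\<And>k. env x k \<le> B" using env_bounded by blast
  have "\<bar>g x k\<bar> \<le> C * B" for k using C(2)[of x k] mult_left_mono[OF B[of k] C(1)] by simp
  then show ?thesis by blast
qed

definition field :: "(real \<Rightarrow> real \<Rightarrow> real) \<Rightarrow> (real \<Rightarrow> complex) \<Rightarrow> real \<times> real \<Rightarrow> complex" where
  "field g \<Xi> = (\<lambda>(x, k). of_real (g x k) * \<Xi> k)"

lemma field_measurable:
  assumes g: "weight g" and [measurable]: "\<Xi> \<in> borel_measurable borel"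
  shows "field g \<Xi> \<in> borel_measurable borel"
proof -
  have [measurable]: "(\<lambda>z. g (fst z) (snd z)) \<in> borel_measurable (borel \<Otimes>\<^sub>M borel)"
    using g unfolding weight_def borel_prod by blast
  have "(\<lambda>z. of_real (g (fst z) (snd z)) * \<Xi> (snd z)) \<in> borel_measurable (borel \<Otimes>\<^sub>M borel)"
    by measurable
  then show ?thesis by (simp add: field_def case_prod_unfold borel_prod)
qed

text \<open>For joint square integrability the integral over \<open>x\<close> is taken first, where
  \<open>env_const\<close> bounds the envelope for all \<open>k\<close> at once; integrating over
  \<open>k\<close> first would give bounds that blow up near \<open>x = 0\<close>. The slice
  conditions use the decay of the envelope in \<open>k\<close>.\<close>

lemma slicewise_L2_field:
  assumes g: "weight g" and \<Xi>: "\<Xi> \<in> L2 lborel"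
  shows "slicewise_L2 (field g \<Xi>)"
proof -
  have \<Xi>m[measurable]: "\<Xi> \<in> borel_measurable borel" using \<Xi> by (auto simp: L2_def)
  obtain C where C: "C \<ge> 0" "\<And>x k. \<bar>g x k\<bar> \<le> C * env x k" using g by (auto simp: weight_def)
  note [measurable] = field_measurable[OF g \<Xi>m] weight_slice_measurable[OF g]
  have inner: "(\<integral>\<^sup>+x. ennreal ((norm (field g \<Xi> (x, k)))\<^sup>2) \<partial>lborel) \<le> ennreal (C\<^sup>2 * env_const) * ennreal ((norm (\<Xi> k))\<^sup>2)" for k
  proof -
    have "(\<integral>\<^sup>+x. ennreal ((norm (field g \<Xi> (x, k)))\<^sup>2) \<partial>lborel)
      \<le> (\<integral>\<^sup>+x. ennreal (C\<^sup>2 * (norm (\<Xi> k))\<^sup>2) * ennreal ((env x k)\<^sup>2) \<partial>lborel)"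
    proof (rule nn_integral_mono)
      fix x
      have "(norm (field g \<Xi> (x, k)))\<^sup>2 \<le> (C * env x k * norm (\<Xi> k))\<^sup>2"
        unfolding field_def using C(2)[of x k] by (intro power_mono) (auto simp: norm_mult intro!: mult_right_mono)
      then show "ennreal ((norm (field g \<Xi> (x, k)))\<^sup>2) \<le> ennreal (C\<^sup>2 * (norm (\<Xi> k))\<^sup>2) * ennreal ((env x k)\<^sup>2)"
        by (simp add: power_mult_distrib mult_ac flip: ennreal_mult')
    qed
    also have "\<dots> = ennreal (C\<^sup>2 * (norm (\<Xi> k))\<^sup>2) * (\<integral>\<^sup>+x. ennreal ((env x k)\<^sup>2) \<partial>lborel)"
      by (rule nn_integral_cmult) (simp add: env_def)
    also have "\<dots> \<le> ennreal (C\<^sup>2 * (norm (\<Xi> k))\<^sup>2) * ennreal env_const"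
      by (intro mult_left_mono env_moment_le) simp
    also have "\<dots> = ennreal (C\<^sup>2 * env_const) * ennreal ((norm (\<Xi> k))\<^sup>2)"
      using env_const_nonneg by (simp add: mult_ac flip: ennreal_mult')
    finally show ?thesis .
  qed
  have "(\<integral>\<^sup>+z. ennreal ((norm (field g \<Xi> z))\<^sup>2) \<partial>lborel)
    = (\<integral>\<^sup>+k. (\<integral>\<^sup>+x. ennreal ((norm (field g \<Xi> (x, k)))\<^sup>2) \<partial>lborel) \<partial>lborel)"
    by (subst nn_integral_lborel_iterated(2)) measurable
  also have "\<dots> \<le> (\<integral>\<^sup>+k. ennreal (C\<^sup>2 * env_const) * ennreal ((norm (\<Xi> k))\<^sup>2) \<partial>lborel)"
    by (intro nn_integral_mono inner)
  also have "\<dots> = ennreal (C\<^sup>2 * env_const) * (\<integral>\<^sup>+k. ennreal ((norm (\<Xi> k))\<^sup>2) \<partial>lborel)"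
    by (rule nn_integral_cmult) measurable
  also have "\<dots> < \<infinity>"
    using \<Xi> by (simp add: L2_iff_nn_integral ennreal_mult_less_top)
  finally have "field g \<Xi> \<in> L2 lborel" by (simp add: L2_iff_nn_integral)
  moreover have "integrable lborel (\<lambda>k. field g \<Xi> (x, k))" for x
    using L2_integrable_mult[OF weight_slice_L2[OF g] \<Xi>] by (simp add: field_def)
  moreover have "(\<lambda>k. field g \<Xi> (x, k)) \<in> L2 lborel" for x
  proof -
    obtain B where "\<And>k. \<bar>g x k\<bar> \<le> B" using weight_bounded[OF g] by blast
    then show ?thesis
      by (intro L2_bound[OF \<Xi>, where C=B]) (auto simp: field_def norm_mult intro!: mult_right_mono)
  qed
  ultimately show ?thesis by (simp add: slicewise_L2_def)
qed

text \<open>Once \<open>x\<close> is integrated out, the two weights survive only through the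
  function \<open>h\<close> of \<open>k\<close>; this is how explicit moments become multipliers
  acting on \<open>\<Xi>\<close>.\<close>

lemma field_inner:
  assumes g: "weight g" "\<Xi> \<in> L2 lborel" and g': "weight g'" "\<Xi>' \<in> L2 lborel"
    and h: "\<And>k. has_bochner_integral lborel (\<lambda>x. g x k * g' x k) (h k)"
  shows "(LBINT z. cnj (field g \<Xi> z) * field g' \<Xi>' z) = (LBINT k. of_real (h k) * (cnj (\<Xi> k) * \<Xi>' k))"
    and "integrable lborel (\<lambda>k. of_real (h k) * (cnj (\<Xi> k) * \<Xi>' k))"
proof -
  have "integrable lborel (\<lambda>z. cnj (field g \<Xi> z) * field g' \<Xi>' z)"
    using slicewise_L2_field[OF g] slicewise_L2_field[OF g']
    by (intro L2_integrable_mult L2_cnj) (auto simp: slicewise_L2_def)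
  then have *: "integrable (lborel \<Otimes>\<^sub>M lborel) (\<lambda>(x, k). cnj (field g \<Xi> (x, k)) * field g' \<Xi>' (x, k))"
    by (simp add: lborel_prod case_prod_unfold)
  have **: "(LBINT x. cnj (field g \<Xi> (x, k)) * field g' \<Xi>' (x, k)) = of_real (h k) * (cnj (\<Xi> k) * \<Xi>' k)" for k
  proof -
    have "(LBINT x. cnj (field g \<Xi> (x, k)) * field g' \<Xi>' (x, k))
      = (LBINT x. of_real (g x k * g' x k) * (cnj (\<Xi> k) * \<Xi>' k))"
      by (simp add: field_def mult_ac)
    also have "\<dots> = of_real (LBINT x. g x k * g' x k) * (cnj (\<Xi> k) * \<Xi>' k)"
      by (simp only: integral_mult_left_zero integral_complex_of_real)
    finally show ?thesis using h[of k] by (simp add: has_bochner_integral_integral_eq)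
  qed
  show "(LBINT z. cnj (field g \<Xi> z) * field g' \<Xi>' z) = (LBINT k. of_real (h k) * (cnj (\<Xi> k) * \<Xi>' k))"
    using lborel_pair.integral_snd[OF *] ** by (simp add: lborel_prod case_prod_unfold)
  show "integrable lborel (\<lambda>k. of_real (h k) * (cnj (\<Xi> k) * \<Xi>' k))"
    using lborel_pair.integrable_snd[OF *] ** by simp
qed

lemma weight_mode_mult:
  assumes c: "c \<ge> 0" and s: "\<bar>s\<bar> = 1" and \<epsilon>: "\<bar>\<epsilon>\<bar> = 1"
    and [measurable]: "(\<lambda>z. h (fst z) (snd z)) \<in> borel_measurable borel"
    and D: "D \<ge> 0" "\<And>x k. \<bar>h x k\<bar> \<le> D * (1 + \<bar>x\<bar>)"
  shows "weight (\<lambda>x k. mode c s \<epsilon> x k * h x k)"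
  unfolding weight_def
proof (intro conjI exI allI)
  have [measurable]: "(\<lambda>z. h (fst z) (snd z)) \<in> borel_measurable (borel \<Otimes>\<^sub>M borel)"
    by (simp add: borel_prod)
  have "(\<lambda>z. mode c s \<epsilon> (fst z) (snd z) * h (fst z) (snd z)) \<in> borel_measurable (borel \<Otimes>\<^sub>M borel)"
    unfolding mode_def side_def sgn_real_def by measurable
  then show "(\<lambda>z. mode c s \<epsilon> (fst z) (snd z) * h (fst z) (snd z)) \<in> borel_measurable borel"
    by (simp add: borel_prod)
  \<comment> \<open>The root in a mode is at most \<open>sqrt (2 * c * w k)\<close>, because its
    argument lies between 0 and \<open>2 * c * w k\<close>; the other factor is the prefactor of the
    mode.\<close>
  define C where "C = 1 / (2 * sqrt pi) * sqrt (2 * c)"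
  show "0 \<le> C * D" using c D by (simp add: C_def)
  fix x k
  show "\<bar>mode c s \<epsilon> x k * h x k\<bar> \<le> C * D * env x k"
  proof (cases "x = 0")
    case False
    have "sqrt (c * (w k - s * sgn x * k)) \<le> sqrt (2 * c) * sqrt (w k)"
      using mult_left_mono[OF mode_arg_le[OF s, of k x] c] by (simp add: mult_ac flip: real_sqrt_mult)
    moreover have "\<bar>side \<epsilon> x\<bar> = 1" using False \<epsilon> by (auto simp: side_def)
    moreover have "0 \<le> sqrt (c * (w k - s * sgn x * k))" using mode_arg_pos[OF s, of k x] c by simp
    ultimately have "\<bar>mode c s \<epsilon> x k\<bar> \<le> 1 / (2 * sqrt pi) * (sqrt (2 * c) * sqrt (w k)) * exp (- (w k * \<bar>x\<bar>))"
      unfolding mode_def by (simp add: abs_mult divide_right_mono)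
    then have "\<bar>mode c s \<epsilon> x k * h x k\<bar> \<le> (1 / (2 * sqrt pi) * (sqrt (2 * c) * sqrt (w k)) * exp (- (w k * \<bar>x\<bar>))) * (D * (1 + \<bar>x\<bar>))"
      unfolding abs_mult using c w_pos[of k] by (intro mult_mono D(2)) auto
    also have "\<dots> = C * D * env x k" using False by (simp add: C_def env_def)
    finally show ?thesis .
  qed (simp add: mode_def side_def env_def)
qed

lemma weight_mode: "c \<ge> 0 \<Longrightarrow> \<bar>s\<bar> = 1 \<Longrightarrow> \<bar>\<epsilon>\<bar> = 1 \<Longrightarrow> weight (mode c s \<epsilon>)"
  using weight_mode_mult[of c s \<epsilon> "\<lambda>_ _. 1" 1] by simp

lemma weight_x_mode: "c \<ge> 0 \<Longrightarrow> \<bar>s\<bar> = 1 \<Longrightarrow> \<bar>\<epsilon>\<bar> = 1 \<Longrightarrow> weight (\<lambda>x k. x * mode c s \<epsilon> x k)"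
  using weight_mode_mult[of c s \<epsilon> "\<lambda>x _. x" 1] by (simp add: mult.commute flip: borel_prod)

lemma log_deriv_bound: assumes s: "\<bar>s\<bar> = 1" shows "\<bar>log_deriv s x k\<bar> \<le> (1 / (2 * w0) + 1) * (1 + \<bar>x\<bar>)"
proof -
  have "\<bar>- (s * sgn x) / (2 * w k)\<bar> \<le> 1 / (2 * w0)"
    using s w_pos[of k] w0_pos w0_le[of k] by (auto simp: abs_mult abs_sgn_eq intro!: frac_le)
  moreover have "\<bar>k * \<bar>x\<bar> / w k\<bar> \<le> \<bar>x\<bar>"
    using w_pos[of k] mult_right_mono[OF less_imp_le[OF w_gt[of k]], of "\<bar>x\<bar>"]
    by (simp add: abs_mult pos_divide_le_eq mult.commute)
  ultimately have "\<bar>log_deriv s x k\<bar> \<le> 1 / (2 * w0) + \<bar>x\<bar>" unfolding log_deriv_def by linarith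
  also have "\<dots> \<le> (1 / (2 * w0) + 1) * (1 + \<bar>x\<bar>)"
    using w0_pos by (simp add: algebra_simps add_divide_distrib)
  finally show ?thesis .
qed

lemma weight_dmode: assumes "c \<ge> 0" "\<bar>s\<bar> = 1" "\<bar>\<epsilon>\<bar> = 1" shows "weight (dmode c s \<epsilon>)"
proof -
  have "(\<lambda>z. log_deriv s (fst z) (snd z)) \<in> borel_measurable (borel \<Otimes>\<^sub>M borel)"
    unfolding log_deriv_def sgn_real_def by measurable
  then have "weight (\<lambda>x k. mode c s \<epsilon> x k * log_deriv s x k)"
    using assms w0_pos by (intro weight_mode_mult[where D="1 / (2 * w0) + 1"] log_deriv_bound) (auto simp: borel_prod)
  then show ?thesis by (simp add: dmode_def[abs_def])
qed

section \<open>Moments of a squared mode\<close>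

lemma mode_sq:
  assumes c: "c \<ge> 0" and s: "\<bar>s\<bar> = 1" and \<epsilon>: "\<bar>\<epsilon>\<bar> = 1" and x: "x \<noteq> 0"
  shows "(mode c s \<epsilon> x k)\<^sup>2 = c / (4 * pi) * (w k - s * sgn x * k) * exp (- (2 * w k * \<bar>x\<bar>))"
proof -
  have "(side \<epsilon> x)\<^sup>2 = 1" using \<epsilon> x by (auto simp: side_def abs_square_eq_1)
  moreover have "0 \<le> c * (w k - s * sgn x * k)" using c mode_arg_pos[OF s, of k x] by simp
  ultimately show ?thesis
    by (simp add: mode_def power_mult_distrib power_divide mult.assoc flip: exp_double)
qed

text \<open>The master formula behind the individual moments. Squaring a mode removes its root and
  the sign \<open>\<epsilon>\<close>, leaving the linear factor \<open>w k - s * k\<close> on the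
  right and \<open>w k + s * k\<close> on the left.\<close>

lemma mode_moment:
  assumes c: "c \<ge> 0" and s: "\<bar>s\<bar> = 1" and \<epsilon>: "\<bar>\<epsilon>\<bar> = 1"
  shows "has_bochner_integral lborel
    (\<lambda>x. (mode c s \<epsilon> x k)\<^sup>2 * (if 0 < x then p0 + p1 * \<bar>x\<bar> + p2 * x\<^sup>2 else q0 + q1 * \<bar>x\<bar> + q2 * x\<^sup>2))
    (c / (4 * pi) * ((w k - s * k) * (p0 / (2 * w k) + p1 / (4 * (w k)\<^sup>2) + p2 / (4 * w k ^ 3))
      + (w k + s * k) * (q0 / (2 * w k) + q1 / (4 * (w k)\<^sup>2) + q2 / (4 * w k ^ 3))))"
proof -
  define d where "d = c / (4 * pi)"
  let ?a = "d * (w k - s * k)" and ?b = "d * (w k + s * k)"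
  have "has_bochner_integral lborel
    (\<lambda>x. (if 0 < x then ?a * p0 + ?a * p1 * \<bar>x\<bar> + ?a * p2 * x\<^sup>2 else if x < 0 then ?b * q0 + ?b * q1 * \<bar>x\<bar> + ?b * q2 * x\<^sup>2 else 0) * exp (- (2 * w k * \<bar>x\<bar>)))
    ((?a * p0 + ?b * q0) / (2 * w k) + (?a * p1 + ?b * q1) / (4 * (w k)\<^sup>2) + (?a * p2 + ?b * q2) / (4 * w k ^ 3))"
    by (rule quadratic_exp_integral[OF w_pos])
  moreover have "(if 0 < x then ?a * p0 + ?a * p1 * \<bar>x\<bar> + ?a * p2 * x\<^sup>2 else if x < 0 then ?b * q0 + ?b * q1 * \<bar>x\<bar> + ?b * q2 * x\<^sup>2 else 0) * exp (- (2 * w k * \<bar>x\<bar>))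
    = (mode c s \<epsilon> x k)\<^sup>2 * (if 0 < x then p0 + p1 * \<bar>x\<bar> + p2 * x\<^sup>2 else q0 + q1 * \<bar>x\<bar> + q2 * x\<^sup>2)" for x
  proof (cases "x = 0")
    case True then show ?thesis by (simp add: mode_def side_def)
  next
    case False
    then show ?thesis unfolding mode_sq[OF assms False] d_def[symmetric] by (auto simp: sgn_real_def algebra_simps)
  qed
  moreover have "(?a * p0 + ?b * q0) / (2 * w k) + (?a * p1 + ?b * q1) / (4 * (w k)\<^sup>2) + (?a * p2 + ?b * q2) / (4 * w k ^ 3)
    = d * ((w k - s * k) * (p0 / (2 * w k) + p1 / (4 * (w k)\<^sup>2) + p2 / (4 * w k ^ 3))
      + (w k + s * k) * (q0 / (2 * w k) + q1 / (4 * (w k)\<^sup>2) + q2 / (4 * w k ^ 3)))"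
    by (simp add: add_divide_distrib distrib_left distrib_right mult_ac)
  ultimately show ?thesis unfolding d_def[symmetric] by simp
qed

end

section \<open>Testing the distributional derivative against the modes\<close>

context dirac_line
begin

text \<open>Since this algebra is closed under differentiation, all its members have derivatives of every order,
  and no Leibniz or chain rule of higher order is needed to recognise test functions.\<close>

inductive_set cutoff_algebra :: "(real \<Rightarrow> complex) \<Rightarrow> nat \<Rightarrow> (real \<Rightarrow> complex) set"
  for \<Phi> :: "real \<Rightarrow> complex" and N :: nat where
  const: "(\<lambda>_. c) \<in> cutoff_algebra \<Phi> N"
| var: "complex_of_real \<in> cutoff_algebra \<Phi> N"
| inv: "(\<lambda>k. complex_of_real (1 / w k)) \<in> cutoff_algebra \<Phi> N"
| base: "\<Phi> \<in> cutoff_algebra \<Phi> N"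
| left: "(\<lambda>k. complex_of_real (flat n (1 + 1 / Suc N * k))) \<in> cutoff_algebra \<Phi> N"
| right: "(\<lambda>k. complex_of_real (flat n (1 + - 1 / Suc N * k))) \<in> cutoff_algebra \<Phi> N"
| add: "f \<in> cutoff_algebra \<Phi> N \<Longrightarrow> g \<in> cutoff_algebra \<Phi> N \<Longrightarrow> (\<lambda>k. f k + g k) \<in> cutoff_algebra \<Phi> N"
| mult: "f \<in> cutoff_algebra \<Phi> N \<Longrightarrow> g \<in> cutoff_algebra \<Phi> N \<Longrightarrow> (\<lambda>k. f k * g k) \<in> cutoff_algebra \<Phi> N"

lemma flat_affine_derivative:
  "((\<lambda>k. complex_of_real (flat n (a + b * k))) has_vector_derivative
     of_real b * (of_real (flat (n + 2) (a + b * k)) + of_real (- real n) * of_real (flat (n + 1) (a + b * k)))) (at k)"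
proof -
  have "((\<lambda>k. a + b * k) has_real_derivative b) (at k)" by (auto intro!: derivative_eq_intros)
  from DERIV_chain2[where s=UNIV and f="flat n", OF flat_has_derivative this]
  have "((\<lambda>k. flat n (a + b * k)) has_real_derivative (flat (n + 2) (a + b * k) - n * flat (n + 1) (a + b * k)) * b) (at k)" .
  then have "((\<lambda>k. complex_of_real (flat n (a + b * k))) has_vector_derivative
      of_real ((flat (n + 2) (a + b * k) - n * flat (n + 1) (a + b * k)) * b)) (at k)"
    by (intro has_vector_derivative_of_real) (simp add: has_real_derivative_iff_has_vector_derivative)
  then show ?thesis by (rule has_vector_derivative_eq_rhs) (simp add: algebra_simps)
qed

text \<open>The condition on \<open>\<Phi>'\<close> closes the algebra under differentiation. The
  inverse of \<open>w\<close> is a convenient generator because its derivative is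
  \<open>- k / w k ^ 3\<close>, again a product of generators.\<close>

lemma cutoff_algebra_derivative:
  assumes \<Phi>: "\<And>k. (\<Phi> has_vector_derivative \<Phi>' k) (at k)" "\<Phi>' \<in> cutoff_algebra \<Phi> N"
    and f: "f \<in> cutoff_algebra \<Phi> N"
  shows "\<exists>f'\<in>cutoff_algebra \<Phi> N. \<forall>k. (f has_vector_derivative f' k) (at k)"
  using f
proof induction
  case (const c)
  show ?case by (rule bexI[OF _ cutoff_algebra.const[of 0]]) simp
next
  case var
  show ?case
    by (rule bexI[OF _ cutoff_algebra.const[of 1]])
      (use has_vector_derivative_of_real[OF DERIV_ident, where 'a=complex] in simp)
next
  case inv
  have d: "((\<lambda>k. complex_of_real (1 / w k)) has_vector_derivative
      - 1 * (of_real k * (of_real (1 / w k) * (of_real (1 / w k) * of_real (1 / w k))))) (at k)" for k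
  proof -
    have "((\<lambda>k. 1 / w k) has_real_derivative - (k / w k * 1) / (w k * w k)) (at k)"
      by (auto intro!: derivative_eq_intros)
    then have "((\<lambda>k. complex_of_real (1 / w k)) has_vector_derivative of_real (- (k / w k * 1) / (w k * w k))) (at k)"
      by (intro has_vector_derivative_of_real) (simp add: has_real_derivative_iff_has_vector_derivative)
    then show ?thesis by (rule has_vector_derivative_eq_rhs) simp
  qed
  show ?case
    by (rule bexI[where x="\<lambda>k. - 1 * (of_real k * (of_real (1 / w k) * (of_real (1 / w k) * of_real (1 / w k))))"])
      (intro allI d cutoff_algebra.intros)+
next
  case base
  show ?case using \<Phi> by blast
next
  case (left n)
  show ?case
    by (rule bexI[where x="\<lambda>k. of_real (1 / Suc N) * (of_real (flat (n + 2) (1 + 1 / Suc N * k)) + of_real (- real n) * of_real (flat (n + 1) (1 + 1 / Suc N * k)))"])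
      (intro allI flat_affine_derivative cutoff_algebra.intros)+
next
  case (right n)
  show ?case
    by (rule bexI[where x="\<lambda>k. of_real (- 1 / Suc N) * (of_real (flat (n + 2) (1 + - 1 / Suc N * k)) + of_real (- real n) * of_real (flat (n + 1) (1 + - 1 / Suc N * k)))"])
      (intro allI flat_affine_derivative cutoff_algebra.intros)+
next
  case (add f g)
  then obtain f' g' where "f' \<in> cutoff_algebra \<Phi> N" "g' \<in> cutoff_algebra \<Phi> N"
    "\<And>k. (f has_vector_derivative f' k) (at k)" "\<And>k. (g has_vector_derivative g' k) (at k)" by blast
  then show ?case
    by (intro bexI[where x="\<lambda>k. f' k + g' k"]) (auto intro: has_vector_derivative_add cutoff_algebra.add)
next
  case (mult f g)
  then obtain f' g' where "f' \<in> cutoff_algebra \<Phi> N" "g' \<in> cutoff_algebra \<Phi> N"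
    "\<And>k. (f has_vector_derivative f' k) (at k)" "\<And>k. (g has_vector_derivative g' k) (at k)" by blast
  with mult.hyps show ?case
    by (intro bexI[where x="\<lambda>k. f k * g' k + f' k * g k"])
      (auto intro: has_vector_derivative_mult cutoff_algebra.add cutoff_algebra.mult)
qed

lemma test_function_cutoff:
  assumes \<Phi>: "\<And>k. (\<Phi> has_vector_derivative \<Phi>' k) (at k)" "\<Phi>' \<in> cutoff_algebra \<Phi> N"
  shows "test_function (\<lambda>k. \<Phi> k * of_real (cutoff N k))"
  unfolding test_function_def
proof
  have "(\<lambda>k. \<Phi> k * (of_real (flat 0 (1 + 1 / Suc N * k)) * of_real (flat 0 (1 + - 1 / Suc N * k)))) \<in> cutoff_algebra \<Phi> N"
    by (intro cutoff_algebra.intros)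
  then have "(\<lambda>k. \<Phi> k * of_real (cutoff N k)) \<in> cutoff_algebra \<Phi> N"
    by (simp add: cutoff_def)
  then show "\<exists>D. D (0::nat) = (\<lambda>k. \<Phi> k * of_real (cutoff N k)) \<and> (\<forall>n t. (D n has_vector_derivative D (Suc n) t) (at t))"
    using cutoff_algebra_derivative[OF \<Phi>] by (rule smooth_sequence[rotated])
  have "{k. \<Phi> k * of_real (cutoff N k) \<noteq> 0} \<subseteq> {- real (Suc N)..real (Suc N)}"
  proof
    fix k assume "k \<in> {k. \<Phi> k * of_real (cutoff N k) \<noteq> 0}"
    then have "\<not> real (Suc N) \<le> \<bar>k\<bar>" using cutoff_eq_0[of N k] by auto
    then show "k \<in> {- real (Suc N)..real (Suc N)}" by auto
  qed
  then show "compact (closure {k. \<Phi> k * of_real (cutoff N k) \<noteq> 0})"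
    by (rule compact_closure[THEN iffD2, OF bounded_subset[OF bounded_closed_interval]])
qed

text \<open>A mode times a phase satisfies \<open>\<Phi>' = (log_deriv + \<i> * y) * \<Phi>\<close>,
  and \<open>log_deriv\<close> is a polynomial in \<open>k\<close> and \<open>1 / w k\<close>. Hence
  the root in the mode enters the algebra only through \<open>\<Phi>\<close> itself.\<close>

lemma mode_phase_derivative:
  fixes c s \<epsilon> x y :: real
  assumes c: "c > 0" and s: "\<bar>s\<bar> = 1"
  defines "\<Phi> \<equiv> \<lambda>k. complex_of_real (mode c s \<epsilon> x k) * cis (k * y)"
    and "\<Phi>' \<equiv> \<lambda>k. (of_real (dmode c s \<epsilon> x k) + \<i> * of_real y * of_real (mode c s \<epsilon> x k)) * cis (k * y)"
  shows "(\<Phi> has_vector_derivative \<Phi>' k) (at k)" and "\<Phi>' \<in> cutoff_algebra \<Phi> N"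
proof -
  have "((\<lambda>k. complex_of_real (mode c s \<epsilon> x k)) has_vector_derivative of_real (dmode c s \<epsilon> x k)) (at k)"
    using mode_has_derivative[OF c s, of \<epsilon> x k]
    by (intro has_vector_derivative_of_real) (simp add: has_real_derivative_iff_has_vector_derivative)
  from has_vector_derivative_mult[OF this cis_has_vector_derivative[of y k]]
  show "(\<Phi> has_vector_derivative \<Phi>' k) (at k)"
    unfolding \<Phi>_def \<Phi>'_def by (rule has_vector_derivative_eq_rhs) (simp add: algebra_simps)
  have "(\<lambda>k. \<Phi> k * (of_real (- (s * sgn x) / 2) * of_real (1 / w k) + (of_real (- \<bar>x\<bar>) * (of_real k * of_real (1 / w k)) + \<i> * of_real y)))
    \<in> cutoff_algebra \<Phi> N"
    by (intro cutoff_algebra.intros)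
  moreover have "\<Phi> k * (of_real (- (s * sgn x) / 2) * of_real (1 / w k) + (of_real (- \<bar>x\<bar>) * (of_real k * of_real (1 / w k)) + \<i> * of_real y)) = \<Phi>' k" for k
    by (simp add: \<Phi>_def \<Phi>'_def dmode_def log_deriv_def algebra_simps)
  ultimately show "\<Phi>' \<in> cutoff_algebra \<Phi> N" by simp
qed

text \<open>Integration by parts against mode times phase. This function is smooth but not compactly
  supported, so the weak derivative is tested on its cutoffs; the decay of the mode gives the
  domination that removes them.\<close>

lemma fourier_mode_derivative:
  assumes c: "c > 0" and s: "\<bar>s\<bar> = 1" and \<epsilon>: "\<bar>\<epsilon>\<bar> = 1"
    and \<Xi>: "\<Xi> \<in> L2 lborel" and d\<Xi>: "d\<Xi> \<in> L2 lborel" and deriv: "has_distributional_derivative \<Xi> d\<Xi>"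
  shows "of_real y * fourier (\<lambda>k. of_real (mode c s \<epsilon> x k) * \<Xi> k) y
    = \<i> * fourier (\<lambda>k. of_real (dmode c s \<epsilon> x k) * \<Xi> k + of_real (mode c s \<epsilon> x k) * d\<Xi> k) y"
proof -
  let ?g = "\<lambda>k. complex_of_real (mode c s \<epsilon> x k)" and ?dg = "\<lambda>k. complex_of_real (dmode c s \<epsilon> x k)"
  define \<Phi> where "\<Phi> k = ?g k * cis (k * y)" for k
  define \<Phi>' where "\<Phi>' k = (?dg k + \<i> * of_real y * ?g k) * cis (k * y)" for k
  have \<Phi>: "(\<Phi> has_vector_derivative \<Phi>' k) (at k)" "\<Phi>' \<in> cutoff_algebra \<Phi> N" for k N
    unfolding \<Phi>_def[abs_def] \<Phi>'_def[abs_def] by (rule mode_phase_derivative[OF c s])+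
  have g: "?g \<in> L2 lborel" "?dg \<in> L2 lborel"
    using c s \<epsilon> by (intro weight_slice_L2 weight_mode weight_dmode; simp)+
  have [measurable]: "\<Xi> \<in> borel_measurable borel" "d\<Xi> \<in> borel_measurable borel"
    "?g \<in> borel_measurable borel" "?dg \<in> borel_measurable borel"
    using \<Xi> d\<Xi> g by (auto simp: L2_def)
  have [measurable]: "\<Phi> \<in> borel_measurable borel" "\<Phi>' \<in> borel_measurable borel"
    unfolding \<Phi>_def[abs_def] \<Phi>'_def[abs_def] by measurable
  have cutoff_m[measurable]: "cutoff n \<in> borel_measurable borel" "cutoff' n \<in> borel_measurable borel" for n
    unfolding cutoff_def[abs_def] cutoff'_def[abs_def] flat_def by measurable
  have int1: "integrable lborel (\<lambda>k. ?g k * \<Xi> k)" "integrable lborel (\<lambda>k. ?dg k * \<Xi> k)" "integrable lborel (\<lambda>k. ?g k * d\<Xi> k)"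
    by (intro L2_integrable_mult g \<Xi> d\<Xi>)+
  have int2: "integrable lborel (\<lambda>k. \<Xi> k * \<Phi> k)" "integrable lborel (\<lambda>k. d\<Xi> k * \<Phi> k)"
    using fourier_integrable[OF int1(1), of y] fourier_integrable[OF int1(3), of y] by (simp_all add: \<Phi>_def mult_ac)
  have int3: "integrable lborel (\<lambda>k. \<Xi> k * \<Phi>' k)"
  proof -
    have "integrable lborel (\<lambda>k. (?dg k * \<Xi> k) * cis (k * y) + \<i> * of_real y * ((?g k * \<Xi> k) * cis (k * y)))"
      by (intro Bochner_Integration.integrable_add integrable_mult_right fourier_integrable int1)
    then show ?thesis by (simp add: \<Phi>'_def algebra_simps)
  qed
  have test: "(LBINT k. \<Xi> k * (\<Phi> k * of_real (cutoff' n k) + \<Phi>' k * of_real (cutoff n k)))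
     = - (LBINT k. d\<Xi> k * (\<Phi> k * of_real (cutoff n k)))" for n
  proof -
    have "((\<lambda>k. \<Phi> k * complex_of_real (cutoff n k)) has_vector_derivative (\<Phi> k * of_real (cutoff' n k) + \<Phi>' k * of_real (cutoff n k))) (at k)" for k
      using cutoff_has_derivative[of n k]
      by (intro has_vector_derivative_mult \<Phi> has_vector_derivative_of_real)
        (simp add: has_real_derivative_iff_has_vector_derivative)
    then have "vector_derivative (\<lambda>k. \<Phi> k * complex_of_real (cutoff n k)) (at k) = \<Phi> k * of_real (cutoff' n k) + \<Phi>' k * of_real (cutoff n k)" for k
      by (rule vector_derivative_at)
    moreover have "(LBINT k. \<Xi> k * vector_derivative (\<lambda>k. \<Phi> k * complex_of_real (cutoff n k)) (at k))
      = - (LBINT k. d\<Xi> k * (\<Phi> k * of_real (cutoff n k)))"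
      using deriv test_function_cutoff[OF \<Phi>, of n] unfolding has_distributional_derivative_def by blast
    ultimately show ?thesis by simp
  qed
  have "(\<lambda>n. \<integral>k. \<Xi> k * (\<Phi> k * of_real (cutoff' n k) + \<Phi>' k * of_real (cutoff n k)) \<partial>lborel)
     \<longlonglongrightarrow> (LBINT k. \<Xi> k * (\<Phi> k * of_real 0 + \<Phi>' k * of_real (exp (- 2))))"
  proof (rule integral_dominated_convergence[where w="\<lambda>k. 2 * norm (\<Xi> k * \<Phi> k) + norm (\<Xi> k * \<Phi>' k)"])
    show "AE k in lborel. (\<lambda>n. \<Xi> k * (\<Phi> k * of_real (cutoff' n k) + \<Phi>' k * of_real (cutoff n k)))
        \<longlonglongrightarrow> \<Xi> k * (\<Phi> k * of_real 0 + \<Phi>' k * of_real (exp (- 2)))"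
      by (intro AE_I2 tendsto_intros cutoff_tendsto cutoff'_tendsto)
    show "AE k in lborel. norm (\<Xi> k * (\<Phi> k * of_real (cutoff' n k) + \<Phi>' k * of_real (cutoff n k)))
        \<le> 2 * norm (\<Xi> k * \<Phi> k) + norm (\<Xi> k * \<Phi>' k)" for n
    proof (rule AE_I2)
      fix k
      have "\<bar>cutoff' n k\<bar> \<le> 2" using cutoff'_bound[of n k] by (rule order_trans) (simp add: pos_divide_le_eq)
      moreover have "\<bar>cutoff n k\<bar> \<le> 1" using cutoff_bounds[of n k] by simp
      ultimately have "norm (\<Phi> k * of_real (cutoff' n k) + \<Phi>' k * of_real (cutoff n k)) \<le> norm (\<Phi> k) * 2 + norm (\<Phi>' k) * 1"
        by (intro order_trans[OF norm_triangle_ineq] add_mono) (auto simp: norm_mult intro!: mult_left_mono mult_left_le)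
      from mult_left_mono[OF this norm_ge_zero[of "\<Xi> k"]]
      show "norm (\<Xi> k * (\<Phi> k * of_real (cutoff' n k) + \<Phi>' k * of_real (cutoff n k)))
        \<le> 2 * norm (\<Xi> k * \<Phi> k) + norm (\<Xi> k * \<Phi>' k)"
        unfolding norm_mult[of "\<Xi> k"] by (rule order_trans) (rule eq_refl, algebra)
    qed
  qed (use int2 int3 in auto)
  moreover have "(\<lambda>n. - (LBINT k. d\<Xi> k * (\<Phi> k * of_real (cutoff n k)))) \<longlonglongrightarrow> - (LBINT k. d\<Xi> k * (\<Phi> k * of_real (exp (- 2))))"
  proof (intro tendsto_minus integral_dominated_convergence[where w="\<lambda>k. norm (d\<Xi> k * \<Phi> k)"])
    show "AE k in lborel. (\<lambda>n. d\<Xi> k * (\<Phi> k * of_real (cutoff n k))) \<longlonglongrightarrow> d\<Xi> k * (\<Phi> k * of_real (exp (- 2)))"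
      by (intro AE_I2 tendsto_intros cutoff_tendsto)
    show "AE k in lborel. norm (d\<Xi> k * (\<Phi> k * of_real (cutoff n k))) \<le> norm (d\<Xi> k * \<Phi> k)" for n
      using cutoff_bounds[of n] by (intro AE_I2) (auto simp: norm_mult intro!: mult_left_mono mult_left_le)
  qed (use int2 in auto)
  ultimately have "(LBINT k. \<Xi> k * (\<Phi> k * of_real 0 + \<Phi>' k * of_real (exp (- 2))))
      = - (LBINT k. d\<Xi> k * (\<Phi> k * of_real (exp (- 2))))"
    unfolding test by (rule LIMSEQ_unique)
  \<comment> \<open>Both sides carry the limit \<open>exp (- 2)\<close> of the cutoffs; being
    nonzero, it cancels.\<close>
  then have "of_real (exp (- 2)) * (LBINT k. \<Xi> k * \<Phi>' k) = of_real (exp (- 2)) * - (LBINT k. d\<Xi> k * \<Phi> k)"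
    unfolding mult_minus_right integral_mult_right_zero[symmetric] by (simp add: mult_ac)
  then have eq: "(LBINT k. \<Xi> k * \<Phi>' k) = - (LBINT k. d\<Xi> k * \<Phi> k)"
    unfolding mult_cancel_left by (auto simp flip: exp_of_real)
  have "(LBINT k. \<Xi> k * \<Phi>' k) = (LBINT k. (?dg k * \<Xi> k) * cis (k * y) + \<i> * of_real y * ((?g k * \<Xi> k) * cis (k * y)))"
    by (simp add: \<Phi>'_def algebra_simps)
  also have "\<dots> = fourier (\<lambda>k. ?dg k * \<Xi> k) y + \<i> * of_real y * fourier (\<lambda>k. ?g k * \<Xi> k) y"
    unfolding fourier_def using fourier_integrable[OF int1(1), of y] fourier_integrable[OF int1(2), of y]
    by (subst Bochner_Integration.integral_add) auto
  finally have 1: "fourier (\<lambda>k. ?dg k * \<Xi> k) y + \<i> * of_real y * fourier (\<lambda>k. ?g k * \<Xi> k) y = - (LBINT k. d\<Xi> k * \<Phi> k)"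
    using eq by simp
  have 2: "(LBINT k. d\<Xi> k * \<Phi> k) = fourier (\<lambda>k. ?g k * d\<Xi> k) y"
    by (simp add: fourier_def \<Phi>_def mult_ac)
  have "\<i> * of_real y * fourier (\<lambda>k. ?g k * \<Xi> k) y = - fourier (\<lambda>k. ?dg k * \<Xi> k + ?g k * d\<Xi> k) y"
    unfolding fourier_add[OF int1(2,3)] using 1 2 by (simp add: algebra_simps eq_neg_iff_add_eq_0)
  then have "\<i> * (\<i> * of_real y * fourier (\<lambda>k. ?g k * \<Xi> k) y) = \<i> * - fourier (\<lambda>k. ?dg k * \<Xi> k + ?g k * d\<Xi> k) y" by simp
  then show ?thesis by (simp flip: mult.assoc)
qed

end

section \<open>Spinor fields as partial Fourier transforms\<close>

lemma matrix_inv_eqI: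
  fixes A B :: "'a::semiring_1 ^ 'n ^ 'n"
  assumes "A ** B = mat 1" "B ** A = mat 1"
  shows "matrix_inv A = B"
  unfolding matrix_inv_def
proof (rule some_equality)
  fix C assume "A ** C = mat 1 \<and> C ** A = mat 1"
  then have "C = C ** (A ** B)" "(C ** A) ** B = B" using assms by simp_all
  then show "C = B" by (simp add: matrix_mul_assoc)
qed (use assms in simp)

section \<open>Two-component fields, component by component\<close>

lemma bounded_linear_axis: "bounded_linear (axis i :: 'a::euclidean_space \<Rightarrow> 'a ^ 'n)"
  unfolding linear_conv_bounded_linear[symmetric]
  by (rule linearI) (auto simp: vec_eq_iff axis_def)

lemma complex2_eq_axis: "v = axis 1 (v $ 1) + axis 2 (v $ 2)" for v :: "complex ^ 2"
  by (simp add: vec_eq_iff forall_2 axis_def)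

lemma complex2_integrable:
  fixes f :: "'a \<Rightarrow> complex ^ 2"
  assumes "integrable M (\<lambda>z. f z $ 1)" "integrable M (\<lambda>z. f z $ 2)"
  shows "integrable M f"
proof -
  have "integrable M (\<lambda>z. axis 1 (f z $ 1) + axis 2 (f z $ 2) :: complex ^ 2)"
    by (intro Bochner_Integration.integrable_add integrable_bounded_linear[OF bounded_linear_axis] assms)
  then show ?thesis by (simp flip: complex2_eq_axis)
qed

lemma complex2_measurable:
  fixes f :: "'a \<Rightarrow> complex ^ 2"
  assumes "(\<lambda>z. f z $ 1) \<in> borel_measurable M" "(\<lambda>z. f z $ 2) \<in> borel_measurable M"
  shows "f \<in> borel_measurable M"
proof -
  have [measurable]: "(axis i :: complex \<Rightarrow> complex ^ 2) \<in> borel_measurable borel" for i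
    by (intro borel_measurable_continuous_onI linear_continuous_on bounded_linear_axis)
  have "(\<lambda>z. axis 1 (f z $ 1) + axis 2 (f z $ 2) :: complex ^ 2) \<in> borel_measurable M"
    using assms by measurable
  then show ?thesis by (simp flip: complex2_eq_axis)
qed

lemma norm_complex2_sq: "(norm v)\<^sup>2 = (norm (v $ 1))\<^sup>2 + (norm (v $ 2))\<^sup>2" for v :: "complex ^ 2"
  by (simp add: norm_vec_def L2_set_def sum_2)

text \<open>The factor \<open>-\<i>\<close> of the second spinor component is split off, so that the fields \<open>u\<^sub>1\<close>, \<open>u\<^sub>2\<close>
  belonging to \<open>\<psi>\<close> are real multiples of \<open>\<Xi>\<close>.\<close>

definition spinor_of :: "(real \<times> real \<Rightarrow> complex) \<Rightarrow> (real \<times> real \<Rightarrow> complex) \<Rightarrow> spinor_field \<Rightarrow> bool" where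
  "spinor_of u\<^sub>1 u\<^sub>2 \<xi> \<longleftrightarrow> slicewise_L2 u\<^sub>1 \<and> slicewise_L2 u\<^sub>2 \<and>
    (\<forall>z. \<xi> z $ 1 = partial_fourier u\<^sub>1 z \<and> \<xi> z $ 2 = - \<i> * partial_fourier u\<^sub>2 z)"

lemma spinor_ofD:
  assumes "spinor_of u\<^sub>1 u\<^sub>2 \<xi>"
  shows "slicewise_L2 u\<^sub>1" "slicewise_L2 u\<^sub>2" "\<xi> z $ 1 = partial_fourier u\<^sub>1 z" "\<xi> z $ 2 = - \<i> * partial_fourier u\<^sub>2 z"
  using assms unfolding spinor_of_def by blast+

lemma spinor_of_L2:
  assumes "spinor_of u\<^sub>1 u\<^sub>2 \<xi>"
  shows "\<xi> \<in> L2 lborel"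
proof -
  have "partial_fourier u\<^sub>1 \<in> L2 lborel" "partial_fourier u\<^sub>2 \<in> L2 lborel"
    using assms partial_fourier_L2(1) by (auto simp: spinor_of_def)
  moreover from this have "(\<lambda>z. - \<i> * partial_fourier u\<^sub>2 z) \<in> L2 lborel" by (intro L2_cmult)
  ultimately have "(\<lambda>z. \<xi> z $ 1) \<in> L2 lborel" "(\<lambda>z. \<xi> z $ 2) \<in> L2 lborel"
    by (simp_all only: spinor_ofD[OF assms])
  then show ?thesis
    by (auto simp: L2_def norm_complex2_sq intro!: complex2_measurable)
qed

lemma spinor_of_inner:
  assumes \<phi>: "spinor_of u\<^sub>1 u\<^sub>2 \<phi>" and \<xi>: "spinor_of v\<^sub>1 v\<^sub>2 \<xi>"
  shows "spinor_inner \<phi> \<xi> = of_real (2 * pi) * ((LBINT z. cnj (u\<^sub>1 z) * v\<^sub>1 z) + (LBINT z. cnj (u\<^sub>2 z) * v\<^sub>2 z))"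
proof -
  have u: "slicewise_L2 u\<^sub>1" "slicewise_L2 u\<^sub>2" and v: "slicewise_L2 v\<^sub>1" "slicewise_L2 v\<^sub>2"
    using \<phi> \<xi> by (auto simp: spinor_of_def)
  have "spinor_inner \<phi> \<xi> = (LBINT z. cnj (partial_fourier u\<^sub>1 z) * partial_fourier v\<^sub>1 z + cnj (partial_fourier u\<^sub>2 z) * partial_fourier v\<^sub>2 z)"
  proof -
    have "cnj (- \<i> * a) * (- \<i> * b) = cnj a * b" for a b :: complex
      by (simp add: complex_eq_iff algebra_simps)
    then show ?thesis
      unfolding spinor_inner_def sum_2 spinor_ofD[OF \<phi>] spinor_ofD[OF \<xi>] by simp
  qed
  also have "\<dots> = (LBINT z. cnj (partial_fourier u\<^sub>1 z) * partial_fourier v\<^sub>1 z) + (LBINT z. cnj (partial_fourier u\<^sub>2 z) * partial_fourier v\<^sub>2 z)"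
    by (intro Bochner_Integration.integral_add L2_integrable_mult L2_cnj partial_fourier_L2(1) u v)
  also have "\<dots> = of_real (2 * pi) * ((LBINT z. cnj (u\<^sub>1 z) * v\<^sub>1 z) + (LBINT z. cnj (u\<^sub>2 z) * v\<^sub>2 z))"
    unfolding partial_fourier_inner[OF u(1) v(1)] partial_fourier_inner[OF u(2) v(2)] by (simp add: distrib_left)
  finally show ?thesis .
qed

text \<open>Writing norms as inner products lets the same calculus of moments yield both
  expectations and variances.\<close>

lemma L2_norm_spinor:
  "complex_of_real ((L2_norm lborel \<xi>)\<^sup>2) = spinor_inner \<xi> \<xi>"
proof -
  have "complex_of_real ((norm (\<xi> z))\<^sup>2) = (\<Sum>i\<in>UNIV. cnj (\<xi> z $ i) * \<xi> z $ i)" for z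
    by (simp add: norm_complex2_sq sum_2 complex_norm_square[unfolded of_real_power] mult.commute)
  then show ?thesis
    unfolding L2_norm_squared spinor_inner_def integral_complex_of_real[symmetric] by simp
qed

context dirac_line
begin

text \<open>With \<open>p\<close> and \<open>q\<close> the halves of \<open>\<eta> + \<tau>\<close>
  and \<open>\<eta> - \<tau>\<close>, criticality says \<open>p * q = 1\<close>. Hence the matrix to
  be inverted has determinant \<open>p * q + 1 = 2\<close>, and the diagonal entries of the product
  cancel.\<close>

lemma interface_matrix: "\<Lambda> \<eta> \<tau> = vector [vector [0, - \<i> * of_real ((\<eta> - \<tau>) / 2)], vector [- \<i> * of_real ((\<eta> + \<tau>) / 2), 0]]"
proof -
  define p q where "p = complex_of_real ((\<eta> + \<tau>) / 2)" and "q = complex_of_real ((\<eta> - \<tau>) / 2)"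
  have "(\<eta> + \<tau>) / 2 * ((\<eta> - \<tau>) / 2) = 1" using critical by (simp add: power2_eq_square algebra_simps)
  then have pq: "p * q = 1" unfolding p_def q_def of_real_mult[symmetric] by simp
  have p: "of_real \<eta> / 2 + of_real \<tau> / 2 = p" "of_real \<eta> / 2 - of_real \<tau> / 2 = q"
    by (simp_all add: p_def q_def add_divide_distrib diff_divide_distrib)
  have A: "mat \<i> ** \<sigma>\<^sub>1 - (1/2) *\<^sub>R (\<eta> *\<^sub>R \<sigma>\<^sub>0 + \<tau> *\<^sub>R \<sigma>\<^sub>3) = vector [vector [- p, \<i>], vector [\<i>, - q]]"
    by (simp add: vec_eq_iff forall_2 matrix_matrix_mult_def mat_def sum_2 \<sigma>\<^sub>0_def \<sigma>\<^sub>1_def \<sigma>\<^sub>3_def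
        scaleR_conv_of_real[where 'a=complex] p_def q_def field_simps)
  have B: "mat \<i> ** \<sigma>\<^sub>1 + (1/2) *\<^sub>R (\<eta> *\<^sub>R \<sigma>\<^sub>0 + \<tau> *\<^sub>R \<sigma>\<^sub>3) = vector [vector [p, \<i>], vector [\<i>, q]]"
    by (simp add: vec_eq_iff forall_2 matrix_matrix_mult_def mat_def sum_2 \<sigma>\<^sub>0_def \<sigma>\<^sub>1_def \<sigma>\<^sub>3_def
        scaleR_conv_of_real[where 'a=complex] p_def q_def field_simps)
  have "matrix_inv (vector [vector [- p, \<i>], vector [\<i>, - q]] :: complex ^ 2 ^ 2)
      = vector [vector [- q / 2, - \<i> / 2], vector [- \<i> / 2, - p / 2]]"
    by (rule matrix_inv_eqI)
      (simp_all add: vec_eq_iff forall_2 matrix_matrix_mult_def mat_def sum_2 pq mult.commute[of q p])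
  then show ?thesis
    unfolding \<Lambda>_def A B
    by (simp add: vec_eq_iff forall_2 matrix_matrix_mult_def sum_2 pq mult.commute[of q p] p_def[symmetric] q_def[symmetric] del: of_real_divide)
qed

abbreviation t :: real where "t \<equiv> \<tau> / \<eta>"

lemma t_bounds: "0 < 1 - t" "0 < 1 + t"
proof -
  have "\<tau>\<^sup>2 < \<eta>\<^sup>2" using critical by simp
  then have "t\<^sup>2 < 1" using \<eta>_nz by (simp add: power_divide)
  then have "\<bar>t\<bar> < 1" by (simp only: abs_square_less_1)
  then show "0 < 1 - t" "0 < 1 + t" unfolding abs_less_iff by linarith+
qed

lemma t_square: "1 - t\<^sup>2 = 4 / \<eta>\<^sup>2"
proof -
  have "1 - t\<^sup>2 = (\<eta>\<^sup>2 - \<tau>\<^sup>2) / \<eta>\<^sup>2" using \<eta>_nz by (simp add: power_divide diff_divide_distrib)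
  then show ?thesis using critical by simp
qed

text \<open>Squared, the first identity says that
  \<open>((\<eta> - \<tau>) / 2)\<^sup>2 * (1 + t) = 1 - t\<close>, which follows from
  \<open>(\<eta> - \<tau>) * (\<eta> + \<tau>) = 4\<close>; the second is its mirror image. Since
  \<open>t\<close> has modulus less than 1, both \<open>\<eta> - \<tau>\<close> and
  \<open>\<eta> + \<tau>\<close> have the sign of \<open>\<eta>\<close>, which determines the sign
  after taking roots.\<close>

lemma coupling_sqrt:
  "(\<eta> - \<tau>) / 2 * sqrt ((1 + t) * a) = sgn \<eta> * sqrt ((1 - t) * a)"
  "(\<eta> + \<tau>) / 2 * sqrt ((1 - t) * a) = sgn \<eta> * sqrt ((1 + t) * a)"
proof -
  have prod: "(\<eta> - \<tau>) * (\<eta> + \<tau>) = 4" using critical by (simp add: power2_eq_square algebra_simps)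
  have m: "\<eta> - \<tau> = \<eta> * (1 - t)" and p: "\<eta> + \<tau> = \<eta> * (1 + t)" using \<eta>_nz by (simp_all add: algebra_simps)
  have sm: "\<eta> - \<tau> = sgn \<eta> * \<bar>\<eta> - \<tau>\<bar>" and sp: "\<eta> + \<tau> = sgn \<eta> * \<bar>\<eta> + \<tau>\<bar>"
    unfolding m p using t_bounds by (simp_all add: abs_mult sgn_mult_abs flip: mult.assoc)
  have e1: "(\<bar>\<eta> - \<tau>\<bar> / 2)\<^sup>2 * (1 + t) = 1 - t"
  proof -
    have A: "(\<eta> - \<tau>)\<^sup>2 * (\<eta> + \<tau>) = 4 * (\<eta> - \<tau>)" using prod by (simp add: power2_eq_square mult.assoc)
    have "(\<bar>\<eta> - \<tau>\<bar> / 2)\<^sup>2 * (1 + t) = ((\<eta> - \<tau>)\<^sup>2 * (\<eta> + \<tau>)) / (4 * \<eta>)"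
      using \<eta>_nz by (simp add: power_divide field_simps)
    also have "\<dots> = 4 * (\<eta> - \<tau>) / (4 * \<eta>)" by (simp only: A)
    also have "\<dots> = 1 - t" using \<eta>_nz by (simp add: add_divide_distrib diff_divide_distrib)
    finally show ?thesis .
  qed
  have e2: "(\<bar>\<eta> + \<tau>\<bar> / 2)\<^sup>2 * (1 - t) = 1 + t"
  proof -
    have A: "(\<eta> + \<tau>)\<^sup>2 * (\<eta> - \<tau>) = 4 * (\<eta> + \<tau>)" using prod by (simp add: power2_eq_square mult.assoc mult.commute[of "\<eta> + \<tau>" "\<eta> - \<tau>"])
    have "(\<bar>\<eta> + \<tau>\<bar> / 2)\<^sup>2 * (1 - t) = ((\<eta> + \<tau>)\<^sup>2 * (\<eta> - \<tau>)) / (4 * \<eta>)"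
      using \<eta>_nz by (simp add: power_divide field_simps)
    also have "\<dots> = 4 * (\<eta> + \<tau>) / (4 * \<eta>)" by (simp only: A)
    also have "\<dots> = 1 + t" using \<eta>_nz by (simp add: add_divide_distrib diff_divide_distrib)
    finally show ?thesis .
  qed
  have "(\<eta> - \<tau>) / 2 * sqrt ((1 + t) * a) = sgn \<eta> * (sqrt ((\<bar>\<eta> - \<tau>\<bar> / 2)\<^sup>2) * sqrt ((1 + t) * a))"
    using sm by simp
  also have "\<dots> = sgn \<eta> * sqrt ((\<bar>\<eta> - \<tau>\<bar> / 2)\<^sup>2 * (1 + t) * a)"
    by (simp only: real_sqrt_mult mult.assoc)
  finally show "(\<eta> - \<tau>) / 2 * sqrt ((1 + t) * a) = sgn \<eta> * sqrt ((1 - t) * a)" unfolding e1 .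
  have "(\<eta> + \<tau>) / 2 * sqrt ((1 - t) * a) = sgn \<eta> * (sqrt ((\<bar>\<eta> + \<tau>\<bar> / 2)\<^sup>2) * sqrt ((1 - t) * a))"
    using sp by simp
  also have "\<dots> = sgn \<eta> * sqrt ((\<bar>\<eta> + \<tau>\<bar> / 2)\<^sup>2 * (1 - t) * a)"
    by (simp only: real_sqrt_mult mult.assoc)
  finally show "(\<eta> + \<tau>) / 2 * sqrt ((1 - t) * a) = sgn \<eta> * sqrt ((1 + t) * a)" unfolding e2 .
qed

text \<open>The minus sign in \<open>g1\<close> is the product of the factor \<open>- \<i>\<close>
  in the matrix entry with the \<open>- \<i>\<close> of the second amplitude. In the second
  component the matrix entry supplies exactly the \<open>- \<i>\<close> that
  \<open>spinor_of\<close> splits off, so \<open>g2\<close> has no such sign.\<close>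

abbreviation g1 :: "real \<Rightarrow> real \<Rightarrow> real" where "g1 \<equiv> mode (1 - t) 1 (- sgn \<eta>)"
abbreviation g2 :: "real \<Rightarrow> real \<Rightarrow> real" where "g2 \<equiv> mode (1 + t) (- 1) (sgn \<eta>)"
abbreviation dg1 :: "real \<Rightarrow> real \<Rightarrow> real" where "dg1 \<equiv> dmode (1 - t) 1 (- sgn \<eta>)"
abbreviation dg2 :: "real \<Rightarrow> real \<Rightarrow> real" where "dg2 \<equiv> dmode (1 + t) (- 1) (sgn \<eta>)"

lemma mode_params: "0 < 1 - t" "0 < 1 + t" "0 \<le> 1 - t" "0 \<le> 1 + t" "\<bar>1::real\<bar> = 1" "\<bar>- 1::real\<bar> = 1" "\<bar>- sgn \<eta>\<bar> = 1" "\<bar>sgn \<eta>\<bar> = 1"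
  using t_bounds \<eta>_nz by (auto simp: abs_sgn_eq)

lemma weights: "weight g1" "weight g2" "weight dg1" "weight dg2"
  "weight (\<lambda>x k. x * g1 x k)" "weight (\<lambda>x k. x * g2 x k)"
  by (intro weight_mode weight_dmode weight_x_mode mode_params)+

text \<open>For negative \<open>x\<close> the matrix is the identity and the modes are the
  amplitudes themselves; for positive \<open>x\<close> the components are exchanged, and
  \<open>coupling_sqrt\<close> restores the form of a mode.\<close>

lemma psi_spinor_of:
  assumes \<Xi>: "\<Xi> \<in> L2 lborel"
  shows "spinor_of (field g1 \<Xi>) (field g2 \<Xi>) (\<psi> m \<eta> \<tau> \<Xi>)"
  unfolding spinor_of_def
proof (intro conjI allI)
  show "slicewise_L2 (field g1 \<Xi>)" "slicewise_L2 (field g2 \<Xi>)"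
    by (intro slicewise_L2_field weights \<Xi>)+
  fix z :: "real \<times> real"
  obtain x y where z: "z = (x, y)" by fastforce
  define R where "R = 2 * sqrt pi"
  have R: "R > 0" by (simp add: R_def)
  define I where "I = (LBINT k. (\<Xi> k * exp (\<i> * of_real (k * y) - of_real (w k * \<bar>x\<bar>))) *s amplitude m \<eta> \<tau> k)"
  \<comment> \<open>Evaluated at \<open>- \<bar>x\<bar>\<close>, these are the profiles before the
    matrix acts, on either side of the line.\<close>
  define h1 where "h1 = mode (1 - t) 1 1 (- \<bar>x\<bar>)"
  define h2 where "h2 = mode (1 + t) (- 1) 1 (- \<bar>x\<bar>)"
  have psi: "\<psi> m \<eta> \<tau> \<Xi> z = (1 / R) *\<^sub>R ((heaviside x *\<^sub>R \<Lambda> \<eta> \<tau> + heaviside (- x) *\<^sub>R \<sigma>\<^sub>0) *v I)"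
    by (simp add: \<psi>_def z I_def R_def)
  have "\<psi> m \<eta> \<tau> \<Xi> z $ 1 = partial_fourier (field g1 \<Xi>) z \<and> \<psi> m \<eta> \<tau> \<Xi> z $ 2 = - \<i> * partial_fourier (field g2 \<Xi>) z"
  proof (cases "x = 0")
    \<comment> \<open>On the line both step functions are 0 and so is \<open>side\<close>, hence
      both expressions vanish.\<close>
    case True
    then show ?thesis
      unfolding psi by (simp add: z heaviside_def partial_fourier_def field_def mode_def side_def fourier_def matrix_vector_mult_def)
  next
    case False
    have h: "sqrt ((1 - t) * (w k + k)) * exp (- (w k * \<bar>x\<bar>)) = R * h1 k"
      "sqrt ((1 + t) * (w k - k)) * exp (- (w k * \<bar>x\<bar>)) = R * h2 k" for k
      using False by (auto simp: h1_def h2_def mode_def side_def R_def)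
    have ex: "exp (\<i> * of_real (k * y) - of_real (w k * \<bar>x\<bar>)) = cis (k * y) * of_real (exp (- (w k * \<bar>x\<bar>)))" for k
      by (simp add: cis_conv_exp exp_diff exp_minus divide_inverse flip: exp_of_real)
    have v1: "((\<Xi> k * exp (\<i> * of_real (k * y) - of_real (w k * \<bar>x\<bar>))) *s amplitude m \<eta> \<tau> k) $ 1
        = of_real R * ((of_real (h1 k) * \<Xi> k) * cis (k * y))" for k
    proof -
      have "((\<Xi> k * exp (\<i> * of_real (k * y) - of_real (w k * \<bar>x\<bar>))) *s amplitude m \<eta> \<tau> k) $ 1
        = of_real (sqrt ((1 - t) * (w k + k)) * exp (- (w k * \<bar>x\<bar>))) * \<Xi> k * cis (k * y)"
        unfolding ex by (simp add: amplitude_def mult_ac)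
      then show ?thesis unfolding h by (simp add: mult_ac)
    qed
    have v2: "((\<Xi> k * exp (\<i> * of_real (k * y) - of_real (w k * \<bar>x\<bar>))) *s amplitude m \<eta> \<tau> k) $ 2
        = - \<i> * of_real R * ((of_real (h2 k) * \<Xi> k) * cis (k * y))" for k
    proof -
      have "((\<Xi> k * exp (\<i> * of_real (k * y) - of_real (w k * \<bar>x\<bar>))) *s amplitude m \<eta> \<tau> k) $ 2
        = - \<i> * of_real (sqrt ((1 + t) * (w k - k)) * exp (- (w k * \<bar>x\<bar>))) * \<Xi> k * cis (k * y)"
        unfolding ex by (simp add: amplitude_def mult_ac)
      then show ?thesis unfolding h by (simp add: mult_ac)
    qed
    have hi: "integrable lborel (\<lambda>k. of_real (h1 k) * \<Xi> k)" "integrable lborel (\<lambda>k. of_real (h2 k) * \<Xi> k)"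
      unfolding h1_def h2_def
      by (intro L2_integrable_mult weight_slice_L2 weight_mode mode_params \<Xi>; simp)+
    have int: "integrable lborel (\<lambda>k. (\<Xi> k * exp (\<i> * of_real (k * y) - of_real (w k * \<bar>x\<bar>))) *s amplitude m \<eta> \<tau> k)"
      by (rule complex2_integrable; unfold v1 v2; intro integrable_mult_right fourier_integrable hi)
    have I: "I $ i = (LBINT k. ((\<Xi> k * exp (\<i> * of_real (k * y) - of_real (w k * \<bar>x\<bar>))) *s amplitude m \<eta> \<tau> k) $ i)" for i
      unfolding I_def using integral_bounded_linear[OF bounded_linear_vec_nth int, of i] by simp
    have I1: "I $ 1 = of_real R * fourier (\<lambda>k. of_real (h1 k) * \<Xi> k) y"
      unfolding I v1 fourier_def by (rule integral_mult_right_zero)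
    have I2: "I $ 2 = - \<i> * of_real R * fourier (\<lambda>k. of_real (h2 k) * \<Xi> k) y"
      unfolding I v2 fourier_def by (rule integral_mult_right_zero)
    show ?thesis
    proof (cases "x < 0")
      case True
      have "g1 x k = h1 k" "g2 x k = h2 k" for k
        using True by (simp_all add: h1_def h2_def mode_def side_def)
      then show ?thesis
        using True R unfolding psi by (simp add: z heaviside_def \<sigma>\<^sub>0_def I1 I2 partial_fourier_def field_def scaleR_conv_of_real[where 'a=complex])
    next
      case F: False
      with False have x: "x > 0" by simp
      have g: "g1 x k = - ((\<eta> - \<tau>) / 2) * h2 k" "g2 x k = (\<eta> + \<tau>) / 2 * h1 k" for k
      proof -
        have "g1 x k = - (sgn \<eta> * sqrt ((1 - t) * (w k - k))) / R * exp (- (w k * \<bar>x\<bar>))"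
          using x by (simp add: mode_def side_def R_def)
        also have "\<dots> = - ((\<eta> - \<tau>) / 2) * h2 k"
          unfolding coupling_sqrt(1)[symmetric] using x by (simp add: h2_def mode_def side_def R_def)
        finally show "g1 x k = - ((\<eta> - \<tau>) / 2) * h2 k" .
        have "g2 x k = (sgn \<eta> * sqrt ((1 + t) * (w k + k))) / R * exp (- (w k * \<bar>x\<bar>))"
          using x by (simp add: mode_def side_def R_def)
        also have "\<dots> = (\<eta> + \<tau>) / 2 * h1 k"
          unfolding coupling_sqrt(2)[symmetric] using x by (simp add: h1_def mode_def side_def R_def)
        finally show "g2 x k = (\<eta> + \<tau>) / 2 * h1 k" .
      qed
      have "partial_fourier (field g1 \<Xi>) z = fourier (\<lambda>k. of_real (- ((\<eta> - \<tau>) / 2)) * (of_real (h2 k) * \<Xi> k)) y"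
        unfolding partial_fourier_def field_def z prod.case g by (simp only: of_real_mult mult.assoc)
      then have p1: "partial_fourier (field g1 \<Xi>) z = of_real (- ((\<eta> - \<tau>) / 2)) * fourier (\<lambda>k. of_real (h2 k) * \<Xi> k) y"
        unfolding fourier_cmult .
      have "partial_fourier (field g2 \<Xi>) z = fourier (\<lambda>k. of_real ((\<eta> + \<tau>) / 2) * (of_real (h1 k) * \<Xi> k)) y"
        unfolding partial_fourier_def field_def z prod.case g by (simp only: of_real_mult mult.assoc)
      then have p2: "partial_fourier (field g2 \<Xi>) z = of_real ((\<eta> + \<tau>) / 2) * fourier (\<lambda>k. of_real (h1 k) * \<Xi> k) y"
        unfolding fourier_cmult .
      have c1: "\<psi> m \<eta> \<tau> \<Xi> z $ 1 = of_real (1 / R) * ((- \<i> * of_real ((\<eta> - \<tau>) / 2)) * I $ 2)"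
        and c2: "\<psi> m \<eta> \<tau> \<Xi> z $ 2 = of_real (1 / R) * ((- \<i> * of_real ((\<eta> + \<tau>) / 2)) * I $ 1)"
        unfolding psi interface_matrix using x
        by (simp_all add: heaviside_def matrix_vector_mult_def sum_2 scaleR_conv_of_real[where 'a=complex])
      show ?thesis unfolding c1 c2 p1 p2 I1 I2 using R by (simp add: field_simps)
    qed
  qed
  then show "\<psi> m \<eta> \<tau> \<Xi> z $ 1 = partial_fourier (field g1 \<Xi>) z" "\<psi> m \<eta> \<tau> \<Xi> z $ 2 = - \<i> * partial_fourier (field g2 \<Xi>) z" by auto
qed

section \<open>The moments needed for each observable\<close>

lemma moment_norm:
  assumes c: "c \<ge> 0" and s: "\<bar>s\<bar> = 1" and \<epsilon>: "\<bar>\<epsilon>\<bar> = 1"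
  shows "has_bochner_integral lborel (\<lambda>x. mode c s \<epsilon> x k * mode c s \<epsilon> x k) (c / (4 * pi))"
proof -
  \<comment> \<open>The dependence on \<open>k\<close> cancels between the two half-lines. This is
    what makes the map from \<open>\<Xi>\<close> to \<open>\<psi>\<close> isometric.\<close>
  have "(w k - s * k) / (2 * w k) + (w k + s * k) / (2 * w k) = 1" using w_pos[of k] by (simp add: field_simps)
  then show ?thesis
    using mode_moment[OF assms, of k 1 0 0 1 0 0] by (simp add: power2_eq_square)
qed

text \<open>The odd factor \<open>x\<close> subtracts the contributions of the half-lines instead of
  adding them, so the terms in \<open>s * k\<close> are what survives.\<close>

lemma moment_x:
  assumes c: "c \<ge> 0" and s: "\<bar>s\<bar> = 1" and \<epsilon>: "\<bar>\<epsilon>\<bar> = 1"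
  shows "has_bochner_integral lborel (\<lambda>x. mode c s \<epsilon> x k * (x * mode c s \<epsilon> x k)) (c / (4 * pi) * (- s * k / (2 * (w k)\<^sup>2)))"
proof -
  have "(w k - s * k) * (1 / (4 * (w k)\<^sup>2)) + (w k + s * k) * (- 1 / (4 * (w k)\<^sup>2)) = - s * k / (2 * (w k)\<^sup>2)"
    using w_pos[of k] by (simp add: field_simps)
  moreover have "(mode c s \<epsilon> x k)\<^sup>2 * (if 0 < x then 0 + 1 * \<bar>x\<bar> + 0 * x\<^sup>2 else 0 + - 1 * \<bar>x\<bar> + 0 * x\<^sup>2) = mode c s \<epsilon> x k * (x * mode c s \<epsilon> x k)" for x
    by (auto simp: power2_eq_square)
  ultimately show ?thesis
    using mode_moment[OF assms, of k 0 1 0 0 "- 1" 0] by simp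
qed

lemma moment_xx:
  assumes c: "c \<ge> 0" and s: "\<bar>s\<bar> = 1" and \<epsilon>: "\<bar>\<epsilon>\<bar> = 1"
  shows "has_bochner_integral lborel (\<lambda>x. (x * mode c s \<epsilon> x k) * (x * mode c s \<epsilon> x k)) (c / (4 * pi) * (1 / (2 * (w k)\<^sup>2)))"
proof -
  have "(w k - s * k) * (1 / (4 * w k ^ 3)) + (w k + s * k) * (1 / (4 * w k ^ 3)) = 1 / (2 * (w k)\<^sup>2)"
    using w_pos[of k] by (simp add: field_simps power2_eq_square power3_eq_cube)
  moreover have "(mode c s \<epsilon> x k)\<^sup>2 * (if 0 < x then 0 + 0 * \<bar>x\<bar> + 1 * x\<^sup>2 else 0 + 0 * \<bar>x\<bar> + 1 * x\<^sup>2) = (x * mode c s \<epsilon> x k) * (x * mode c s \<epsilon> x k)" for x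
    by (auto simp: power2_eq_square)
  ultimately show ?thesis
    using mode_moment[OF assms, of k 0 0 1 0 0 1] by simp
qed

lemma abs_1_square: "\<bar>s::real\<bar> = 1 \<Longrightarrow> s * s = 1"
  by (metis abs_mult_self_eq mult_1)

text \<open>The first two integrals are half the \<open>k\<close>-derivative of the constant in
  \<open>moment_norm\<close>, hence 0; the proof checks this on the explicit moments. In the third,
  \<open>s * s = 1\<close> cancels the terms in \<open>k\<^sup>2\<close>; the remainder is the
  source of the summand with factor 1/4 in the variance of \<open>y\<close>.\<close>

lemma moment_dmode:
  assumes c: "c \<ge> 0" and s: "\<bar>s\<bar> = 1" and \<epsilon>: "\<bar>\<epsilon>\<bar> = 1"
  shows "has_bochner_integral lborel (\<lambda>x. mode c s \<epsilon> x k * dmode c s \<epsilon> x k) 0"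
    and "has_bochner_integral lborel (\<lambda>x. dmode c s \<epsilon> x k * mode c s \<epsilon> x k) 0"
    and "has_bochner_integral lborel (\<lambda>x. dmode c s \<epsilon> x k * dmode c s \<epsilon> x k) (c / (4 * pi) * (1 / (4 * (w k)\<^sup>2)))"
proof -
  let ?W = "w k"
  have ss: "s * s = 1" using s by (rule abs_1_square)
  have "(?W - s * k) * (- s / (2 * ?W) / (2 * ?W) + - k / ?W / (4 * ?W\<^sup>2) + 0 / (4 * ?W ^ 3))
      + (?W + s * k) * (s / (2 * ?W) / (2 * ?W) + - k / ?W / (4 * ?W\<^sup>2) + 0 / (4 * ?W ^ 3)) = (s * s - 1) * k / (2 * ?W\<^sup>2)"
    using w_pos[of k] by (simp add: field_simps power2_eq_square)
  then have eq: "(?W - s * k) * (- s / (2 * ?W) / (2 * ?W) + - k / ?W / (4 * ?W\<^sup>2) + 0 / (4 * ?W ^ 3))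
      + (?W + s * k) * (s / (2 * ?W) / (2 * ?W) + - k / ?W / (4 * ?W\<^sup>2) + 0 / (4 * ?W ^ 3)) = 0"
    using ss by simp
  have pt: "(mode c s \<epsilon> x k)\<^sup>2 * (if 0 < x then - s / (2 * ?W) + - k / ?W * \<bar>x\<bar> + 0 * x\<^sup>2 else s / (2 * ?W) + - k / ?W * \<bar>x\<bar> + 0 * x\<^sup>2)
    = mode c s \<epsilon> x k * dmode c s \<epsilon> x k" for x
  proof (cases "x = 0")
    case True then show ?thesis by (simp add: mode_def side_def)
  qed (auto simp: dmode_def log_deriv_def sgn_real_def power2_eq_square)
  show *: "has_bochner_integral lborel (\<lambda>x. mode c s \<epsilon> x k * dmode c s \<epsilon> x k) 0"
    using mode_moment[OF assms, of k "- s / (2 * ?W)" "- k / ?W" 0 "s / (2 * ?W)" "- k / ?W" 0]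
    unfolding pt eq by simp
  then show "has_bochner_integral lborel (\<lambda>x. dmode c s \<epsilon> x k * mode c s \<epsilon> x k) 0" by (simp add: mult.commute)
  have "(?W - s * k) * (1 / (4 * ?W\<^sup>2) / (2 * ?W) + s * k / ?W\<^sup>2 / (4 * ?W\<^sup>2) + k\<^sup>2 / ?W\<^sup>2 / (4 * ?W ^ 3))
      + (?W + s * k) * (1 / (4 * ?W\<^sup>2) / (2 * ?W) + - s * k / ?W\<^sup>2 / (4 * ?W\<^sup>2) + k\<^sup>2 / ?W\<^sup>2 / (4 * ?W ^ 3))
      = 1 / (4 * ?W\<^sup>2) + (1 - s * s) * k\<^sup>2 / (2 * ?W ^ 4)"
    using w_pos[of k] by (simp add: field_simps power2_eq_square power3_eq_cube eval_nat_numeral)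
  then have eq2: "(?W - s * k) * (1 / (4 * ?W\<^sup>2) / (2 * ?W) + s * k / ?W\<^sup>2 / (4 * ?W\<^sup>2) + k\<^sup>2 / ?W\<^sup>2 / (4 * ?W ^ 3))
      + (?W + s * k) * (1 / (4 * ?W\<^sup>2) / (2 * ?W) + - s * k / ?W\<^sup>2 / (4 * ?W\<^sup>2) + k\<^sup>2 / ?W\<^sup>2 / (4 * ?W ^ 3)) = 1 / (4 * ?W\<^sup>2)"
    using ss by simp
  have sq: "(log_deriv s x k)\<^sup>2 = (if 0 < x then 1 / (4 * ?W\<^sup>2) + s * k / ?W\<^sup>2 * \<bar>x\<bar> + k\<^sup>2 / ?W\<^sup>2 * x\<^sup>2 else 1 / (4 * ?W\<^sup>2) + - s * k / ?W\<^sup>2 * \<bar>x\<bar> + k\<^sup>2 / ?W\<^sup>2 * x\<^sup>2)"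
    if "x \<noteq> 0" for x
  proof -
    have sq: "(- (s * e) / (2 * ?W) - k * \<bar>x\<bar> / ?W)\<^sup>2 = (s * s) * (e * e) / (4 * ?W\<^sup>2) + s * e * k / ?W\<^sup>2 * \<bar>x\<bar> + k\<^sup>2 / ?W\<^sup>2 * x\<^sup>2" for e
      using w_pos[of k] by (simp add: power2_eq_square field_simps)
    show ?thesis unfolding log_deriv_def sq ss using that by (auto simp: sgn_real_def)
  qed
  have pt2: "(mode c s \<epsilon> x k)\<^sup>2 * (if 0 < x then 1 / (4 * ?W\<^sup>2) + s * k / ?W\<^sup>2 * \<bar>x\<bar> + k\<^sup>2 / ?W\<^sup>2 * x\<^sup>2 else 1 / (4 * ?W\<^sup>2) + - s * k / ?W\<^sup>2 * \<bar>x\<bar> + k\<^sup>2 / ?W\<^sup>2 * x\<^sup>2)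
    = dmode c s \<epsilon> x k * dmode c s \<epsilon> x k" for x
  proof (cases "x = 0")
    case True then show ?thesis by (simp add: dmode_def mode_def side_def)
  next
    case False
    show ?thesis unfolding sq[OF False, symmetric] by (simp add: dmode_def power2_eq_square)
  qed
  show "has_bochner_integral lborel (\<lambda>x. dmode c s \<epsilon> x k * dmode c s \<epsilon> x k) (c / (4 * pi) * (1 / (4 * (w k)\<^sup>2)))"
    using mode_moment[OF assms, of k "1 / (4 * ?W\<^sup>2)" "s * k / ?W\<^sup>2" "k\<^sup>2 / ?W\<^sup>2" "1 / (4 * ?W\<^sup>2)" "- s * k / ?W\<^sup>2" "k\<^sup>2 / ?W\<^sup>2"]
    unfolding pt2 eq2 .
qed

text \<open>The roots have the same product on both sides, because \<open>w k - k\<close> and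
  \<open>w k + k\<close> only trade places, while the signs of \<open>g1\<close> and
  \<open>g2\<close> give opposite signs to the half-lines. This is why the velocities average to
  0.\<close>

lemma moment_cross: "has_bochner_integral lborel (\<lambda>x. g1 x k * g2 x k) 0"
proof -
  define K where "K = 1 / (4 * pi) * (sqrt ((1 - t) * (w k - k)) * sqrt ((1 + t) * (w k + k)))"
  define L where "L = 1 / (4 * pi) * (sqrt ((1 - t) * (w k + k)) * sqrt ((1 + t) * (w k - k)))"
  have KL: "K = L" unfolding K_def L_def by (simp add: mult_ac flip: real_sqrt_mult)
  have "has_bochner_integral lborel
    (\<lambda>x. (if 0 < x then - K + 0 * \<bar>x\<bar> + 0 * x\<^sup>2 else if x < 0 then L + 0 * \<bar>x\<bar> + 0 * x\<^sup>2 else 0) * exp (- (2 * w k * \<bar>x\<bar>)))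
    ((- K + L) / (2 * w k) + (0 + 0) / (4 * (w k)\<^sup>2) + (0 + 0) / (4 * w k ^ 3))"
    by (rule quadratic_exp_integral[OF w_pos])
  moreover have "(if 0 < x then - K + 0 * \<bar>x\<bar> + 0 * x\<^sup>2 else if x < 0 then L + 0 * \<bar>x\<bar> + 0 * x\<^sup>2 else 0) * exp (- (2 * w k * \<bar>x\<bar>)) = g1 x k * g2 x k" for x
  proof -
    have ee: "exp (- (2 * w k * \<bar>x\<bar>)) = exp (- (w k * \<bar>x\<bar>)) * exp (- (w k * \<bar>x\<bar>))" by (simp flip: exp_add)
    have sg: "sgn \<eta> * sgn \<eta> = 1" using \<eta>_nz by (simp add: sgn_if)
    have sp: "sqrt pi * sqrt pi = pi" by simp
    consider "x > 0" | "x < 0" | "x = 0" by linarith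
    then show ?thesis
    proof cases
      case 1
      have "g1 x k * g2 x k = - (sgn \<eta> * sgn \<eta>) / (4 * (sqrt pi * sqrt pi)) * (sqrt ((1 - t) * (w k - k)) * sqrt ((1 + t) * (w k + k))) * (exp (- (w k * \<bar>x\<bar>)) * exp (- (w k * \<bar>x\<bar>)))"
        using 1 by (simp add: mode_def side_def)
      then show ?thesis using 1 unfolding sg sp ee by (simp add: K_def)
    next
      case 2
      have "g1 x k * g2 x k = 1 / (4 * (sqrt pi * sqrt pi)) * (sqrt ((1 - t) * (w k + k)) * sqrt ((1 + t) * (w k - k))) * (exp (- (w k * \<bar>x\<bar>)) * exp (- (w k * \<bar>x\<bar>)))"
        using 2 by (simp add: mode_def side_def)
      then show ?thesis using 2 unfolding sp ee by (simp add: L_def)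
    qed (simp add: mode_def side_def)
  qed
  ultimately show ?thesis using KL by simp
qed

end

section \<open>Expectation values and variances\<close>

lemma inner_self: "(\<integral>z. cnj (f z) * f z \<partial>M) = complex_of_real ((L2_norm M f)\<^sup>2)"
  unfolding L2_norm_squared integral_complex_of_real[symmetric]
  by (simp add: complex_norm_square[unfolded of_real_power] mult.commute)

lemma norm_matrix_op:
  "norm (matrix_op \<sigma>\<^sub>1 \<xi> z) = norm (\<xi> z)" "norm (matrix_op \<sigma>\<^sub>2 \<xi> z) = norm (\<xi> z)" "norm (matrix_op \<sigma>\<^sub>3 \<xi> z) = norm (\<xi> z)"
  by (simp_all add: norm_vec_def L2_set_def sum_2 matrix_op_def matrix_vector_mult_def \<sigma>\<^sub>1_def \<sigma>\<^sub>2_def \<sigma>\<^sub>3_def norm_mult add.commute)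

lemma L2_norm_matrix_op:
  "L2_norm M (matrix_op \<sigma>\<^sub>1 \<xi>) = L2_norm M \<xi>" "L2_norm M (matrix_op \<sigma>\<^sub>2 \<xi>) = L2_norm M \<xi>" "L2_norm M (matrix_op \<sigma>\<^sub>3 \<xi>) = L2_norm M \<xi>"
  by (simp_all add: L2_norm_def norm_matrix_op)

context dirac_line
begin

lemma weight_uminus: "weight g \<Longrightarrow> weight (\<lambda>x k. - g x k)"
  unfolding weight_def by simp

text \<open>Turns the inner product of two spinors into one integral over \<open>k\<close>:
  \<open>H\<close> collects the moments of both components together with the factor from
  Plancherel.\<close>

lemma pair_inner:
  assumes a: "weight a1" "weight a2" and b: "weight b1" "weight b2" and \<Xi>: "\<Xi> \<in> L2 lborel" and \<Theta>: "\<Theta> \<in> L2 lborel"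
    and h1: "\<And>k. has_bochner_integral lborel (\<lambda>x. a1 x k * b1 x k) (h1 k)"
    and h2: "\<And>k. has_bochner_integral lborel (\<lambda>x. a2 x k * b2 x k) (h2 k)"
    and H: "\<And>k. 2 * pi * (h1 k + h2 k) = H k"
  shows "of_real (2 * pi) * ((LBINT z. cnj (field a1 \<Xi> z) * field b1 \<Theta> z) + (LBINT z. cnj (field a2 \<Xi> z) * field b2 \<Theta> z))
    = (LBINT k. of_real (H k) * (cnj (\<Xi> k) * \<Theta> k))"
proof -
  note i1 = field_inner[OF a(1) \<Xi> b(1) \<Theta> h1] and i2 = field_inner[OF a(2) \<Xi> b(2) \<Theta> h2]
  have "of_real (2 * pi) * ((LBINT k. of_real (h1 k) * (cnj (\<Xi> k) * \<Theta> k)) + (LBINT k. of_real (h2 k) * (cnj (\<Xi> k) * \<Theta> k)))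
    = (LBINT k. of_real (2 * pi) * (of_real (h1 k) * (cnj (\<Xi> k) * \<Theta> k) + of_real (h2 k) * (cnj (\<Xi> k) * \<Theta> k)))"
    unfolding integral_mult_right_zero Bochner_Integration.integral_add[OF i1(2) i2(2)] ..
  also have "\<dots> = (LBINT k. of_real (H k) * (cnj (\<Xi> k) * \<Theta> k))"
    by (simp add: algebra_simps flip: H)
  finally show ?thesis unfolding i1(1) i2(1) .
qed

text \<open>The factor \<open>2 * pi\<close> from Plancherel against \<open>1 / (4 * pi)\<close>
  from the modes leaves \<open>(1 - t) / 2\<close> and \<open>(1 + t) / 2\<close>: for normalised
  \<open>\<Xi>\<close> these are the probabilities of the two spin components, with sum 1 and
  difference \<open>- t\<close>.\<close>

lemma weighted_sum:
  "2 * pi * ((1 - t) / (4 * pi) + (1 + t) / (4 * pi)) = 1"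
  "2 * pi * ((1 - t) / (4 * pi) + - ((1 + t) / (4 * pi))) = - t"
  "2 * pi * ((1 - t) / (4 * pi) * a + (1 + t) / (4 * pi) * a) = a"
  using pi_neq_zero by (simp_all add: divide_simps) (simp_all add: algebra_simps)

context
  fixes \<Xi> :: "real \<Rightarrow> complex"
  assumes \<Xi>: "\<Xi> \<in> L2 lborel"
begin

abbreviation \<Psi> :: spinor_field where "\<Psi> \<equiv> \<psi> m \<eta> \<tau> \<Xi>"

lemma psi_norm: "complex_of_real ((L2_norm lborel \<Psi>)\<^sup>2) = of_real ((L2_norm lborel \<Xi>)\<^sup>2)"
proof -
  have "complex_of_real ((L2_norm lborel \<Psi>)\<^sup>2) = (LBINT k. of_real 1 * (cnj (\<Xi> k) * \<Xi> k))"
    unfolding L2_norm_spinor spinor_of_inner[OF psi_spinor_of[OF \<Xi>] psi_spinor_of[OF \<Xi>]]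
    by (rule pair_inner[OF weights(1,2,1,2) \<Xi> \<Xi> moment_norm moment_norm]) (intro mode_params weighted_sum)+
  then show ?thesis by (simp add: inner_self)
qed

lemma expect_sigma3: "expect (matrix_op \<sigma>\<^sub>3) \<Psi> = of_real (- t) * of_real ((L2_norm lborel \<Xi>)\<^sup>2)"
proof -
  have eq: "field (\<lambda>x k. - g2 x k) \<Xi> = (\<lambda>z. - 1 * field g2 \<Xi> z)"
    by (auto simp: field_def)
  have "spinor_of (field g1 \<Xi>) (field (\<lambda>x k. - g2 x k) \<Xi>) (matrix_op \<sigma>\<^sub>3 \<Psi>)"
    unfolding spinor_of_def eq partial_fourier_cmult
    using spinor_ofD[OF psi_spinor_of[OF \<Xi>]] slicewise_L2_cmult[OF spinor_ofD(2)[OF psi_spinor_of[OF \<Xi>]], of "- 1"]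
    by (auto simp: matrix_op_def matrix_vector_mult_def \<sigma>\<^sub>3_def sum_2 simp del: split_paired_All)
  note sp = spinor_of_inner[OF psi_spinor_of[OF \<Xi>] this]
  have m: "has_bochner_integral lborel (\<lambda>x. g2 x k * - g2 x k) (- ((1 + t) / (4 * pi)))" for k
    using has_bochner_integral_minus[OF moment_norm[of "1 + t" "- 1" "sgn \<eta>" k]] mode_params by simp
  have "expect (matrix_op \<sigma>\<^sub>3) \<Psi> = (LBINT k. of_real (- t) * (cnj (\<Xi> k) * \<Xi> k))"
    unfolding expect_def sp
    by (rule pair_inner[OF weights(1,2,1) weight_uminus[OF weights(2)] \<Xi> \<Xi> moment_norm m]) (intro mode_params weighted_sum)+
  then show ?thesis by (simp add: inner_self)
qed

lemma expect_velocity: "expect vel_x \<Psi> = 0" "expect vel_y \<Psi> = 0"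
proof -
  note P = spinor_ofD[OF psi_spinor_of[OF \<Xi>]]
  have c12: "(LBINT z. cnj (field g1 \<Xi> z) * field g2 \<Xi> z) = 0"
    using field_inner(1)[OF weights(1) \<Xi> weights(2) \<Xi> moment_cross] by simp
  have c21: "(LBINT z. cnj (field g2 \<Xi> z) * field g1 \<Xi> z) = 0"
    using field_inner(1)[OF weights(2) \<Xi> weights(1) \<Xi>, of "\<lambda>_. 0"] moment_cross by (simp add: mult.commute)
  \<comment> \<open>Exchanging the components moves the split-off \<open>- \<i>\<close> into the
    first one and must create it in the second, whence the factor \<open>\<i>\<close> before
    \<open>field g1 \<Xi>\<close>.\<close>
  have "spinor_of (\<lambda>z. - \<i> * field g2 \<Xi> z) (\<lambda>z. \<i> * field g1 \<Xi> z) (vel_x \<Psi>)"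
    unfolding spinor_of_def partial_fourier_cmult
    using P slicewise_L2_cmult[OF P(2), of "- \<i>"] slicewise_L2_cmult[OF P(1), of \<i>]
    by (auto simp: vel_x_def matrix_op_def matrix_vector_mult_def \<sigma>\<^sub>1_def sum_2 simp del: split_paired_All simp flip: mult.assoc)
  note sp = spinor_of_inner[OF psi_spinor_of[OF \<Xi>] this]
  show "expect vel_x \<Psi> = 0"
    unfolding expect_def sp mult.left_commute[of "cnj _"] integral_mult_right_zero c12 c21 by simp
  have "spinor_of (\<lambda>z. - 1 * field g2 \<Xi> z) (\<lambda>z. - 1 * field g1 \<Xi> z) (vel_y \<Psi>)"
    unfolding spinor_of_def partial_fourier_cmult
    using P slicewise_L2_cmult[OF P(2), of "- 1"] slicewise_L2_cmult[OF P(1), of "- 1"]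
    by (auto simp: vel_y_def matrix_op_def matrix_vector_mult_def \<sigma>\<^sub>2_def sum_2 simp del: split_paired_All simp flip: mult.assoc)
  note sp = spinor_of_inner[OF psi_spinor_of[OF \<Xi>] this]
  show "expect vel_y \<Psi> = 0"
    unfolding expect_def sp mult.left_commute[of "cnj _"] integral_mult_right_zero c12 c21 by simp
qed

section \<open>The position \<open>x\<close>\<close>

lemma pos_x_spinor_of: "spinor_of (field (\<lambda>x k. x * g1 x k) \<Xi>) (field (\<lambda>x k. x * g2 x k) \<Xi>) (pos_x \<Psi>)"
proof -
  note P = spinor_ofD[OF psi_spinor_of[OF \<Xi>]]
  have pf: "partial_fourier (field (\<lambda>x k. x * g x k) \<Xi>) (x, y) = of_real x * partial_fourier (field g \<Xi>) (x, y)" for g x y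
    by (simp add: partial_fourier_def field_def fourier_cmult[symmetric] mult.assoc)
  have "pos_x \<Psi> (x, y) $ i = of_real x * \<Psi> (x, y) $ i" for x y i
    by (simp add: pos_x_def scaleR_conv_of_real[where 'a=complex])
  then show ?thesis
    unfolding spinor_of_def
    by (auto intro!: slicewise_L2_field weights \<Xi> simp: pf P)
qed

lemma psi_dom_x: "\<Psi> \<in> dom_x"
  using spinor_of_L2[OF psi_spinor_of[OF \<Xi>]] spinor_of_L2[OF pos_x_spinor_of] by (simp add: dom_x_def)

lemma expect_pos_x:
  "expect pos_x \<Psi> = of_real (\<tau> / (2 * \<eta>)) * L2_inner \<Xi> (\<lambda>k. of_real (k / (k\<^sup>2 + 4 * m\<^sup>2 / \<eta>\<^sup>2)) * \<Xi> k)"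
proof -
  have "expect pos_x \<Psi> = (LBINT k. of_real (\<tau> / (2 * \<eta>) * (k / (w k)\<^sup>2)) * (cnj (\<Xi> k) * \<Xi> k))"
    unfolding expect_def spinor_of_inner[OF psi_spinor_of[OF \<Xi>] pos_x_spinor_of]
  proof (rule pair_inner[OF weights(1,2,5,6) \<Xi> \<Xi> moment_x moment_x])
    show "2 * pi * ((1 - t) / (4 * pi) * (- 1 * k / (2 * (w k)\<^sup>2)) + (1 + t) / (4 * pi) * (- (- 1) * k / (2 * (w k)\<^sup>2)))
      = \<tau> / (2 * \<eta>) * (k / (w k)\<^sup>2)" for k
      by (simp add: field_simps)
  qed (use mode_params in auto)
  also have "\<dots> = (LBINT k. of_real (\<tau> / (2 * \<eta>)) * (cnj (\<Xi> k) * (of_real (k / (k\<^sup>2 + 4 * m\<^sup>2 / \<eta>\<^sup>2)) * \<Xi> k)))"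
    unfolding w_sq of_real_mult by (simp add: mult_ac)
  also have "\<dots> = of_real (\<tau> / (2 * \<eta>)) * L2_inner \<Xi> (\<lambda>k. of_real (k / (k\<^sup>2 + 4 * m\<^sup>2 / \<eta>\<^sup>2)) * \<Xi> k)"
    unfolding L2_inner_def by (rule integral_mult_right_zero)
  finally show ?thesis .
qed

lemma inverse_w_norm:
  "(LBINT k. of_real (C * (1 / (w k)\<^sup>2)) * (cnj (\<Xi> k) * \<Xi> k))
    = of_real (C * (L2_norm lborel (\<lambda>k. of_real (1 / sqrt (k\<^sup>2 + 4 * m\<^sup>2 / \<eta>\<^sup>2)) * \<Xi> k))\<^sup>2)"
proof -
  have "complex_of_real (C * (1 / (w k)\<^sup>2)) * (cnj (\<Xi> k) * \<Xi> k) = of_real C * (cnj (of_real (1 / w k) * \<Xi> k) * (of_real (1 / w k) * \<Xi> k))" for k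
    by (simp add: power2_eq_square)
  then have "(LBINT k. of_real (C * (1 / (w k)\<^sup>2)) * (cnj (\<Xi> k) * \<Xi> k)) = of_real C * (LBINT k. cnj (of_real (1 / w k) * \<Xi> k) * (of_real (1 / w k) * \<Xi> k))"
    by (simp only: integral_mult_right_zero)
  then show ?thesis unfolding inner_self \<omega>_def by simp
qed

lemma norm_pos_x:
  "complex_of_real ((L2_norm lborel (pos_x \<Psi>))\<^sup>2)
    = of_real (1/2 * (L2_norm lborel (\<lambda>k. of_real (1 / sqrt (k\<^sup>2 + 4 * m\<^sup>2 / \<eta>\<^sup>2)) * \<Xi> k))\<^sup>2)"
  unfolding L2_norm_spinor spinor_of_inner[OF pos_x_spinor_of pos_x_spinor_of] inverse_w_norm[symmetric]
proof (rule pair_inner[OF weights(5,6,5,6) \<Xi> \<Xi> moment_xx moment_xx])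
  show "2 * pi * ((1 - t) / (4 * pi) * (1 / (2 * (w k)\<^sup>2)) + (1 + t) / (4 * pi) * (1 / (2 * (w k)\<^sup>2))) = 1 / 2 * (1 / (w k)\<^sup>2)" for k
    by (simp add: field_simps)
qed (use mode_params in auto)

section \<open>The position \<open>y\<close>, given a weak derivative\<close>

context
  fixes d\<Xi> :: "real \<Rightarrow> complex"
  assumes d\<Xi>: "d\<Xi> \<in> L2 lborel" and deriv: "has_distributional_derivative \<Xi> d\<Xi>"
begin

lemma pos_y_spinor_of:
  "spinor_of (\<lambda>z. \<i> * (field dg1 \<Xi> z + field g1 d\<Xi> z)) (\<lambda>z. \<i> * (field dg2 \<Xi> z + field g2 d\<Xi> z)) (pos_y \<Psi>)"
proof -
  note P = spinor_ofD[OF psi_spinor_of[OF \<Xi>]]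
  have pf: "partial_fourier (\<lambda>z. field (dmode c s \<epsilon>) \<Xi> z + field (mode c s \<epsilon>) d\<Xi> z) (x, y) = - \<i> * (of_real y * partial_fourier  (field (mode c s \<epsilon>) \<Xi>) (x, y))"
    if "c > 0" "\<bar>s\<bar> = 1" "\<bar>\<epsilon>\<bar> = 1" for c s \<epsilon> x y
    unfolding partial_fourier_def field_def prod.case fourier_mode_derivative[OF that \<Xi> d\<Xi> deriv, of y x]
    by simp
  have "pos_y \<Psi> (x, y) $ i = of_real y * \<Psi> (x, y) $ i" for x y i
    by (simp add: pos_y_def scaleR_conv_of_real[where 'a=complex])
  then show ?thesis
    unfolding spinor_of_def partial_fourier_cmult
    by (auto intro!: slicewise_L2_cmult slicewise_L2_add slicewise_L2_field weights \<Xi> d\<Xi>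
        simp: pf[OF mode_params(1,5,7)] pf[OF mode_params(2,6,8)] P)
qed

lemma psi_dom_y: "\<Psi> \<in> dom_y"
  using spinor_of_L2[OF psi_spinor_of[OF \<Xi>]] spinor_of_L2[OF pos_y_spinor_of] by (simp add: dom_y_def)

lemma field_L2: "field g1 \<Xi> \<in> L2 lborel" "field g2 \<Xi> \<in> L2 lborel" "field dg1 \<Xi> \<in> L2 lborel" "field dg2 \<Xi> \<in> L2 lborel"
  "field g1 d\<Xi> \<in> L2 lborel" "field g2 d\<Xi> \<in> L2 lborel"
  using slicewise_L2_field weights \<Xi> d\<Xi> by (auto simp: slicewise_L2_def)

text \<open>By orthogonality of a mode to its \<open>k\<close>-derivative, the term in which the
  derivative falls on the mode contributes nothing; only the derivative of \<open>\<Xi>\<close>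
  remains.\<close>

lemma expect_pos_y: "expect pos_y \<Psi> = L2_inner \<Xi> (\<lambda>k. \<i> * d\<Xi> k)"
proof -
  have split: "(LBINT z. cnj (u z) * (\<i> * (a z + b z))) = \<i> * ((LBINT z. cnj (u z) * a z) + (LBINT z. cnj (u z) * b z))"
    if "u \<in> L2 lborel" "a \<in> L2 lborel" "b \<in> L2 lborel" for u a b :: "real \<times> real \<Rightarrow> complex"
    unfolding Bochner_Integration.integral_add[OF L2_integrable_mult[OF L2_cnj[OF that(1)] that(2)] L2_integrable_mult[OF L2_cnj[OF that(1)] that(3)], symmetric]
      integral_mult_right_zero[symmetric] by (simp add: algebra_simps)
  have z: "of_real (2 * pi) * ((LBINT z. cnj (field g1 \<Xi> z) * field dg1 \<Xi> z) + (LBINT z. cnj (field g2 \<Xi> z) * field dg2 \<Xi> z))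
      = (LBINT k. of_real 0 * (cnj (\<Xi> k) * \<Xi> k))"
    by (rule pair_inner[OF weights(1-4) \<Xi> \<Xi> moment_dmode(1) moment_dmode(1)]) (use mode_params in auto)
  have o: "of_real (2 * pi) * ((LBINT z. cnj (field g1 \<Xi> z) * field g1 d\<Xi> z) + (LBINT z. cnj (field g2 \<Xi> z) * field g2 d\<Xi> z))
      = (LBINT k. of_real 1 * (cnj (\<Xi> k) * d\<Xi> k))"
    by (rule pair_inner[OF weights(1,2,1,2) \<Xi> d\<Xi> moment_norm moment_norm]) (intro mode_params weighted_sum)+
  have "expect pos_y \<Psi> = \<i> * (of_real (2 * pi) * ((LBINT z. cnj (field g1 \<Xi> z) * field dg1 \<Xi> z) + (LBINT z. cnj (field g2 \<Xi> z) * field dg2 \<Xi> z))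
      + of_real (2 * pi) * ((LBINT z. cnj (field g1 \<Xi> z) * field g1 d\<Xi> z) + (LBINT z. cnj (field g2 \<Xi> z) * field g2 d\<Xi> z)))"
    unfolding expect_def spinor_of_inner[OF psi_spinor_of[OF \<Xi>] pos_y_spinor_of]
      split[OF field_L2(1,3,5)] split[OF field_L2(2,4,6)] by (simp add: algebra_simps)
  also have "\<dots> = \<i> * (LBINT k. cnj (\<Xi> k) * d\<Xi> k)" unfolding z o by simp
  also have "\<dots> = L2_inner \<Xi> (\<lambda>k. \<i> * d\<Xi> k)"
    unfolding L2_inner_def integral_mult_right_zero[symmetric] by (simp add: mult.left_commute)
  finally show ?thesis .
qed

text \<open>Of the four terms of the expanded square, the two mixed ones vanish already for each
  fixed \<open>k\<close>. The derivative of the modes then contributes the quarter of the weighted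
  norm, the derivative of \<open>\<Xi>\<close> its own norm.\<close>

lemma norm_pos_y:
  "complex_of_real ((L2_norm lborel (pos_y \<Psi>))\<^sup>2)
    = of_real ((L2_norm lborel (\<lambda>k. \<i> * d\<Xi> k))\<^sup>2
        + 1/4 * (L2_norm lborel (\<lambda>k. of_real (1 / sqrt (k\<^sup>2 + 4 * m\<^sup>2 / \<eta>\<^sup>2)) * \<Xi> k))\<^sup>2)"
proof -
  define J where "J u v = (\<integral>z. cnj (u z) * v z \<partial>(lborel :: (real \<times> real) measure))" for u v :: "real \<times> real \<Rightarrow> complex"
  have split: "J (\<lambda>z. \<i> * (a z + b z)) (\<lambda>z. \<i> * (a z + b z)) = J a a + J a b + J b a + J b b"
    if a: "a \<in> L2 lborel" and b: "b \<in> L2 lborel" for a b :: "real \<times> real \<Rightarrow> complex"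
  proof -
    have i: "integrable lborel (\<lambda>z. cnj (u z) * v z)" if "u \<in> L2 lborel" "v \<in> L2 lborel" for u v :: "real \<times> real \<Rightarrow> complex"
      using that by (intro L2_integrable_mult L2_cnj)
    have "cnj (\<i> * (p + q)) * (\<i> * (p + q)) = cnj p * p + cnj p * q + cnj q * p + cnj q * q" for p q :: complex
      by (simp add: complex_eq_iff algebra_simps)
    then show ?thesis
      unfolding J_def using i[OF a a] i[OF a b] i[OF b a] i[OF b b] by simp
  qed
  have dd: "of_real (2 * pi) * (J (field dg1 \<Xi>) (field dg1 \<Xi>) + J (field dg2 \<Xi>) (field dg2 \<Xi>)) = (LBINT k. of_real (1/4 * (1 / (w k)\<^sup>2)) * (cnj (\<Xi> k) * \<Xi> k))"
    unfolding J_def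
  proof (rule pair_inner[OF weights(3,4,3,4) \<Xi> \<Xi> moment_dmode(3) moment_dmode(3)])
    show "2 * pi * ((1 - t) / (4 * pi) * (1 / (4 * (w k)\<^sup>2)) + (1 + t) / (4 * pi) * (1 / (4 * (w k)\<^sup>2))) = 1/4 * (1 / (w k)\<^sup>2)" for k
      by (subst weighted_sum(3)) simp
  qed (use mode_params in auto)
  have dg: "of_real (2 * pi) * (J (field dg1 \<Xi>) (field g1 d\<Xi>) + J (field dg2 \<Xi>) (field g2 d\<Xi>)) = (LBINT k. of_real 0 * (cnj (\<Xi> k) * d\<Xi> k))"
    unfolding J_def
    by (rule pair_inner[OF weights(3,4,1,2) \<Xi> d\<Xi> moment_dmode(2) moment_dmode(2)]) (use mode_params in auto)
  have gd: "of_real (2 * pi) * (J (field g1 d\<Xi>) (field dg1 \<Xi>) + J (field g2 d\<Xi>) (field dg2 \<Xi>)) = (LBINT k. of_real 0 * (cnj (d\<Xi> k) * \<Xi> k))"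
    unfolding J_def
    by (rule pair_inner[OF weights(1-4) d\<Xi> \<Xi> moment_dmode(1) moment_dmode(1)]) (use mode_params in auto)
  have gg: "of_real (2 * pi) * (J (field g1 d\<Xi>) (field g1 d\<Xi>) + J (field g2 d\<Xi>) (field g2 d\<Xi>)) = (LBINT k. of_real 1 * (cnj (d\<Xi> k) * d\<Xi> k))"
    unfolding J_def
    by (rule pair_inner[OF weights(1,2,1,2) d\<Xi> d\<Xi> moment_norm moment_norm]) (intro mode_params weighted_sum)+
  have "complex_of_real ((L2_norm lborel (pos_y \<Psi>))\<^sup>2)
    = of_real (2 * pi) * (J (field dg1 \<Xi>) (field dg1 \<Xi>) + J (field dg2 \<Xi>) (field dg2 \<Xi>))
    + of_real (2 * pi) * (J (field dg1 \<Xi>) (field g1 d\<Xi>) + J (field dg2 \<Xi>) (field g2 d\<Xi>))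
    + of_real (2 * pi) * (J (field g1 d\<Xi>) (field dg1 \<Xi>) + J (field g2 d\<Xi>) (field dg2 \<Xi>))
    + of_real (2 * pi) * (J (field g1 d\<Xi>) (field g1 d\<Xi>) + J (field g2 d\<Xi>) (field g2 d\<Xi>))"
    unfolding L2_norm_spinor spinor_of_inner[OF pos_y_spinor_of pos_y_spinor_of] J_def[symmetric]
      split[OF field_L2(3,5)] split[OF field_L2(4,6)] by (simp add: algebra_simps)
  also have "\<dots> = of_real (1/4 * (L2_norm lborel (\<lambda>k. of_real (1 / sqrt (k\<^sup>2 + 4 * m\<^sup>2 / \<eta>\<^sup>2)) * \<Xi> k))\<^sup>2) + of_real ((L2_norm lborel d\<Xi>)\<^sup>2)"
    unfolding dd dg gd gg inverse_w_norm by (simp add: inner_self)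
  also have "L2_norm lborel d\<Xi> = L2_norm lborel (\<lambda>k. \<i> * d\<Xi> k)"
    by (simp add: L2_norm_def norm_mult)
  finally show ?thesis by simp
qed

end

end

end

section \<open>From the domain of \<open>y\<close> to the weak derivative\<close>

lemma L2_indicator_Icc: "(\<lambda>k::real. indicator {a..b} k :: real) \<in> L2 lborel"
proof -
  have "(norm (indicator {a..b} k :: real))\<^sup>2 = indicator {a..b} k" for k by (simp add: indicator_def)
  then show ?thesis by (simp add: L2_def emeasure_lborel_Icc_eq)
qed

lemma L2_locally_integrable:
  assumes f: "f \<in> L2 lborel"
  shows "locally_integrable f"
  unfolding locally_integrable_def set_integrable_def
proof (intro allI)
  fix a b :: real
  have "(\<lambda>k. complex_of_real (indicator {a..b} k)) \<in> L2 lborel"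
    by (rule L2_bound[OF L2_indicator_Icc[of a b], where C=1]) auto
  from L2_integrable_mult[OF this f] show "integrable lborel (\<lambda>k. indicator {a..b} k *\<^sub>R f k)"
    by (simp add: scaleR_conv_of_real)
qed

lemma continuous_compact_support:
  fixes h :: "real \<Rightarrow> complex"
  assumes h: "continuous_on UNIV h" and K: "compact K" "\<And>k. k \<notin> K \<Longrightarrow> h k = 0"
  obtains B where "\<And>k. norm (h k) \<le> B" "h \<in> L2 lborel"
proof -
  have "bounded (h ` K)"
    using compact_imp_bounded[OF compact_continuous_image[OF continuous_on_subset[OF h] K(1)]] by simp
  then obtain B where B: "B > 0" "\<And>k. k \<in> K \<Longrightarrow> norm (h k) \<le> B" unfolding bounded_pos by blast
  then have hB: "norm (h k) \<le> B" for k using K(2)[of k] by (cases "k \<in> K") auto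
  obtain a where a: "\<And>k. k \<in> K \<Longrightarrow> \<bar>k\<bar> \<le> a" using compact_imp_bounded[OF K(1)] unfolding bounded_real by blast
  have "h \<in> L2 lborel"
  proof (rule L2_bound[OF L2_indicator_Icc[of "- a" a]])
    show "h \<in> borel_measurable lborel" using borel_measurable_continuous_onI[OF h] by simp
    show "AE k in lborel. norm (h k) \<le> B * norm (indicator {- a..a} k :: real)"
    proof (rule AE_I2)
      fix k
      have "k \<notin> K" if "k \<notin> {- a..a}" using a[of k] that by (auto simp: abs_le_iff)
      then show "norm (h k) \<le> B * norm (indicator {- a..a} k :: real)"
        using hB[of k] K(2)[of k] by (cases "k \<in> {- a..a}") simp_all
    qed
  qed
  then show ?thesis using that hB by blast
qed

lemma test_function_derivative:
  assumes "test_function \<phi>"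
  obtains \<phi>' K where "\<And>k. (\<phi> has_vector_derivative \<phi>' k) (at k)" "continuous_on UNIV \<phi>" "continuous_on UNIV \<phi>'"
    "compact K" "\<And>k. k \<notin> K \<Longrightarrow> \<phi> k = 0" "\<And>k. k \<notin> K \<Longrightarrow> \<phi>' k = 0"
proof -
  obtain D where D: "D (0::nat) = \<phi>" "\<And>n t. (D n has_vector_derivative D (Suc n) t) (at t)"
    and K: "compact (closure {t. \<phi> t \<noteq> 0})"
    using assms unfolding test_function_def by blast
  have cont: "continuous_on UNIV (D n)" for n
    using D(2) by (intro continuous_at_imp_continuous_on ballI has_vector_derivative_continuous)
  define C where "C = closure {t. \<phi> t \<noteq> 0}"
  have C: "compact C" "open (- C)" using K closed_closure[of "{t. \<phi> t \<noteq> 0}"] unfolding C_def by (simp_all only: open_Compl)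
  have z: "\<phi> k = 0" if "k \<notin> C" for k
    using that closure_subset[of "{t. \<phi> t \<noteq> 0}"] unfolding C_def by blast
  \<comment> \<open>The complement of the closed support is open, so the derivative vanishes there
    as well.\<close>
  have z': "D 1 k = 0" if k: "k \<notin> C" for k
  proof -
    have "((\<lambda>_. 0) has_vector_derivative (0::complex)) (at k)" by simp
    then have "(\<phi> has_vector_derivative 0) (at k)"
      by (rule has_vector_derivative_transform_within_open[OF _ C(2)]) (simp_all add: k z)
    moreover have "(\<phi> has_vector_derivative D 1 k) (at k)" using D(2)[of 0 k] by (simp add: D(1))
    ultimately show ?thesis by (rule vector_derivative_unique_at[symmetric])
  qed
  show ?thesis
  proof (rule that[of "D 1" C])
    show "(\<phi> has_vector_derivative D 1 k) (at k)" for k using D(2)[of 0 k] by (simp add: D(1))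
    show "continuous_on UNIV \<phi>" using cont[of 0] by (simp add: D(1))
  qed (use cont C z z' in auto)
qed

text \<open>In this form of the product rule the shift falls on \<open>G\<close>, which will be
  continuous, and never on the merely measurable \<open>f\<close>.\<close>

lemma diffquot_mult:
  "diffquot n (\<lambda>k. G k * f k) k = G (k + 1 / real (Suc n)) * diffquot n f k + f k * diffquot n G k"
  by (simp add: diffquot_def algebra_simps)

context dirac_line
begin

lemma mode_neq_0:
  assumes "c > 0" "\<bar>s\<bar> = 1" "\<bar>\<epsilon>\<bar> = 1" "x \<noteq> 0"
  shows "mode c s \<epsilon> x k \<noteq> 0"
  using assms mode_arg_pos[OF assms(2), of k x] by (auto simp: mode_def side_def)

lemma continuous_on_w: "continuous_on UNIV w"
  unfolding \<omega>_def[abs_def] by (intro continuous_intros)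

lemma continuous_on_mode: "continuous_on UNIV (mode c s \<epsilon> x)"
  unfolding mode_def[abs_def] \<omega>_def[abs_def] by (intro continuous_intros) auto

lemma continuous_on_log_deriv: "continuous_on UNIV (log_deriv s x)"
  unfolding log_deriv_def[abs_def] by (intro continuous_intros continuous_on_w) simp_all

context
  fixes \<Xi> :: "real \<Rightarrow> complex"
  assumes \<Xi>: "\<Xi> \<in> L2 lborel"
begin

text \<open>A quotient rule for weak derivatives: testing \<open>\<Xi>\<close> with
  \<open>\<phi>\<close> amounts to testing \<open>G k * \<Xi> k\<close> with
  \<open>\<phi> k / G k\<close>. The mode has no zeros off the line, and compact support of
  \<open>\<phi>\<close> neutralises the growth of its inverse.\<close>

lemma weak_derivative_quotient:
  fixes c s \<epsilon> x :: real
  defines "G \<equiv> \<lambda>k. complex_of_real (mode c s \<epsilon> x k)"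
  assumes c: "c > 0" "\<bar>s\<bar> = 1" "\<bar>\<epsilon>\<bar> = 1" "x \<noteq> 0"
    and g: "g \<in> L2 lborel"
    and lim: "(\<lambda>n. \<integral>k. (norm (diffquot n (\<lambda>k. G k * \<Xi> k) k - g k))\<^sup>2 \<partial>lborel) \<longlonglongrightarrow> 0"
    and d\<Xi>: "d\<Xi> \<in> L2 lborel" "\<And>k. d\<Xi> k = g k / G k - of_real (log_deriv s x k) * \<Xi> k"
  shows "has_distributional_derivative \<Xi> d\<Xi>"
  unfolding has_distributional_derivative_def
proof (intro conjI allI impI L2_locally_integrable \<Xi> d\<Xi>(1))
  fix \<phi> assume "test_function \<phi>"
  then obtain \<phi>' K where \<phi>: "\<And>k. (\<phi> has_vector_derivative \<phi>' k) (at k)" "continuous_on UNIV \<phi>" "continuous_on UNIV \<phi>'"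
    "compact K" "\<And>k. k \<notin> K \<Longrightarrow> \<phi> k = 0" "\<And>k. k \<notin> K \<Longrightarrow> \<phi>' k = 0"
    using test_function_derivative by metis
  define L where "L k = complex_of_real (log_deriv s x k)" for k
  have nz: "mode c s \<epsilon> x k \<noteq> 0" for k using mode_neq_0[OF c] .
  have Gnz: "G k \<noteq> 0" for k using nz by (simp add: G_def)
  have contG: "continuous_on UNIV G" "continuous_on UNIV L"
    unfolding G_def L_def by (intro continuous_intros continuous_on_mode continuous_on_log_deriv)+
  define \<zeta> where "\<zeta> k = \<phi> k / G k" for k
  define \<zeta>' where "\<zeta>' k = (\<phi>' k - \<phi> k * L k) / G k" for k
  have \<zeta>: "(\<zeta> has_vector_derivative \<zeta>' k) (at k)" for k
  proof -
    have "((\<lambda>k. 1 / mode c s \<epsilon> x k) has_real_derivative - dmode c s \<epsilon> x k / (mode c s \<epsilon> x k * mode c s \<epsilon> x k)) (at k)"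
      using mode_has_derivative[OF c(1,2), of \<epsilon> x k] nz[of k] by (auto intro!: derivative_eq_intros)
    from has_vector_derivative_mult[OF \<phi>(1) has_vector_derivative_of_real[OF this]]
    moreover have "(\<lambda>k. \<phi> k * complex_of_real (1 / mode c s \<epsilon> x k)) = \<zeta>"
      by (simp add: \<zeta>_def G_def fun_eq_iff)
    moreover have "\<phi> k * of_real (- dmode c s \<epsilon> x k / (mode c s \<epsilon> x k * mode c s \<epsilon> x k)) + \<phi>' k * of_real (1 / mode c s \<epsilon> x k) = \<zeta>' k"
      using nz[of k] by (simp add: \<zeta>'_def G_def L_def dmode_def field_simps)
    ultimately show ?thesis by (simp only:)
  qed
  have cont: "continuous_on UNIV \<zeta>" "continuous_on UNIV \<zeta>'" "continuous_on UNIV (\<lambda>k. L k * \<phi> k)"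
    unfolding \<zeta>_def[abs_def] \<zeta>'_def[abs_def] by (intro continuous_intros \<phi> contG; simp add: Gnz)+
  obtain \<zeta>L: "\<zeta> \<in> L2 lborel"
    using continuous_compact_support[OF cont(1) \<phi>(4)] \<phi>(5) by (auto simp: \<zeta>_def)
  have "\<zeta>' k = 0" if "k \<notin> K" for k using \<phi>(5,6)[OF that] by (simp add: \<zeta>'_def)
  then obtain B where B: "\<And>k. norm (\<zeta>' k) \<le> B"
    using continuous_compact_support[OF cont(2) \<phi>(4)] by blast
  have \<phi>'L: "\<phi>' \<in> L2 lborel"
    using continuous_compact_support[OF \<phi>(3,4,6)] by blast
  have L\<phi>: "(\<lambda>k. L k * \<phi> k) \<in> L2 lborel"
    using continuous_compact_support[OF cont(3) \<phi>(4)] \<phi>(5) by auto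
  have GL: "G \<in> L2 lborel" unfolding G_def using c by (intro weight_slice_L2 weight_mode) auto
  have G\<Xi>: "integrable lborel (\<lambda>k. G k * \<Xi> k)" "(\<lambda>k. G k * \<Xi> k) \<in> L2 lborel"
    using slicewise_L2_field[OF weight_mode \<Xi>, of c s \<epsilon>] c by (simp_all add: slicewise_L2_def field_def G_def)
  have weak: "(LBINT k. g k * \<zeta> k) = - (LBINT k. (G k * \<Xi> k) * \<zeta>' k)"
    by (rule diffquot_weak_limit[OF G\<Xi> g lim \<zeta>L \<zeta> B])
  have "(G k * \<Xi> k) * \<zeta>' k = \<Xi> k * \<phi>' k - \<Xi> k * (L k * \<phi> k)" for k
    using Gnz[of k] by (simp add: \<zeta>'_def field_simps)
  then have e1: "(LBINT k. (G k * \<Xi> k) * \<zeta>' k) = (LBINT k. \<Xi> k * \<phi>' k) - (LBINT k. \<Xi> k * (L k * \<phi> k))"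
    using L2_integrable_mult[OF \<Xi> \<phi>'L] L2_integrable_mult[OF \<Xi> L\<phi>] by simp
  have "d\<Xi> k * \<phi> k = g k * \<zeta> k - \<Xi> k * (L k * \<phi> k)" for k
    using Gnz[of k] by (simp add: d\<Xi>(2) \<zeta>_def L_def field_simps)
  then have e2: "(LBINT k. d\<Xi> k * \<phi> k) = (LBINT k. g k * \<zeta> k) - (LBINT k. \<Xi> k * (L k * \<phi> k))"
    using L2_integrable_mult[OF g \<zeta>L] L2_integrable_mult[OF \<Xi> L\<phi>] by simp
  have "vector_derivative \<phi> (at k) = \<phi>' k" for k using \<phi>(1) by (rule vector_derivative_at)
  then show "(LBINT k. \<Xi> k * vector_derivative \<phi> (at k)) = - (LBINT k. d\<Xi> k * \<phi> k)"
    unfolding e2 weak e1 by simp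
qed

text \<open>The argument runs on the first component, whose norm is at most that of the spinor and
  whose modes have the positive coefficient \<open>1 - t\<close>. The candidate is built on one
  slice; that it is square integrable is then shown by returning to all slices.\<close>

lemma dom_y_imp_weak_derivative:
  assumes dom: "\<psi> m \<eta> \<tau> \<Xi> \<in> dom_y"
  shows "\<exists>d\<Xi>\<in>L2 lborel. has_distributional_derivative \<Xi> d\<Xi>"
proof -
  have [measurable]: "\<Xi> \<in> borel_measurable borel" using \<Xi> by (auto simp: L2_def)
  have gm[measurable]: "(\<lambda>k. g1 x k) \<in> borel_measurable borel" "(\<lambda>k. dg1 x k) \<in> borel_measurable borel" for x
    using weight_slice_measurable weights by auto
  define G where "G x k = complex_of_real (g1 x k)" for x k
  define Y where "Y z = snd z *\<^sub>R partial_fourier (field g1 \<Xi>) z" for z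
  have [measurable]: "field g1 \<Xi> \<in> borel_measurable borel" by (rule field_measurable[OF weights(1)]) measurable
  have [measurable]: "partial_fourier (field g1 \<Xi>) \<in> borel_measurable (borel \<Otimes>\<^sub>M borel)"
    unfolding borel_prod by measurable
  have "Y \<in> borel_measurable (borel \<Otimes>\<^sub>M borel)" unfolding Y_def[abs_def] by measurable
  then have [measurable]: "Y \<in> borel_measurable borel" by (simp add: borel_prod)
  have Y: "Y \<in> L2 lborel"
  proof (rule L2_bound[where C=1])
    show "pos_y (\<psi> m \<eta> \<tau> \<Xi>) \<in> L2 lborel" using dom by (simp add: dom_y_def)
    have "norm (Y z) \<le> norm (pos_y (\<psi> m \<eta> \<tau> \<Xi>) z)" for z
    proof -
      have "Y z = pos_y (\<psi> m \<eta> \<tau> \<Xi>) z $ 1"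
        by (simp add: Y_def pos_y_def case_prod_unfold spinor_ofD(3)[OF psi_spinor_of[OF \<Xi>]])
      then show ?thesis using Finite_Cartesian_Product.norm_nth_le by metis
    qed
    then show "AE z in lborel. norm (Y z) \<le> 1 * norm (pos_y (\<psi> m \<eta> \<tau> \<Xi>) z)" by simp
  qed simp
  define M where "M x = (\<integral>\<^sup>+y. ennreal ((norm (y *\<^sub>R fourier (\<lambda>k. G x k * \<Xi> k) y))\<^sup>2) \<partial>lborel)" for x
  have M: "M x = (\<integral>\<^sup>+y. ennreal ((norm (Y (x, y)))\<^sup>2) \<partial>lborel)" for x
    by (simp add: M_def Y_def partial_fourier_def field_def G_def)
  have Mint: "(\<integral>\<^sup>+x. M x \<partial>lborel) < \<infinity>"
    unfolding M using Y by (subst nn_integral_lborel_iterated(1)) (auto simp: L2_iff_nn_integral)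
  have "M \<in> borel_measurable lborel"
    unfolding M[abs_def] by (rule lborel.borel_measurable_nn_integral) (simp add: case_prod_unfold lborel_prod)
  then have [measurable]: "M \<in> borel_measurable borel" by simp
  \<comment> \<open>Almost every slice has finite \<open>M x\<close>, so one can be chosen off the
    line \<open>x = 0\<close>, where the mode has no zeros.\<close>
  have "AE x in lborel. M x \<noteq> \<infinity>"
    using Mint by (intro nn_integral_noteq_infinite) auto
  then have "AE x in lborel. M x \<noteq> \<infinity> \<and> x \<noteq> 0"
    using AE_lborel_singleton[of 0] by eventually_elim simp
  moreover have "ae_filter (lborel :: real measure) \<noteq> bot" by (simp add: ae_filter_eq_bot_iff)
  ultimately have "\<exists>x. M x \<noteq> \<infinity> \<and> x \<noteq> 0" by (rule eventually_happens'[rotated])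
  then obtain x0 where x0: "M x0 \<noteq> \<infinity>" "x0 \<noteq> 0" by blast
  have slice: "integrable lborel (\<lambda>k. G x k * \<Xi> k)" "(\<lambda>k. G x k * \<Xi> k) \<in> L2 lborel" for x
    using slicewise_L2_field[OF weights(1) \<Xi>] by (simp_all add: slicewise_L2_def field_def G_def)
  have "(\<lambda>y. y *\<^sub>R fourier (\<lambda>k. G x0 k * \<Xi> k) y) \<in> L2 lborel"
    using x0(1) slice(1)[of x0] unfolding M_def by (auto simp: L2_iff_nn_integral less_top)
  then obtain r g where r: "strict_mono r" and g: "g \<in> L2 lborel"
    and AEg: "AE k in lborel. (\<lambda>j. diffquot (r j) (\<lambda>k. G x0 k * \<Xi> k) k) \<longlonglongrightarrow> g k"
    and limg: "(\<lambda>n. \<integral>k. (norm (diffquot n (\<lambda>k. G x0 k * \<Xi> k) k - g k))\<^sup>2 \<partial>lborel) \<longlonglongrightarrow> 0"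
    using diffquot_L2_convergent[OF slice] by blast
  note [measurable] = L2_measurable[OF g]
  have [measurable]: "(\<lambda>k. log_deriv s x k) \<in> borel_measurable borel" for s x
    by (rule borel_measurable_continuous_onI[OF continuous_on_log_deriv])
  \<comment> \<open>The quotient rule applied to \<open>G x0 k * \<Xi> k\<close>. Since
    \<open>G x0\<close> decays exponentially, this says nothing yet about square
    integrability.\<close>
  define d\<Xi> where "d\<Xi> k = g k / G x0 k - of_real (log_deriv 1 x0 k) * \<Xi> k" for k
  have d\<Xi>m[measurable]: "d\<Xi> \<in> borel_measurable borel" unfolding d\<Xi>_def[abs_def] G_def by measurable
  have Gd: "(\<lambda>j. diffquot (r j) (G x) k) \<longlonglongrightarrow> of_real (dg1 x k)" for x k
  proof -
    have "((\<lambda>k. complex_of_real (g1 x k)) has_vector_derivative of_real (dg1 x k)) (at k)"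
      using mode_has_derivative[OF mode_params(1,5), of "- sgn \<eta>" x k]
      by (intro has_vector_derivative_of_real) (simp add: has_real_derivative_iff_has_vector_derivative)
    from LIMSEQ_subseq_LIMSEQ[OF diffquot_tendsto[OF this] r] show ?thesis by (simp add: G_def[abs_def] comp_def)
  qed
  have Gs: "(\<lambda>j. G x (k + 1 / real (Suc (r j)))) \<longlonglongrightarrow> G x k" for x k
  proof -
    have "(\<lambda>n. 1 / real (Suc n)) \<longlonglongrightarrow> 0" using LIMSEQ_inverse_real_of_nat by (simp add: inverse_eq_divide)
    from LIMSEQ_subseq_LIMSEQ[OF this r] have "(\<lambda>j. k + 1 / real (Suc (r j))) \<longlonglongrightarrow> k + 0"
      by (intro tendsto_intros) (simp add: comp_def)
    moreover have "isCont (G x) (k + 0)"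
      using continuous_on_mode unfolding G_def[abs_def] by (intro continuous_intros) (simp add: continuous_on_eq_continuous_at)
    ultimately show ?thesis by (metis isCont_tendsto_compose add_0_right)
  qed
  have Gnz: "G x0 k \<noteq> 0" for k
    unfolding G_def using mode_neq_0[OF mode_params(1,5,7) x0(2)] by simp
  \<comment> \<open>Dividing the product rule by the shifted mode yields the quotients of
    \<open>\<Xi>\<close> alone. This limit no longer involves \<open>x0\<close>, so it can be
    carried to every other slice.\<close>
  have AEd: "AE k in lborel. (\<lambda>j. diffquot (r j) \<Xi> k) \<longlonglongrightarrow> d\<Xi> k"
    using AEg
  proof eventually_elim
    case (elim k)
    have "(\<lambda>j. (diffquot (r j) (\<lambda>k. G x0 k * \<Xi> k) k - \<Xi> k * diffquot (r j) (G x0) k) / G x0 (k + 1 / real (Suc (r j))))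
      \<longlonglongrightarrow> (g k - \<Xi> k * of_real (dg1 x0 k)) / G x0 k"
      by (intro tendsto_intros elim Gd Gs Gnz)
    moreover have "(g k - \<Xi> k * of_real (dg1 x0 k)) / G x0 k = d\<Xi> k"
      using Gnz[of k] by (simp add: d\<Xi>_def G_def dmode_def field_simps)
    ultimately show ?case using Gnz by (simp add: diffquot_mult del: of_nat_Suc)
  qed
  \<comment> \<open>On each slice the product rule gives the pointwise limit, and Fatou's lemma
    transfers the Plancherel bound by \<open>M x\<close>, trivially where \<open>M x\<close> is
    infinite.\<close>
  have slice_le: "(\<integral>\<^sup>+k. ennreal ((norm (G x k * d\<Xi> k + of_real (dg1 x k) * \<Xi> k))\<^sup>2) \<partial>lborel) \<le> M x" for x
  proof (rule nn_integral_Fatou_bound)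
    show "diffquot (r j) (\<lambda>k. G x k * \<Xi> k) \<in> borel_measurable lborel" for j
      using diffquot_L2[OF slice(2)] by (auto simp: L2_def)
    show "AE k in lborel. (\<lambda>j. diffquot (r j) (\<lambda>k. G x k * \<Xi> k) k) \<longlonglongrightarrow> G x k * d\<Xi> k + of_real (dg1 x k) * \<Xi> k"
      using AEd
    proof eventually_elim
      case (elim k)
      have "(\<lambda>j. diffquot (r j) (\<lambda>k. G x k * \<Xi> k) k) \<longlonglongrightarrow> G x k * d\<Xi> k + \<Xi> k * of_real (dg1 x k)"
        unfolding diffquot_mult by (intro tendsto_intros elim Gd Gs)
      then show ?case by (simp add: mult.commute)
    qed
    show "\<forall>\<^sub>F j in sequentially. (\<integral>\<^sup>+k. ennreal ((norm (diffquot (r j) (\<lambda>k. G x k * \<Xi> k) k))\<^sup>2) \<partial>lborel) \<le> M x"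
    proof (intro always_eventually allI)
      fix j
      let ?I = "\<integral>\<^sup>+k. ennreal ((norm (diffquot (r j) (\<lambda>k. G x k * \<Xi> k) k))\<^sup>2) \<partial>lborel"
      have "ennreal 1 * ?I \<le> ennreal (2 * pi) * ?I"
        using pi_ge_two by (intro mult_right_mono ennreal_leI) auto
      also have "\<dots> \<le> M x" unfolding M_def by (rule diffquot_nn_integral_le[OF slice])
      finally show "?I \<le> M x" by simp
    qed
  qed
  have fm[measurable]: "field g1 d\<Xi> \<in> borel_measurable borel" "field dg1 \<Xi> \<in> borel_measurable borel"
    by (rule field_measurable[OF weights(1) d\<Xi>m], rule field_measurable[OF weights(3)]) measurable
  have "(\<integral>\<^sup>+z. ennreal ((norm (field g1 d\<Xi> z + field dg1 \<Xi> z))\<^sup>2) \<partial>lborel)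
      = (\<integral>\<^sup>+x. (\<integral>\<^sup>+k. ennreal ((norm (field g1 d\<Xi> (x, k) + field dg1 \<Xi> (x, k)))\<^sup>2) \<partial>lborel) \<partial>lborel)"
    by (subst nn_integral_lborel_iterated(1)) measurable
  also have "\<dots> = (\<integral>\<^sup>+x. (\<integral>\<^sup>+k. ennreal ((norm (G x k * d\<Xi> k + of_real (dg1 x k) * \<Xi> k))\<^sup>2) \<partial>lborel) \<partial>lborel)"
    by (simp add: field_def G_def)
  also have "\<dots> \<le> (\<integral>\<^sup>+x. M x \<partial>lborel)" by (intro nn_integral_mono slice_le)
  finally have "(\<lambda>z. field g1 d\<Xi> z + field dg1 \<Xi> z) \<in> L2 lborel"
    using Mint by (simp add: L2_iff_nn_integral)
  \<comment> \<open>The derivative of the mode times \<open>\<Xi>\<close> is square integrable in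
    any case; subtracting it isolates the field of \<open>d\<Xi>\<close>.\<close>
  then have "(\<lambda>z. field g1 d\<Xi> z + field dg1 \<Xi> z - field dg1 \<Xi> z) \<in> L2 lborel"
    using slicewise_L2_field[OF weights(3) \<Xi>] by (intro L2_diff) (auto simp: slicewise_L2_def)
  then have "(\<integral>\<^sup>+z. ennreal ((norm (field g1 d\<Xi> z))\<^sup>2) \<partial>lborel) < \<infinity>" by (simp add: L2_iff_nn_integral)
  also have "(\<integral>\<^sup>+z. ennreal ((norm (field g1 d\<Xi> z))\<^sup>2) \<partial>lborel)
      = (\<integral>\<^sup>+k. (\<integral>\<^sup>+x. ennreal ((norm (field g1 d\<Xi> (x, k)))\<^sup>2) \<partial>lborel) \<partial>lborel)"
    by (subst nn_integral_lborel_iterated(2)) measurable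
  \<comment> \<open>The integral of the squared mode over \<open>x\<close> is the same positive
    constant for every \<open>k\<close>, so finiteness of the double integral is exactly square
    integrability of \<open>d\<Xi>\<close>.\<close>
  also have "\<dots> = (\<integral>\<^sup>+k. ennreal ((1 - t) / (4 * pi)) * ennreal ((norm (d\<Xi> k))\<^sup>2) \<partial>lborel)"
  proof (rule nn_integral_cong)
    fix k
    have "(\<integral>\<^sup>+x. ennreal ((norm (field g1 d\<Xi> (x, k)))\<^sup>2) \<partial>lborel)
      = (\<integral>\<^sup>+x. ennreal ((norm (d\<Xi> k))\<^sup>2) * ennreal (g1 x k * g1 x k) \<partial>lborel)"
      by (simp add: field_def norm_mult power_mult_distrib ennreal_mult' mult.commute flip: power2_eq_square)
    also have "\<dots> = ennreal ((norm (d\<Xi> k))\<^sup>2) * (\<integral>\<^sup>+x. ennreal (g1 x k * g1 x k) \<partial>lborel)"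
      using weight_slice_measurable(2)[OF weights(1)] by (intro nn_integral_cmult) simp
    also have "(\<integral>\<^sup>+x. ennreal (g1 x k * g1 x k) \<partial>lborel) = ennreal ((1 - t) / (4 * pi))"
      using moment_norm[OF mode_params(3,5,7), of k]
      by (simp add: nn_integral_eq_integral has_bochner_integral_iff)
    finally show "(\<integral>\<^sup>+x. ennreal ((norm (field g1 d\<Xi> (x, k)))\<^sup>2) \<partial>lborel) = ennreal ((1 - t) / (4 * pi)) * ennreal ((norm (d\<Xi> k))\<^sup>2)"
      by (simp add: mult.commute)
  qed
  also have "\<dots> = ennreal ((1 - t) / (4 * pi)) * (\<integral>\<^sup>+k. ennreal ((norm (d\<Xi> k))\<^sup>2) \<partial>lborel)"
    by (rule nn_integral_cmult) simp
  finally have "d\<Xi> \<in> L2 lborel"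
    using mode_params(1) by (auto simp: L2_iff_nn_integral ennreal_mult_less_top)
  moreover from this have "has_distributional_derivative \<Xi> d\<Xi>"
    by (intro weak_derivative_quotient[OF mode_params(1,5,7) x0(2) g]) (use limg in \<open>simp_all add: d\<Xi>_def G_def\<close>)
  ultimately show ?thesis by blast
qed

end

end

theorem corollary1p1:
  fixes m \<eta> \<tau> :: real and \<Xi> :: "real \<Rightarrow> complex"
  assumes "m > 0"
    and "\<eta>\<^sup>2 - \<tau>\<^sup>2 = 4"
    and "\<Xi> \<in> L2 lborel"
  shows "\<psi> m \<eta> \<tau> \<Xi> \<in> dom_x \<and>
    (\<psi> m \<eta> \<tau> \<Xi> \<in> dom_y \<longleftrightarrow>
       \<Xi> \<in> L2 lborel \<and> (\<exists>d\<Xi> \<in> L2 lborel. has_distributional_derivative \<Xi> d\<Xi>)) \<and>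
    (L2_norm lborel \<Xi> = 1 \<longrightarrow>
       expect (matrix_op \<sigma>\<^sub>3) (\<psi> m \<eta> \<tau> \<Xi>) = of_real (- \<tau> / \<eta>) \<and>
       var (matrix_op \<sigma>\<^sub>3) (\<psi> m \<eta> \<tau> \<Xi>) = of_real (4 / \<eta>\<^sup>2) \<and>
       expect pos_x (\<psi> m \<eta> \<tau> \<Xi>) =
         of_real (\<tau> / (2 * \<eta>)) * L2_inner \<Xi> (\<lambda>k. of_real (k / (k\<^sup>2 + 4 * m\<^sup>2 / \<eta>\<^sup>2)) * \<Xi> k) \<and>
       var pos_x (\<psi> m \<eta> \<tau> \<Xi>) =
         of_real (1/2 * (L2_norm lborel (\<lambda>k. of_real (1 / sqrt (k\<^sup>2 + 4 * m\<^sup>2 / \<eta>\<^sup>2)) * \<Xi> k))\<^sup>2)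
         - of_real (\<tau>\<^sup>2 / (4 * \<eta>\<^sup>2)) *
           (L2_inner \<Xi> (\<lambda>k. of_real (k / (k\<^sup>2 + 4 * m\<^sup>2 / \<eta>\<^sup>2)) * \<Xi> k))\<^sup>2 \<and>
       (\<forall>d\<Xi> \<in> L2 lborel. has_distributional_derivative \<Xi> d\<Xi> \<longrightarrow>
          expect pos_y (\<psi> m \<eta> \<tau> \<Xi>) = L2_inner \<Xi> (\<lambda>k. \<i> * d\<Xi> k) \<and>
          var pos_y (\<psi> m \<eta> \<tau> \<Xi>) =
            of_real ((L2_norm lborel (\<lambda>k. \<i> * d\<Xi> k))\<^sup>2
              + 1/4 * (L2_norm lborel (\<lambda>k. of_real (1 / sqrt (k\<^sup>2 + 4 * m\<^sup>2 / \<eta>\<^sup>2)) * \<Xi> k))\<^sup>2)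
            - (L2_inner \<Xi> (\<lambda>k. \<i> * d\<Xi> k))\<^sup>2) \<and>
       expect vel_x (\<psi> m \<eta> \<tau> \<Xi>) = 0 \<and>
       expect vel_y (\<psi> m \<eta> \<tau> \<Xi>) = 0 \<and>
       var vel_x (\<psi> m \<eta> \<tau> \<Xi>) = 1 \<and>
       var vel_y (\<psi> m \<eta> \<tau> \<Xi>) = 1)"
proof -
  interpret dirac_line m \<eta> \<tau> using assms(1,2) by unfold_locales
  note \<Xi> = assms(3)
  have norm: "complex_of_real ((L2_norm lborel (\<psi> m \<eta> \<tau> \<Xi>))\<^sup>2) = 1" if "L2_norm lborel \<Xi> = 1"
    using psi_norm[OF \<Xi>] that by simp
  have sigma3: "expect (matrix_op \<sigma>\<^sub>3) (\<psi> m \<eta> \<tau> \<Xi>) = of_real (- \<tau> / \<eta>)" if "L2_norm lborel \<Xi> = 1"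
    using expect_sigma3[OF \<Xi>] that by simp
  \<comment> \<open>Pauli matrices preserve the norm, so the variance is 1 minus the squared
    expectation; criticality turns this into \<open>4 / \<eta>\<^sup>2\<close>.\<close>
  have var_sigma3: "var (matrix_op \<sigma>\<^sub>3) (\<psi> m \<eta> \<tau> \<Xi>) = of_real (4 / \<eta>\<^sup>2)" if "L2_norm lborel \<Xi> = 1"
  proof -
    have "var (matrix_op \<sigma>\<^sub>3) (\<psi> m \<eta> \<tau> \<Xi>) = of_real (1 - (\<tau> / \<eta>)\<^sup>2)"
      unfolding var_def L2_norm_matrix_op norm[OF that] sigma3[OF that] by simp
    then show ?thesis unfolding t_square .
  qed
  have var_x: "var pos_x (\<psi> m \<eta> \<tau> \<Xi>) =
         of_real (1/2 * (L2_norm lborel (\<lambda>k. of_real (1 / sqrt (k\<^sup>2 + 4 * m\<^sup>2 / \<eta>\<^sup>2)) * \<Xi> k))\<^sup>2)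
         - of_real (\<tau>\<^sup>2 / (4 * \<eta>\<^sup>2)) *
           (L2_inner \<Xi> (\<lambda>k. of_real (k / (k\<^sup>2 + 4 * m\<^sup>2 / \<eta>\<^sup>2)) * \<Xi> k))\<^sup>2"
    unfolding var_def norm_pos_x[OF \<Xi>] expect_pos_x[OF \<Xi>] by (simp add: power_mult_distrib power_divide)
  have var_v: "var vel_x (\<psi> m \<eta> \<tau> \<Xi>) = 1" "var vel_y (\<psi> m \<eta> \<tau> \<Xi>) = 1" if "L2_norm lborel \<Xi> = 1"
    unfolding var_def expect_velocity[OF \<Xi>] unfolding vel_x_def vel_y_def L2_norm_matrix_op norm[OF that] by simp_all
  have y: "expect pos_y (\<psi> m \<eta> \<tau> \<Xi>) = L2_inner \<Xi> (\<lambda>k. \<i> * d\<Xi> k) \<and>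
      var pos_y (\<psi> m \<eta> \<tau> \<Xi>) =
            of_real ((L2_norm lborel (\<lambda>k. \<i> * d\<Xi> k))\<^sup>2
              + 1/4 * (L2_norm lborel (\<lambda>k. of_real (1 / sqrt (k\<^sup>2 + 4 * m\<^sup>2 / \<eta>\<^sup>2)) * \<Xi> k))\<^sup>2)
            - (L2_inner \<Xi> (\<lambda>k. \<i> * d\<Xi> k))\<^sup>2"
    if "d\<Xi> \<in> L2 lborel" "has_distributional_derivative \<Xi> d\<Xi>" for d\<Xi>
    unfolding var_def norm_pos_y[OF \<Xi> that] expect_pos_y[OF \<Xi> that] by simp
  show ?thesis
    using psi_dom_x[OF \<Xi>] psi_dom_y[OF \<Xi>] dom_y_imp_weak_derivative[OF \<Xi>] \<Xi> sigma3 var_sigma3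
      expect_pos_x[OF \<Xi>] var_x y expect_velocity[OF \<Xi>] var_v by blast
qed

end
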